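(* Let $n\geq 2$ be an integer and let $K \in C(\mathbb{R}^{2n})$, $K\not\equiv 0$, be nonpositive and satisfy $$|K(x)| \leq C(|x|^\lambda + 1) \quad \text{in } \mathbb{R}^{2n}, \quad \text{for some } C > 0,\ \lambda \geq 0.$$ Assume that $\alpha_1(K)>0$. Then for any $\alpha \in (0, \alpha_1(K))$, there exists a solution $u_{\alpha}$ to $$(-\Delta)^n u = K(x)e^{2nu} \quad \text{in } \mathbb{R}^{2n}$$ such that $$\lim_{|x|\to \infty}\big[u_\alpha(x) - \alpha\ln |x|\big] = \ell \quad\text{for some } \ell \in \mathbb{R}.$$
   Context: $\alpha_1(K) := \sup\{\beta \in \mathbb{R} : K(x)(1+ |x|)^{2n\beta} \in L^1(\mathbb{R}^{2n})\}$, where the value $+\infty$ is allowed. A solution is a continuous function satisfying the equation in the sense of distributions. *)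

theory Defs
  imports "HOL-Analysis.Analysis"
begin

definition partial_deriv :: "'a::euclidean_space \<Rightarrow> ('a \<Rightarrow> real) \<Rightarrow> 'a \<Rightarrow> real" where
  "partial_deriv b f x = deriv (\<lambda>t. f (x + t *\<^sub>R b)) 0"

primrec Ck :: "nat \<Rightarrow> ('a::euclidean_space \<Rightarrow> real) \<Rightarrow> bool" where
  "Ck 0 f \<longleftrightarrow> continuous_on UNIV f"
| "Ck (Suc k) f \<longleftrightarrow> f differentiable_on UNIV \<and> (\<forall>b\<in>Basis. Ck k (partial_deriv b f))"

definition test_function :: "('a::euclidean_space \<Rightarrow> real) \<Rightarrow> bool" where
  "test_function \<phi> \<longleftrightarrow> (\<forall>k. Ck k \<phi>) \<and> compact (closure {x. \<phi> x \<noteq> 0})"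

definition laplacian :: "('a::euclidean_space \<Rightarrow> real) \<Rightarrow> 'a \<Rightarrow> real" where
  "laplacian f x = (\<Sum>b\<in>Basis. partial_deriv b (partial_deriv b f) x)"

definition neg_laplacian_pow :: "nat \<Rightarrow> ('a::euclidean_space \<Rightarrow> real) \<Rightarrow> 'a \<Rightarrow> real" where
  "neg_laplacian_pow n = (\<lambda>f x. - laplacian f x) ^^ n"

(* A continuous u solves (-Laplacian)^n u = K e^{2nu} in the sense of distributions.
   The polyharmonic operator is formally self-adjoint, so no sign appears when it is
   moved onto the test function.  Both integrands are continuous with compact support
   whenever K is continuous. *)
definition is_solution :: "nat \<Rightarrow> ('a::euclidean_space \<Rightarrow> real) \<Rightarrow> ('a \<Rightarrow> real) \<Rightarrow> bool" where
  "is_solution n K u \<longleftrightarrow> continuous_on UNIV u \<and>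
     (\<forall>\<phi>. test_function \<phi> \<longrightarrow>
        (\<integral>x. u x * neg_laplacian_pow n \<phi> x \<partial>lebesgue) =
        (\<integral>x. K x * exp (2 * real n * u x) * \<phi> x \<partial>lebesgue))"

(* The supremum is taken in the extended reals: it is \<infinity> if every \<beta> is admissible,
   and -\<infinity> if none is. *)
definition alpha1 :: "nat \<Rightarrow> ('a::euclidean_space \<Rightarrow> real) \<Rightarrow> ereal" where
  "alpha1 n K = Sup (ereal ` {\<beta>::real. integrable lebesgue (\<lambda>x. K x * (1 + norm x) powr (2 * real n * \<beta>))})"

end

theory Submission
  imports Defs "HOL-Complex_Analysis.Great_Picard"
begin

text \<open>
  For \<open>d = 2n\<close> the logarithm is, up to a negative constant \<open>-\<gamma>\<close>, the fundamental solution of the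
  polyharmonic operator, so it suffices to find a density \<open>f = - K e\<^sup>2\<^sup>n\<^sup>u / (\<alpha>\<gamma>)\<close> of total mass 1 such that
  \<open>u(x) = \<alpha> \<integral> (ln |x - y| - ln (1 + |y|)) f(y) dy + c\<close>. Put \<open>h = |K| (1 + |x|)\<^sup>2\<^sup>n\<^sup>\<alpha>\<close>, which is integrable
  because \<open>\<alpha> < \<alpha>\<^sub>1(K)\<close>, and \<open>w = 2n (u - c - \<alpha> ln (1 + |x|))\<close>. With the symmetric kernel
  \<open>k(x,y) = ln |x - y| - ln (1 + |x|) - ln (1 + |y|) \<le> 0\<close> the problem becomes the mean field equation
  \<open>w(x) = 2n\<alpha> \<integral> k(x,y) e\<^sup>w\<^sup>(\<^sup>y\<^sup>) h(y) dy / \<integral> e\<^sup>w h\<close>. If \<open>k\<close> is averaged over the cells of a finite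
  partition, this is the Euler--Lagrange equation of entropy minus interaction energy on a simplex
  and a minimiser exists by compactness; no fixed point theorem is needed. Since \<open>k \<le> 0\<close>, Jensen's
  inequality bounds \<open>\<integral> e\<^sup>w h\<close> from below and hence the densities from above uniformly in the partition, so
  the potentials are equicontinuous and a subsequence converges to a solution. The uniform estimates
  for \<open>k\<close> and the asymptotics of \<open>u\<close> come from Young's inequality
  \<open>a b \<le> \<tau> e\<^sup>a + b ln (1 + b/\<tau>)\<close> with \<open>a = ln (1/|x - y|)\<close>, \<open>b = h(y)\<close>, the polynomial growth of \<open>K\<close> making
  \<open>h ln (1 + h/\<tau>)\<close> integrable.
\<close>

section \<open>Test functions and integration by parts\<close>

text \<open>The sign of \<open>K\<close> shapes the argument. It makes the coupling to the
  nonpositive kernel positive, so \<open>w\<close> is nonpositive and \<open>e^w\<close> is at most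
  1; only the normalising integral then has to be bounded, and from below. With the opposite sign
  \<open>e^w\<close> would have no a priori bound. The exponent in \<open>h\<close> comes from the
  normalisation of the kernel: since \<open>f\<close> has mass 1, subtracting
  \<open>ln (1 + |x|)\<close> from the kernel costs exactly that term in the potential, and after
  multiplication by \<open>2 n \<alpha>\<close> and exponentiation it becomes the weight in
  \<open>h\<close>. The obstacle is that \<open>h\<close> may be unbounded at infinity, where the
  singularity of \<open>ln |x - y|\<close> then meets large values. Young's inequality with a free
  parameter \<open>\<tau>\<close> replaces the missing supremum bound. It costs a logarithmic moment
  of \<open>h\<close>, which is paid for by an admissible exponent strictly above
  \<open>\<alpha>\<close>. The mean field equation does not see the constant \<open>c\<close>; it is
  fixed only at the end, by matching \<open>e^(2nc)\<close> with \<open>\<alpha> \<gamma>\<close>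
  divided by the normalising integral.\<close>

lemma integral_lborel_translate:
  fixes f :: "'a::euclidean_space \<Rightarrow> real"
  assumes [measurable]: "f \<in> borel_measurable borel"
  shows "(\<integral>x. f (x + c) \<partial>lborel) = (\<integral>x. f x \<partial>lborel)"
proof -
  have "(\<integral>x. f x \<partial>lborel) = (\<integral>x. f x \<partial>distr lborel borel ((+) c))"
    by (simp add: lborel_distr_plus)
  also have "\<dots> = (\<integral>x. f (c + x) \<partial>lborel)"
    by (rule integral_distr) auto
  finally show ?thesis by (simp add: add.commute)
qed

lemma integrable_compact_support:
  fixes f :: "'a::euclidean_space \<Rightarrow> real"
  assumes f: "continuous_on UNIV f" and supp: "\<And>x. norm x > R \<Longrightarrow> f x = 0"
  shows "integrable lborel f"
proof -
  have "integrable lborel (\<lambda>x. indicator (cball 0 R) x *\<^sub>R f x)"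
    by (rule borel_integrable_compact) (use f continuous_on_subset in auto)
  also have "(\<lambda>x. indicator (cball 0 R) x *\<^sub>R f x) = f"
    using supp by (force simp: indicator_def not_le)
  finally show ?thesis .
qed

lemma compact_support_bounded:
  fixes f :: "'a::euclidean_space \<Rightarrow> real"
  assumes f: "continuous_on UNIV f" and supp: "\<And>x. norm x > R \<Longrightarrow> f x = 0"
  obtains M where "M \<ge> 0" "\<And>x. \<bar>f x\<bar> \<le> M"
proof -
  have "compact (f ` cball 0 R)"
    by (rule compact_continuous_image) (use f continuous_on_subset in auto)
  then obtain M where M: "\<And>x. x \<in> cball 0 R \<Longrightarrow> \<bar>f x\<bar> \<le> M"
    using compact_imp_bounded bounded_iff by (metis imageI real_norm_def)
  have "\<bar>f x\<bar> \<le> max M 0" for x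
    using M[of x] supp[of x] by (cases "norm x > R") auto
  then show ?thesis using that[of "max M 0"] by auto
qed

lemma has_real_derivative_along:
  fixes F :: "'a::euclidean_space \<Rightarrow> real"
  assumes "\<And>x. ((\<lambda>t. F (x + t *\<^sub>R b)) has_real_derivative F' x) (at 0)"
  shows "((\<lambda>t. F (x + t *\<^sub>R b)) has_real_derivative F' (x + t *\<^sub>R b)) (at t)"
proof -
  have "((\<lambda>s. F ((x + t *\<^sub>R b) + s *\<^sub>R b)) has_real_derivative F' (x + t *\<^sub>R b)) (at 0)"
    by (rule assms)
  then have "((\<lambda>s. F (x + (s + t) *\<^sub>R b)) has_real_derivative F' (x + t *\<^sub>R b)) (at 0)"
    by (simp add: algebra_simps)
  then show ?thesis
    using DERIV_shift[of "\<lambda>s. F (x + s *\<^sub>R b)" _ 0 t] by simp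
qed

text \<open>Translation invariance gives every difference quotient the integral zero. The mean value
  theorem bounds the quotients by \<open>M\<close>, and steps of length at most 1 keep their
  supports in the ball of radius \<open>R + 1\<close>, so dominated convergence carries the zero
  over to \<open>F'\<close>.\<close>

lemma integral_directional_derivative:
  fixes F F' :: "'a::euclidean_space \<Rightarrow> real"
  assumes b: "b \<in> Basis"
    and D: "\<And>x. ((\<lambda>t. F (x + t *\<^sub>R b)) has_real_derivative F' x) (at 0)"
    and cF: "continuous_on UNIV F" and cF': "continuous_on UNIV F'"
    and sF: "\<And>x. norm x > R \<Longrightarrow> F x = 0" and sF': "\<And>x. norm x > R \<Longrightarrow> F' x = 0"
  shows "(\<integral>x. F' x \<partial>lborel) = 0"
proof -
  obtain M where M: "M \<ge> 0" "\<And>x. \<bar>F' x\<bar> \<le> M"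
    using compact_support_bounded[OF cF' sF'] by metis
  have [measurable]: "F \<in> borel_measurable borel" "F' \<in> borel_measurable borel"
    using cF cF' by (auto intro: borel_measurable_continuous_onI)
  define s where "s i x = (F (x + (1 / Suc i) *\<^sub>R b) - F x) * Suc i" for i x
  have [measurable]: "s i \<in> borel_measurable borel" for i
    unfolding s_def by measurable
  have bound: "\<bar>s i x\<bar> \<le> M * indicator (cball 0 (R + 1)) x" for i x
  proof -
    have "\<exists>z>0. z < 1 / Suc i \<and> F (x + (1 / Suc i) *\<^sub>R b) - F (x + 0 *\<^sub>R b) = (1 / Suc i - 0) * F' (x + z *\<^sub>R b)"
      by (rule MVT2) (use has_real_derivative_along[OF D] in auto)
    then obtain z where "F (x + (1 / Suc i) *\<^sub>R b) - F x = (1 / Suc i) * F' (x + z *\<^sub>R b)" by auto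
    then have "\<bar>s i x\<bar> \<le> M" using M(2) by (simp add: s_def)
    moreover have "s i x = 0" if "norm x > R + 1"
    proof -
      have "norm ((1 / Suc i) *\<^sub>R b) \<le> 1" using b by (simp add: field_simps)
      then have "norm (x + (1 / Suc i) *\<^sub>R b) > R"
        using that norm_diff_ineq[of x "(1 / Suc i) *\<^sub>R b"] by linarith
      then show ?thesis using sF that by (simp add: s_def)
    qed
    ultimately show ?thesis by (auto simp: indicator_def not_le)
  qed
  have lim: "(\<lambda>i. s i x) \<longlonglongrightarrow> F' x" for x
  proof -
    have "((\<lambda>h. (F (x + h *\<^sub>R b) - F x) / h) \<longlongrightarrow> F' x) (at 0)"
      using D[of x] by (simp add: has_field_derivative_iff)
    moreover have "filterlim (\<lambda>i. 1 / real (Suc i)) (at 0) sequentially"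
      using LIMSEQ_Suc[OF lim_1_over_n] by (auto simp: filterlim_at)
    ultimately have "(\<lambda>i. (F (x + (1 / Suc i) *\<^sub>R b) - F x) / (1 / Suc i)) \<longlonglongrightarrow> F' x"
      by (rule filterlim_compose)
    then show ?thesis by (simp add: s_def)
  qed
  have "(\<lambda>i. \<integral>x. s i x \<partial>lborel) \<longlonglongrightarrow> (\<integral>x. F' x \<partial>lborel)"
  proof (rule integral_dominated_convergence[where w = "\<lambda>x. M * indicator (cball 0 (R + 1)) x"])
    show "integrable lborel (\<lambda>x::'a. M * indicator (cball 0 (R + 1)) x)"
      by (intro integrable_mult_right integrable_real_indicator) (use emeasure_lborel_cball_finite in \<open>auto simp: infinity_ennreal_def\<close>)
  qed (use bound lim in auto)
  moreover have "(\<integral>x. s i x \<partial>lborel) = 0" for i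
  proof -
    have int: "integrable lborel F" by (rule integrable_compact_support[OF cF sF])
    have sh: "integrable lborel (\<lambda>x. F (x + (1 / Suc i) *\<^sub>R b))"
    proof (rule integrable_compact_support)
      show "continuous_on UNIV (\<lambda>x. F (x + (1 / Suc i) *\<^sub>R b))"
        by (rule continuous_on_compose2[OF cF]) (auto intro!: continuous_intros)
      show "F (x + (1 / Suc i) *\<^sub>R b) = 0" if "norm x > R + norm ((1 / Suc i) *\<^sub>R b)" for x
        using that norm_diff_ineq[of x "(1 / Suc i) *\<^sub>R b"] by (intro sF) linarith
    qed
    have "(\<integral>x. s i x \<partial>lborel) = ((\<integral>x. F (x + (1 / Suc i) *\<^sub>R b) \<partial>lborel) - (\<integral>x. F x \<partial>lborel)) * Suc i"
      unfolding s_def using int sh by simp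
    then show ?thesis by (simp add: integral_lborel_translate)
  qed
  ultimately show ?thesis by (simp add: LIMSEQ_const_iff)
qed

section \<open>Calculus of C^k functions and test functions\<close>

lemma Ck_continuous_on: "Ck k f \<Longrightarrow> continuous_on UNIV f"
  by (cases k) (auto intro: differentiable_imp_continuous_on)

text \<open>\<open>deriv\<close> merely selects a value, so differentiability along the line is what
  turns \<open>partial_deriv\<close> into a genuine derivative.\<close>

lemma partial_deriv_has_derivative:
  fixes f :: "'a::euclidean_space \<Rightarrow> real"
  assumes "f differentiable_on UNIV"
  shows "((\<lambda>t. f (x + t *\<^sub>R b)) has_real_derivative partial_deriv b f x) (at 0)"
proof -
  have f: "f differentiable (at y)" for y using assms by (simp add: differentiable_on_def)
  have "(\<lambda>t. x + t *\<^sub>R b) differentiable (at (0::real))"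
    by (rule differentiableI[where f'="\<lambda>t. t *\<^sub>R b"]) (auto intro!: derivative_eq_intros)
  then have "(\<lambda>t. f (x + t *\<^sub>R b)) differentiable (at (0::real))"
    by (rule differentiable_compose[OF f])
  then show ?thesis
    unfolding partial_deriv_def by (simp only: DERIV_deriv_iff_real_differentiable)
qed

lemma partial_derivI:
  "((\<lambda>t. f (x + t *\<^sub>R b)) has_real_derivative D) (at 0) \<Longrightarrow> partial_deriv b f x = D"
  unfolding partial_deriv_def by (rule DERIV_imp_deriv)

lemma Ck_const: "Ck k (\<lambda>_. c)"
proof (induction k arbitrary: c)
  case (Suc k)
  have *: "partial_deriv b (\<lambda>_. c) x = 0" for b x :: 'a
    by (rule partial_derivI) (rule DERIV_const)
  have "Ck k (partial_deriv b (\<lambda>_. c))" for b :: 'a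
    unfolding *[abs_def] by (rule Suc.IH)
  then show ?case by simp
qed simp

lemma Ck_add: "Ck k f \<Longrightarrow> Ck k g \<Longrightarrow> Ck k (\<lambda>x. f x + g x)"
proof (induction k arbitrary: f g)
  case 0
  then show ?case unfolding Ck.simps by (rule continuous_on_add)
next
  case (Suc k)
  have f: "f differentiable_on UNIV" and g: "g differentiable_on UNIV" using Suc.prems by simp_all
  have *: "partial_deriv b (\<lambda>x. f x + g x) x = partial_deriv b f x + partial_deriv b g x" for b x
    by (rule partial_derivI, rule DERIV_add; rule partial_deriv_has_derivative) (fact f g)+
  have "Ck k (partial_deriv b (\<lambda>x. f x + g x))" if "b \<in> Basis" for b
    unfolding *[abs_def] by (rule Suc.IH) (use Suc.prems that in simp_all)
  moreover have "(\<lambda>x. f x + g x) differentiable_on UNIV"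
    by (rule differentiable_on_add[OF f g])
  ultimately show ?case by simp
qed

lemma Ck_minus: "Ck k f \<Longrightarrow> Ck k (\<lambda>x. - f x)"
proof (induction k arbitrary: f)
  case 0
  then show ?case unfolding Ck.simps by (rule continuous_on_minus)
next
  case (Suc k)
  have f: "f differentiable_on UNIV" using Suc.prems by simp
  have *: "partial_deriv b (\<lambda>x. - f x) x = - partial_deriv b f x" for b x
    by (rule partial_derivI, rule DERIV_minus, rule partial_deriv_has_derivative) (fact f)
  have "Ck k (partial_deriv b (\<lambda>x. - f x))" if "b \<in> Basis" for b
    unfolding *[abs_def] by (rule Suc.IH) (use Suc.prems that in simp)
  moreover have "(\<lambda>x. - f x) differentiable_on UNIV"
    by (rule differentiable_on_minus[OF f])
  ultimately show ?case by simp
qed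

lemma Ck_sum: "finite S \<Longrightarrow> (\<And>b. b \<in> S \<Longrightarrow> Ck k (f b)) \<Longrightarrow> Ck k (\<lambda>x. \<Sum>b\<in>S. f b x)"
  by (induction S rule: finite_induct) (auto simp: Ck_const Ck_add)

lemma partial_deriv_translate: "partial_deriv b (\<lambda>x. f (x + y)) x = partial_deriv b f (x + y)"
  by (simp add: partial_deriv_def algebra_simps)

lemma Ck_translate: "Ck k f \<Longrightarrow> Ck k (\<lambda>x. f (x + y))"
proof (induction k arbitrary: f)
  case 0
  then show ?case
    unfolding Ck.simps by (rule continuous_on_compose2) (auto intro!: continuous_intros)
next
  case (Suc k)
  have f: "f differentiable (at x)" for x using Suc.prems by (simp add: differentiable_on_def)
  have "(\<lambda>x. x + y) differentiable (at x)" for x by (intro derivative_intros)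
  then have "(\<lambda>x. f (x + y)) differentiable (at x)" for x by (rule differentiable_compose[OF f])
  then have "(\<lambda>x. f (x + y)) differentiable_on UNIV" by (simp add: differentiable_on_def)
  moreover have "Ck k (partial_deriv b (\<lambda>x. f (x + y)))" if "b \<in> Basis" for b
    unfolding partial_deriv_translate[abs_def] by (rule Suc.IH) (use Suc.prems that in simp)
  ultimately show ?case by simp
qed

lemma test_function_support:
  assumes "test_function \<phi>"
  obtains R where "R > 0" "\<And>x. norm x > R \<Longrightarrow> \<phi> x = 0"
proof -
  have "bounded (closure {x. \<phi> x \<noteq> 0})"
    using assms by (simp add: test_function_def compact_imp_bounded)
  then obtain R where "R > 0" "\<And>x. x \<in> closure {x. \<phi> x \<noteq> 0} \<Longrightarrow> norm x \<le> R"
    using bounded_pos by blast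
  then show ?thesis
    using that[of R] closure_subset[of "{x. \<phi> x \<noteq> 0}"] by (metis (mono_tags, lifting) in_mono mem_Collect_eq not_le)
qed

lemma test_functionI:
  assumes "\<And>k. Ck k \<phi>" and "\<And>x. norm x > R \<Longrightarrow> \<phi> x = 0"
  shows "test_function \<phi>"
proof -
  have "{x. \<phi> x \<noteq> 0} \<subseteq> cball 0 R" using assms(2) by (force simp: not_le)
  then have "closure {x. \<phi> x \<noteq> 0} \<subseteq> cball 0 R" by (simp add: closure_minimal)
  then show ?thesis
    using assms(1) bounded_subset[OF bounded_cball]
    by (simp add: test_function_def compact_eq_bounded_closed)
qed

lemma test_function_continuous: "test_function \<phi> \<Longrightarrow> continuous_on UNIV \<phi>"
  by (auto simp: test_function_def intro: Ck_continuous_on)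

lemma test_function_deriv:
  assumes "test_function \<phi>"
  shows "((\<lambda>t. \<phi> (x + t *\<^sub>R b)) has_real_derivative partial_deriv b \<phi> x) (at 0)"
proof -
  have "Ck 1 \<phi>" using assms by (simp add: test_function_def)
  then show ?thesis by (intro partial_deriv_has_derivative) simp
qed

lemma test_function_partial:
  assumes "test_function \<phi>" "b \<in> Basis"
  shows "test_function (partial_deriv b \<phi>)"
proof -
  obtain R where R: "R > 0" "\<And>x. norm x > R \<Longrightarrow> \<phi> x = 0"
    using test_function_support[OF assms(1)] by metis
  show ?thesis
  proof (rule test_functionI)
    show "Ck k (partial_deriv b \<phi>)" for k
      using assms(1)[unfolded test_function_def, THEN conjunct1, rule_format, of "Suc k"] assms(2) by simp
    show "partial_deriv b \<phi> x = 0" if "norm x > R" for x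
    proof (rule partial_derivI)
      have "\<forall>\<^sub>F t in nhds (0::real). norm (x + t *\<^sub>R b) > R"
      proof (rule order_tendstoD)
        show "((\<lambda>t. norm (x + t *\<^sub>R b)) \<longlongrightarrow> norm (x + 0 *\<^sub>R b)) (nhds (0::real))"
          by (intro tendsto_intros filterlim_ident)
      qed (use that in simp)
      then have "\<forall>\<^sub>F t in nhds (0::real). \<phi> (x + t *\<^sub>R b) = 0"
        by eventually_elim (rule R(2))
      then show "((\<lambda>t. \<phi> (x + t *\<^sub>R b)) has_real_derivative 0) (at 0)"
        by (subst DERIV_cong_ev[OF refl _ refl]) auto
    qed
  qed
qed

lemma test_function_laplacian:
  assumes "test_function \<phi>"
  shows "test_function (laplacian \<phi>)"
proof -
  have t: "test_function (partial_deriv b (partial_deriv b \<phi>))" if "b \<in> Basis" for b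
    using assms that by (intro test_function_partial)
  have "\<exists>R. \<forall>x. norm x > R \<longrightarrow> partial_deriv b (partial_deriv b \<phi>) x = 0" if "b \<in> Basis" for b
    by (rule test_function_support[OF t[OF that]]) blast
  then obtain R where R: "\<And>b x. b \<in> Basis \<Longrightarrow> norm x > R b \<Longrightarrow> partial_deriv b (partial_deriv b \<phi>) x = 0"
    by metis
  show ?thesis
  proof (rule test_functionI)
    show "Ck k (laplacian \<phi>)" for k
    proof -
      have "Ck k (partial_deriv b (partial_deriv b \<phi>))" if "b \<in> Basis" for b
        using t[OF that] by (simp only: test_function_def)
      then show ?thesis
        unfolding laplacian_def[abs_def] by (intro Ck_sum finite_Basis)
    qed
    show "laplacian \<phi> x = 0" if x: "norm x > Max (R ` Basis)" for x
      unfolding laplacian_def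
    proof (rule sum.neutral, rule ballI)
      fix b :: 'a assume b: "b \<in> Basis"
      then have "R b \<le> Max (R ` Basis)" by (intro Max_ge) auto
      with x show "partial_deriv b (partial_deriv b \<phi>) x = 0" by (intro R[OF b]) linarith
    qed
  qed
qed

lemma test_function_minus:
  assumes "test_function \<phi>"
  shows "test_function (\<lambda>x. - \<phi> x)"
proof -
  obtain R where "\<And>x. norm x > R \<Longrightarrow> \<phi> x = 0"
    by (rule test_function_support[OF assms]) blast
  then have "- \<phi> x = 0" if "norm x > R" for x using that by simp
  moreover have "Ck k (\<lambda>x. - \<phi> x)" for k
    using assms by (intro Ck_minus) (simp add: test_function_def)
  ultimately show ?thesis by (rule test_functionI[rotated])
qed

lemma neg_laplacian_pow_Suc:
  "neg_laplacian_pow (Suc n) \<phi> = (\<lambda>x. - laplacian (neg_laplacian_pow n \<phi>) x)"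
  by (simp add: neg_laplacian_pow_def)

lemma test_function_neg_laplacian_pow:
  assumes "test_function \<phi>"
  shows "test_function (neg_laplacian_pow n \<phi>)"
proof (induction n)
  case 0
  show ?case using assms by (simp add: neg_laplacian_pow_def)
next
  case (Suc n)
  show ?case
    unfolding neg_laplacian_pow_Suc by (intro test_function_minus test_function_laplacian Suc.IH)
qed

lemma test_function_translate:
  assumes "test_function \<phi>"
  shows "test_function (\<lambda>x. \<phi> (x + y))"
proof -
  obtain R where R: "R > 0" "\<And>x. norm x > R \<Longrightarrow> \<phi> x = 0"
    using test_function_support[OF assms] by metis
  show ?thesis
  proof (rule test_functionI)
    show "Ck k (\<lambda>x. \<phi> (x + y))" for k
      using assms by (simp add: test_function_def Ck_translate)
    show "\<phi> (x + y) = 0" if "norm x > R + norm y" for x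
      using that norm_diff_ineq[of x y] by (intro R) linarith
  qed
qed

lemma neg_laplacian_pow_translate:
  "neg_laplacian_pow n (\<lambda>x. \<phi> (x + y)) = (\<lambda>x. neg_laplacian_pow n \<phi> (x + y))"
proof (induction n)
  case (Suc n)
  then show ?case
    by (simp add: neg_laplacian_pow_def laplacian_def partial_deriv_translate[abs_def])
qed (simp add: neg_laplacian_pow_def)

text \<open>Green's second identity, one direction at a time:
  \<open>G x * ?q b x - L b x * \<psi> x\<close> is the derivative of
  \<open>G x * ?p b x - H b x * \<psi> x\<close>, which has compact support because
  \<open>\<psi>\<close> has, so its integral vanishes.\<close>

lemma integral_mult_laplacian:
  fixes G :: "'a::euclidean_space \<Rightarrow> real" and H L :: "'a \<Rightarrow> 'a \<Rightarrow> real"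
  assumes D1: "\<And>b x. b \<in> Basis \<Longrightarrow> ((\<lambda>t. G (x + t *\<^sub>R b)) has_real_derivative H b x) (at 0)"
    and D2: "\<And>b x. b \<in> Basis \<Longrightarrow> ((\<lambda>t. H b (x + t *\<^sub>R b)) has_real_derivative L b x) (at 0)"
    and c: "continuous_on UNIV G" "\<And>b. b \<in> Basis \<Longrightarrow> continuous_on UNIV (H b)"
      "\<And>b. b \<in> Basis \<Longrightarrow> continuous_on UNIV (L b)"
    and \<psi>: "test_function \<psi>"
  shows "(\<integral>x. G x * laplacian \<psi> x \<partial>lborel) = (\<integral>x. (\<Sum>b\<in>Basis. L b x) * \<psi> x \<partial>lborel)"
proof -
  let ?p = "\<lambda>b. partial_deriv b \<psi>" and ?q = "\<lambda>b. partial_deriv b (partial_deriv b \<psi>)"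
  have I1: "integrable lborel (\<lambda>x. G x * ?q b x)" and I2: "integrable lborel (\<lambda>x. L b x * \<psi> x)"
    and E: "(\<integral>x. G x * ?q b x \<partial>lborel) = (\<integral>x. L b x * \<psi> x \<partial>lborel)" if b: "b \<in> Basis" for b
  proof -
    have tp: "test_function (?p b)" and tq: "test_function (?q b)"
      using \<psi> b by (auto intro: test_function_partial)
    obtain R0 where R0: "\<And>x. norm x > R0 \<Longrightarrow> \<psi> x = 0" by (rule test_function_support[OF \<psi>]) blast
    obtain R1 where R1: "\<And>x. norm x > R1 \<Longrightarrow> ?p b x = 0" by (rule test_function_support[OF tp]) blast
    obtain R2 where R2: "\<And>x. norm x > R2 \<Longrightarrow> ?q b x = 0" by (rule test_function_support[OF tq]) blast
    note R = R0 R1 R2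
    note cc = c(1) c(2,3)[OF b] test_function_continuous[OF \<psi>] test_function_continuous[OF tp]
      test_function_continuous[OF tq]
    show I1: "integrable lborel (\<lambda>x. G x * ?q b x)"
      by (rule integrable_compact_support[OF continuous_on_mult[OF cc(1) cc(6)], of R2]) (simp add: R(3))
    show I2: "integrable lborel (\<lambda>x. L b x * \<psi> x)"
      by (rule integrable_compact_support[OF continuous_on_mult[OF cc(3) cc(4)], of R0]) (simp add: R(1))
    have "(\<integral>x. G x * ?q b x - L b x * \<psi> x \<partial>lborel) = 0"
    proof (rule integral_directional_derivative[OF b, where R = "max R0 (max R1 R2)"
          and F = "\<lambda>x. G x * ?p b x - H b x * \<psi> x"])
      fix x
      show "((\<lambda>t. G (x + t *\<^sub>R b) * ?p b (x + t *\<^sub>R b) - H b (x + t *\<^sub>R b) * \<psi> (x + t *\<^sub>R b))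
          has_real_derivative G x * ?q b x - L b x * \<psi> x) (at 0)"
        using DERIV_diff[OF DERIV_mult[OF D1[OF b, of x] test_function_deriv[OF tp, of x b]]
            DERIV_mult[OF D2[OF b, of x] test_function_deriv[OF \<psi>, of x b]]]
        by (simp add: algebra_simps)
    next
      show "continuous_on UNIV (\<lambda>x. G x * ?p b x - H b x * \<psi> x)"
        by (intro continuous_on_diff continuous_on_mult cc)
      show "continuous_on UNIV (\<lambda>x. G x * ?q b x - L b x * \<psi> x)"
        by (intro continuous_on_diff continuous_on_mult cc)
    qed (simp_all add: R)
    then show "(\<integral>x. G x * ?q b x \<partial>lborel) = (\<integral>x. L b x * \<psi> x \<partial>lborel)"
      using I1 I2 by simp
  qed
  have "(\<integral>x. G x * laplacian \<psi> x \<partial>lborel) = (\<integral>x. (\<Sum>b\<in>Basis. G x * ?q b x) \<partial>lborel)"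
    by (simp only: laplacian_def sum_distrib_left)
  also have "\<dots> = (\<Sum>b\<in>Basis. \<integral>x. G x * ?q b x \<partial>lborel)"
    by (rule Bochner_Integration.integral_sum) (rule I1)
  also have "\<dots> = (\<Sum>b\<in>Basis. \<integral>x. L b x * \<psi> x \<partial>lborel)"
    by (rule sum.cong) (auto simp only: E)
  also have "\<dots> = (\<integral>x. (\<Sum>b\<in>Basis. L b x * \<psi> x) \<partial>lborel)"
    by (rule Bochner_Integration.integral_sum[symmetric]) (rule I2)
  finally show ?thesis
    by (simp only: sum_distrib_right)
qed

text \<open>With \<open>s = |x|^2 + \<epsilon>\<close> the chain rule gives
  \<open>4 |x|^2 g''(s) + 2 d g'(s)\<close> for the Laplacian of \<open>g s\<close>. A positive
  \<open>\<epsilon>\<close> keeps the function twice continuously differentiable at the origin, so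
  Green's identity produces no term there.\<close>

lemma integral_radial_mult_laplacian:
  fixes \<psi> :: "'a::euclidean_space \<Rightarrow> real" and g g1 g2 :: "real \<Rightarrow> real"
  assumes \<epsilon>: "\<epsilon> > 0"
    and g1: "\<And>s. s > 0 \<Longrightarrow> (g has_real_derivative g1 s) (at s)"
    and g2: "\<And>s. s > 0 \<Longrightarrow> (g1 has_real_derivative g2 s) (at s)"
    and g3: "continuous_on {0<..} g2"
    and \<psi>: "test_function \<psi>"
  shows "(\<integral>x. g ((norm x)\<^sup>2 + \<epsilon>) * laplacian \<psi> x \<partial>lborel) =
    (\<integral>x. (4 * (norm x)\<^sup>2 * g2 ((norm x)\<^sup>2 + \<epsilon>) + 2 * real DIM('a) * g1 ((norm x)\<^sup>2 + \<epsilon>)) * \<psi> x \<partial>lborel)"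
proof -
  let ?s = "\<lambda>x::'a. x \<bullet> x + \<epsilon>"
  have pos: "?s x > 0" for x using \<epsilon> by (simp add: add_nonneg_pos)
  have ds: "((\<lambda>t. ?s (x + t *\<^sub>R b)) has_real_derivative 2 * (x \<bullet> b)) (at 0)" for x b
  proof -
    have "?s (x + t *\<^sub>R b) = x \<bullet> x + 2 * t * (x \<bullet> b) + t * t * (b \<bullet> b) + \<epsilon>" for t
      by (simp add: inner_add_left inner_add_right inner_commute[of b x], simp only: distrib_left mult.assoc)
    moreover have "((\<lambda>t. x \<bullet> x + 2 * t * (x \<bullet> b) + t * t * (b \<bullet> b) + \<epsilon>) has_real_derivative 2 * (x \<bullet> b)) (at 0)"
      by (auto intro!: derivative_eq_intros)
    ultimately show ?thesis by simp
  qed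
  have cg: "continuous_on {0<..} g"
    by (intro DERIV_continuous_on[where D=g1] has_field_derivative_at_within[OF g1]) simp
  have cg1: "continuous_on {0<..} g1"
    by (intro DERIV_continuous_on[where D=g2] has_field_derivative_at_within[OF g2]) simp
  have dg: "((\<lambda>t. f (?s (x + t *\<^sub>R b))) has_real_derivative f' (?s x) * (2 * (x \<bullet> b))) (at 0)"
    if "\<And>s. s > 0 \<Longrightarrow> (f has_real_derivative f' s) (at s)" for f f' x b
    using DERIV_chain2[OF _ ds[of x b], of f "f' (?s x)"] that[OF pos] by simp
  have "(\<integral>x. g (?s x) * laplacian \<psi> x \<partial>lborel) =
     (\<integral>x. (\<Sum>b\<in>Basis. g2 (?s x) * (2 * (x \<bullet> b)) * (2 * (x \<bullet> b)) + 2 * g1 (?s x)) * \<psi> x \<partial>lborel)"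
  proof (rule integral_mult_laplacian[where H = "\<lambda>b x. g1 (?s x) * (2 * (x \<bullet> b))"])
    fix b x :: 'a assume b: "b \<in> Basis"
    show "((\<lambda>t. g (?s (x + t *\<^sub>R b))) has_real_derivative g1 (?s x) * (2 * (x \<bullet> b))) (at 0)"
      by (rule dg[OF g1])
    have db: "((\<lambda>t. 2 * ((x + t *\<^sub>R b) \<bullet> b)) has_real_derivative 2) (at 0)"
      using b by (auto simp: inner_simps intro!: derivative_eq_intros)
    show "((\<lambda>t. g1 (?s (x + t *\<^sub>R b)) * (2 * ((x + t *\<^sub>R b) \<bullet> b))) has_real_derivative
        g2 (?s x) * (2 * (x \<bullet> b)) * (2 * (x \<bullet> b)) + 2 * g1 (?s x)) (at 0)"
      by (rule DERIV_cong[OF DERIV_mult[OF dg[OF g2, of x b] db]]) simp_all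
  next
    have cs: "continuous_on UNIV ?s" by (intro continuous_intros)
    have cc: "continuous_on UNIV (\<lambda>x. f (?s x))" if "continuous_on {0<..} f" for f
      by (rule continuous_on_compose2[OF that cs]) (use pos in auto)
    show "continuous_on UNIV (\<lambda>x. g (?s x))" by (rule cc[OF cg])
    fix b :: 'a
    show "continuous_on UNIV (\<lambda>x. g1 (?s x) * (2 * (x \<bullet> b)))"
      by (intro continuous_on_mult cc[OF cg1]) (intro continuous_intros)+
    show "continuous_on UNIV (\<lambda>x. g2 (?s x) * (2 * (x \<bullet> b)) * (2 * (x \<bullet> b)) + 2 * g1 (?s x))"
      by (intro continuous_on_add continuous_on_mult cc[OF cg1] cc[OF g3]) (intro continuous_intros)+
  qed (rule \<psi>)
  moreover have "(\<Sum>b\<in>Basis. g2 (?s x) * (2 * (x \<bullet> b)) * (2 * (x \<bullet> b)) + 2 * g1 (?s x))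
      = 4 * (x \<bullet> x) * g2 (?s x) + 2 * real DIM('a) * g1 (?s x)" for x :: 'a
  proof -
    have "g2 (?s x) * (2 * (x \<bullet> b)) * (2 * (x \<bullet> b)) = 4 * g2 (?s x) * ((x \<bullet> b) * (x \<bullet> b))" for b
      by simp
    then have "(\<Sum>b\<in>Basis. g2 (?s x) * (2 * (x \<bullet> b)) * (2 * (x \<bullet> b)) + 2 * g1 (?s x))
      = 4 * g2 (?s x) * (\<Sum>b\<in>Basis. (x \<bullet> b) * (x \<bullet> b)) + real DIM('a) * (2 * g1 (?s x))"
      by (simp only: sum.distrib sum_distrib_left sum_constant of_nat_id)
    also have "(\<Sum>b\<in>Basis. (x \<bullet> b) * (x \<bullet> b)) = x \<bullet> x"
      by (rule euclidean_inner[symmetric])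
    finally show ?thesis by (simp only: of_nat_mult of_nat_numeral mult_ac)
  qed
  ultimately show ?thesis by (simp add: dot_square_norm)
qed

section \<open>Integrability of radial singularities\<close>

text \<open>The series of \<open>c j\<close> times the indicator of \<open>A j\<close> dominates
  \<open>f\<close> and has the given sum as its integral. Overlaps only enlarge the majorant, so
  dyadic balls can stand in for annuli.\<close>

lemma integrable_dominated_by_shells:
  fixes f :: "'a \<Rightarrow> real"
  assumes [measurable]: "f \<in> borel_measurable M" "\<And>j::nat. A j \<in> sets M"
    and fin: "\<And>j. emeasure M (A j) < \<infinity>" and c: "\<And>j. c j \<ge> 0"
    and dom: "\<And>x. x \<in> space M \<Longrightarrow> f x \<noteq> 0 \<Longrightarrow> \<exists>j. x \<in> A j \<and> \<bar>f x\<bar> \<le> c j"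
    and summ: "summable (\<lambda>j. c j * measure M (A j))"
  shows "integrable M f"
proof (rule integrableI_bounded)
  have "(\<integral>\<^sup>+x. norm (f x) \<partial>M) \<le> (\<integral>\<^sup>+x. (\<Sum>j. ennreal (c j) * indicator (A j) x) \<partial>M)"
  proof (rule nn_integral_mono)
    fix x assume x: "x \<in> space M"
    show "ennreal (norm (f x)) \<le> (\<Sum>j. ennreal (c j) * indicator (A j) x)"
    proof (cases "f x = 0")
      case False
      then obtain j where j: "x \<in> A j" "\<bar>f x\<bar> \<le> c j" using dom x by blast
      have "ennreal (norm (f x)) \<le> (\<Sum>i\<in>{j}. ennreal (c i) * indicator (A i) x)"
        using j by (simp add: ennreal_leI)
      also have "\<dots> \<le> (\<Sum>i. ennreal (c i) * indicator (A i) x)"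
        by (rule sum_le_suminf) auto
      finally show ?thesis .
    qed simp
  qed
  also have "\<dots> = (\<Sum>j. ennreal (c j) * emeasure M (A j))"
    by (simp add: nn_integral_suminf nn_integral_cmult)
  also have "\<dots> = (\<Sum>j. ennreal (c j * measure M (A j)))"
    using fin c by (simp add: emeasure_eq_ennreal_measure ennreal_mult less_top)
  also have "\<dots> < \<infinity>"
    using summ c by (subst suminf_ennreal2) (auto simp: ennreal_less_top)
  finally show "(\<integral>\<^sup>+x. norm (f x) \<partial>M) < \<infinity>" .
qed simp

lemma dyadic_bracket:
  fixes t :: real
  assumes "0 < t" "t \<le> 1"
  obtains j :: nat where "1 / 2 ^ Suc j < t" "t \<le> 1 / 2 ^ j"
proof -
  obtain N :: nat where "(1/2) ^ N < t" using real_arch_pow_inv[of t "1/2"] assms by auto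
  then have P: "1 / 2 ^ Suc N < t" using assms by (simp add: power_one_over field_simps)
  define j where "j = (LEAST j. 1 / 2 ^ Suc j < t)"
  have j: "1 / 2 ^ Suc j < t" unfolding j_def by (rule LeastI) (rule P)
  moreover have "t \<le> 1 / 2 ^ j"
  proof (cases j)
    case (Suc i)
    then have "\<not> 1 / 2 ^ Suc i < t" using not_less_Least[of i "\<lambda>j. 1 / 2 ^ Suc j < t"] by (simp add: j_def)
    then show ?thesis using Suc by simp
  qed (use assms in simp)
  ultimately show ?thesis using that by blast
qed

lemma measure_lborel_cball:
  fixes c :: "'a::euclidean_space"
  shows "r \<ge> 0 \<Longrightarrow> measure lborel (cball c r) = unit_ball_vol (real DIM('a)) * r ^ DIM('a)"
  using emeasure_cball[of r c] by (simp add: measure_def)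

text \<open>On the annulus between \<open>r / 2 ^ Suc j\<close> and \<open>r / 2 ^ j\<close> the
  integrand is at most \<open>(2 ^ Suc j / r) ^ m\<close>, while the ball has volume of order
  \<open>2^(-jd)\<close>; since \<open>m < d\<close>, the products decay at least like
  \<open>2^(-j)\<close>.\<close>

lemma integrable_inverse_norm_power:
  fixes r :: real
  assumes m: "m < DIM('a::euclidean_space)"
  shows "integrable lborel (\<lambda>x::'a. indicator (cball 0 r) x * inverse (norm x ^ m))"
proof (cases "r > 0")
  case r: True
  let ?V = "unit_ball_vol (real DIM('a))" and ?d = "DIM('a)"
  show ?thesis
  proof (rule integrable_dominated_by_shells[where A = "\<lambda>j. cball 0 (r / 2 ^ j)"
        and c = "\<lambda>j. (2 ^ Suc j / r) ^ m"])
    fix x :: 'a assume nz: "indicator (cball 0 r) x * inverse (norm x ^ m) \<noteq> 0"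
    then have x: "norm x \<le> r" by (auto simp: indicator_def split: if_splits)
    show "\<exists>j. x \<in> cball 0 (r / 2 ^ j) \<and> \<bar>indicator (cball 0 r) x * inverse (norm x ^ m)\<bar> \<le> (2 ^ Suc j / r) ^ m"
    proof (cases "x = 0")
      case True
      \<comment> \<open>Because \<open>inverse 0 = 0\<close>, the value at the origin is nonzero
        only for the zeroth power.\<close>
      then have "m = 0" using nz by (cases m) auto
      then show ?thesis using True r by (intro exI[of _ 0]) auto
    next
      case False
      then have "0 < norm x / r" "norm x / r \<le> 1" using x r by auto
      then obtain j where j: "1 / 2 ^ Suc j < norm x / r" "norm x / r \<le> 1 / 2 ^ j"
        by (rule dyadic_bracket)
      have "inverse (norm x) \<le> 2 ^ Suc j / r"
        using j(1) r False by (simp add: field_simps)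
      then have "inverse (norm x) ^ m \<le> (2 ^ Suc j / r) ^ m" by (rule power_mono) simp
      moreover have "norm x \<le> r / 2 ^ j" using j(2) r by (simp add: field_simps)
      ultimately show ?thesis using x by (intro exI[of _ j]) (simp add: power_inverse)
    qed
  next
    have le: "(2 ^ Suc j / r) ^ m * (r / 2 ^ j) ^ ?d \<le> (2 / r) ^ m * r ^ ?d * (1 / 2) ^ j" for j
    proof -
      have "(2::real) ^ (j * m) * 2 ^ j \<le> 2 ^ (j * ?d)"
        using m by (subst power_add[symmetric], intro power_increasing)
          (use mult_le_mono2[of "Suc m" ?d j] in simp_all)
      then have "(2 ^ j) ^ m / (2 ^ j) ^ ?d \<le> (1 / 2::real) ^ j"
        by (simp add: power_mult[symmetric] power_one_over field_simps)
      then have "((2 / r) ^ m * r ^ ?d) * ((2 ^ j) ^ m / (2 ^ j) ^ ?d) \<le> ((2 / r) ^ m * r ^ ?d) * (1 / 2) ^ j"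
        using r by (intro mult_left_mono) auto
      moreover have "(2 ^ Suc j / r) ^ m * (r / 2 ^ j) ^ ?d = ((2 / r) ^ m * r ^ ?d) * ((2 ^ j) ^ m / (2 ^ j) ^ ?d)"
        by (simp add: power_divide power_mult_distrib)
      ultimately show ?thesis by simp
    qed
    show "summable (\<lambda>j. (2 ^ Suc j / r) ^ m * measure lborel (cball (0::'a) (r / 2 ^ j)))"
    proof (rule summable_comparison_test')
      show "summable (\<lambda>j. ?V * ((2 / r) ^ m * r ^ ?d * (1 / 2) ^ j))"
        by (intro summable_mult summable_geometric) simp
      show "norm ((2 ^ Suc j / r) ^ m * measure lborel (cball (0::'a) (r / 2 ^ j)))
          \<le> ?V * ((2 / r) ^ m * r ^ ?d * (1 / 2) ^ j)" for j
        using mult_left_mono[OF le[of j], of ?V] r by (simp add: measure_lborel_cball mult_ac abs_mult)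
    qed
  next
    show "emeasure lborel (cball (0::'a) (r / 2 ^ j)) < \<infinity>" for j
      by (rule emeasure_bounded_finite) simp
    show "(\<lambda>x::'a. indicator (cball 0 r) x * inverse (norm x ^ m)) \<in> borel_measurable lborel"
      by (intro borel_measurable_times borel_measurable_indicator borel_measurable_inverse
          borel_measurable_power borel_measurable_norm) simp_all
  qed (use r in simp_all)
next
  case False
  \<comment> \<open>For a nonpositive radius the ball is empty or a single point, hence a null
    set.\<close>
  have "x = 0" if "norm x \<le> r" for x :: 'a
  proof -
    have "norm x \<le> 0" using that False by linarith
    then show ?thesis by simp
  qed
  then have ae: "AE x::'a in lborel. indicator (cball 0 r) x * inverse (norm x ^ m) = (0::real)"
    by (intro AE_I[where N="{0::'a}"]) (auto simp: indicator_def)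
  have "(\<lambda>x::'a. indicator (cball 0 r) x * inverse (norm x ^ m)) \<in> borel_measurable lborel"
    by (intro borel_measurable_times borel_measurable_indicator borel_measurable_inverse
        borel_measurable_power borel_measurable_norm) simp_all
  from integrable_cong_AE[OF this _ ae] show ?thesis by simp
qed

text \<open>The bubble decays like \<open>|x|^(-2n-2)\<close>, two powers better than the volume
  growth \<open>|x|^(2n)\<close>, so the dyadic terms decay like \<open>4^(-j)\<close>. Up to a
  factor its integral is the point mass of the Newton kernel.\<close>

lemma integrable_bubble:
  assumes d: "DIM('a::euclidean_space) = 2 * n"
  shows "integrable lborel (\<lambda>x::'a. inverse (((norm x)\<^sup>2 + 1) ^ (n + 1)))"
proof (rule integrable_dominated_by_shells[where A = "\<lambda>j. cball 0 (2 ^ j)"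
      and c = "\<lambda>j. inverse ((2 ^ (j - 1))\<^sup>2 ^ (n + 1))"])
  fix x :: 'a
  have "\<exists>N. norm x \<le> 2 ^ N" using real_arch_pow[of 2 "norm x"] by (auto intro: less_imp_le)
  then obtain N where N: "norm x \<le> 2 ^ N" by blast
  define j where "j = (LEAST j. norm x \<le> 2 ^ j)"
  have j: "norm x \<le> 2 ^ j" unfolding j_def by (rule LeastI) (rule N)
  \<comment> \<open>Truncated subtraction gives 1 at \<open>j = 0\<close>, where the summand 1 on
    the right suffices; for larger \<open>j\<close> minimality gives
    \<open>norm x > 2 ^ (j - 1)\<close>.\<close>
  have "(2 ^ (j - 1))\<^sup>2 \<le> (norm x)\<^sup>2 + 1"
  proof (cases j)
    case (Suc i)
    then have "\<not> norm x \<le> 2 ^ i" using not_less_Least[of i "\<lambda>j. norm x \<le> 2 ^ j"] by (simp add: j_def)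
    then have "(2 ^ i)\<^sup>2 \<le> (norm x)\<^sup>2" by (intro power_mono) auto
    then have "(2 ^ i)\<^sup>2 \<le> (norm x)\<^sup>2 + 1" by linarith
    then show ?thesis by (simp only: Suc diff_Suc_1)
  qed simp
  then have "(2 ^ (j - 1))\<^sup>2 ^ (n + 1) \<le> ((norm x)\<^sup>2 + 1) ^ (n + 1)"
    by (intro power_mono) auto
  then have "inverse (((norm x)\<^sup>2 + 1) ^ (n + 1)) \<le> inverse ((2 ^ (j - 1))\<^sup>2 ^ (n + 1))"
    by (intro le_imp_inverse_le) simp_all
  then show "\<exists>j. x \<in> cball 0 (2 ^ j) \<and> \<bar>inverse (((norm x)\<^sup>2 + 1) ^ (n + 1))\<bar> \<le> inverse ((2 ^ (j - 1))\<^sup>2 ^ (n + 1))"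
    using j by (intro exI[of _ j]) simp
next
  let ?V = "unit_ball_vol (real (2 * n))"
  show "summable (\<lambda>j. inverse ((2 ^ (j - 1))\<^sup>2 ^ (n + 1)) * measure lborel (cball (0::'a) (2 ^ j)))"
  proof (rule summable_comparison_test')
    show "summable (\<lambda>j. ?V * 2 ^ (2 * n + 2) * (1 / 4) ^ j)"
      by (intro summable_mult summable_geometric) simp
    fix j :: nat assume "1 \<le> j"
    then obtain i where i: "j = Suc i" by (cases j) auto
    have "inverse ((2 ^ i)\<^sup>2 ^ (n + 1)) * (2 ^ Suc i) ^ (2 * n) = 2 ^ (2 * n) * (1 / 4 :: real) ^ i"
    proof -
      have 1: "(2 ^ Suc i) ^ (2 * n) = (2::real) ^ (2 * n) * ((2 ^ i)\<^sup>2) ^ n"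
        by (simp add: power_mult power_mult_distrib)
      have 2: "((2::real) ^ i)\<^sup>2 = 4 ^ i" by (simp add: power_mult[symmetric] mult.commute[of i] power_mult)
      show ?thesis unfolding 1 2 by (simp add: power_one_over divide_simps)
    qed
    moreover have "(2::real) ^ (2 * n) * (1 / 4) ^ i \<le> 2 ^ (2 * n + 2) * (1 / 4) ^ j"
      by (simp add: i)
    ultimately have "inverse ((2 ^ (j - 1))\<^sup>2 ^ (n + 1)) * (2 ^ j) ^ (2 * n) \<le> 2 ^ (2 * n + 2) * (1 / 4 :: real) ^ j"
      using i by simp
    from mult_left_mono[OF this, of ?V]
    show "norm (inverse ((2 ^ (j - 1))\<^sup>2 ^ (n + 1)) * measure lborel (cball (0::'a) (2 ^ j)))
        \<le> ?V * 2 ^ (2 * n + 2) * (1 / 4) ^ j"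
      by (simp only: measure_lborel_cball d norm_mult real_norm_def) (simp add: mult_ac measure_lborel_cball d)
  qed
next
  show "emeasure lborel (cball (0::'a) (2 ^ j)) < \<infinity>" for j
    by (rule emeasure_bounded_finite) simp
  show "(\<lambda>x::'a. inverse (((norm x)\<^sup>2 + 1) ^ (n + 1))) \<in> borel_measurable lborel"
    by measurable
qed simp_all

section \<open>Limits of integrals against test functions\<close>

lemma test_function_bounded:
  assumes "test_function \<phi>"
  obtains M where "M \<ge> 0" "\<And>x. \<bar>\<phi> x\<bar> \<le> M"
  by (rule test_function_support[OF assms], rule compact_support_bounded[OF test_function_continuous[OF assms]]) auto

lemma test_function_measurable [measurable_dest]: "test_function \<phi> \<Longrightarrow> \<phi> \<in> borel_measurable borel"
  by (intro borel_measurable_continuous_onI test_function_continuous)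

text \<open>Dominated convergence on the support of \<open>\<psi>\<close>; the singularity sits at a
  single point, a null set. The bound adds affine growth to a locally integrable power, so that it
  covers the regularised logarithm as well as the regularised powers.\<close>

lemma tendsto_integral_mult_test_function:
  fixes H :: "nat \<Rightarrow> 'a::euclidean_space \<Rightarrow> real"
  assumes \<psi>: "test_function \<psi>" and m: "m < DIM('a)"
    and [measurable]: "\<And>i. H i \<in> borel_measurable borel" "h \<in> borel_measurable borel"
    and lim: "\<And>x. x \<noteq> 0 \<Longrightarrow> (\<lambda>i. H i x) \<longlonglongrightarrow> h x"
    and bd: "\<And>i x. x \<noteq> 0 \<Longrightarrow> \<bar>H i x\<bar> \<le> C * inverse (norm x ^ m) + D * norm x + E"
  shows "integrable lborel (\<lambda>x. h x * \<psi> x)"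
    and "(\<lambda>i. \<integral>x. H i x * \<psi> x \<partial>lborel) \<longlonglongrightarrow> (\<integral>x. h x * \<psi> x \<partial>lborel)"
proof -
  note [measurable] = test_function_measurable[OF \<psi>]
  obtain R where R: "\<And>x. norm x > R \<Longrightarrow> \<psi> x = 0" by (rule test_function_support[OF \<psi>]) blast
  obtain M where M: "M \<ge> 0" "\<And>x. \<bar>\<psi> x\<bar> \<le> M" by (rule test_function_bounded[OF \<psi>]) blast
  let ?w = "\<lambda>x::'a. (\<bar>C\<bar> * M) * (indicator (cball 0 R) x * inverse (norm x ^ m))
      + indicator (cball 0 R) x *\<^sub>R (M * (\<bar>D\<bar> * norm x + \<bar>E\<bar>))"
  have w: "integrable lborel ?w"
    by (intro Bochner_Integration.integrable_add integrable_mult_right integrable_inverse_norm_power m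
        borel_integrable_compact) (auto intro!: continuous_intros)
  have AE0: "AE x in lborel. x \<noteq> (0::'a)" by (rule AE_lborel_singleton)
  have b: "AE x in lborel. norm (H i x * \<psi> x) \<le> ?w x" for i
    using AE0
  proof eventually_elim
    case (elim x)
    show ?case
    proof (cases "norm x > R")
      case False
      have "\<bar>H i x\<bar> \<le> \<bar>C\<bar> * inverse (norm x ^ m) + \<bar>D\<bar> * norm x + \<bar>E\<bar>"
      proof -
        have "C * inverse (norm x ^ m) \<le> \<bar>C\<bar> * inverse (norm x ^ m)" "D * norm x \<le> \<bar>D\<bar> * norm x"
          by (intro mult_right_mono abs_ge_self; simp)+
        then show ?thesis using bd[OF elim, of i] abs_ge_self[of E] by linarith
      qed
      then have "\<bar>H i x\<bar> * \<bar>\<psi> x\<bar> \<le> (\<bar>C\<bar> * inverse (norm x ^ m) + \<bar>D\<bar> * norm x + \<bar>E\<bar>) * M"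
        using M by (intro mult_mono) auto
      then show ?thesis using False by (simp add: abs_mult algebra_simps)
    qed (simp add: R)
  qed
  have l: "AE x in lborel. (\<lambda>i. H i x * \<psi> x) \<longlonglongrightarrow> h x * \<psi> x"
    using AE0 by eventually_elim (intro tendsto_mult lim tendsto_const)
  have meas: "(\<lambda>x. h x * \<psi> x) \<in> borel_measurable lborel" "(\<lambda>x. H i x * \<psi> x) \<in> borel_measurable lborel" for i
    by simp_all
  show "integrable lborel (\<lambda>x. h x * \<psi> x)"
    by (rule integrable_dominated_convergence[OF meas w l b])
  show "(\<lambda>i. \<integral>x. H i x * \<psi> x \<partial>lborel) \<longlonglongrightarrow> (\<integral>x. h x * \<psi> x \<partial>lborel)"
    by (rule integral_dominated_convergence[OF meas w l b])
qed

section \<open>The fundamental solution of the polyharmonic operator\<close>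

text \<open>The shift \<open>1 / Suc i\<close> is the \<open>\<epsilon>\<close> of the radial
  formula, made to tend to zero: logarithms and negative powers of \<open>reg_sq i x\<close> are
  smooth at the origin.\<close>

definition reg_sq :: "nat \<Rightarrow> 'a::real_normed_vector \<Rightarrow> real" where
  "reg_sq i x = (norm x)\<^sup>2 + 1 / real (Suc i)"

lemma reg_sq_pos: "reg_sq i x > 0"
  by (simp add: reg_sq_def add_nonneg_pos)

lemma reg_sq_ge: "(norm x)\<^sup>2 \<le> reg_sq i x"
  by (simp add: reg_sq_def)

lemma reg_sq_measurable [measurable]: "reg_sq i \<in> borel_measurable borel"
  unfolding reg_sq_def by measurable

lemma reg_sq_lim: "(\<lambda>i. reg_sq i x) \<longlonglongrightarrow> (norm x)\<^sup>2"
  using tendsto_add[OF tendsto_const LIMSEQ_Suc[OF lim_1_over_n], of "(norm x)\<^sup>2"] by (simp add: reg_sq_def)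

lemma reg_sq_inv: "x \<noteq> 0 \<Longrightarrow> inverse (reg_sq i x ^ k) \<le> inverse (norm x ^ (2 * k))"
  using reg_sq_ge[of x i] unfolding power_mult by (intro le_imp_inverse_le power_mono) auto

text \<open>With \<open>g s = ln s / 2\<close> the radial formula tends to
  \<open>(d - 2) / |x|^2\<close>. As \<open>d > 2\<close> this limit is locally integrable and
  dominates the approximations up to a factor, so no point mass arises.\<close>

lemma integral_ln_norm_mult_laplacian:
  fixes \<psi> :: "'a::euclidean_space \<Rightarrow> real"
  assumes d: "DIM('a) > 2" and \<psi>: "test_function \<psi>"
  shows "(\<integral>x. ln (norm x) * laplacian \<psi> x \<partial>lborel)
    = (DIM('a) - 2) * (\<integral>x. inverse (norm x ^ 2) * \<psi> x \<partial>lborel)"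
proof -
  let ?d = "real DIM('a)"
  have s_le: "reg_sq i x \<le> (1 + norm x)\<^sup>2" for i and x :: 'a
  proof -
    have "1 / real (Suc i) \<le> 1" by simp
    moreover have "(1 + norm x)\<^sup>2 = 1 + (norm x)\<^sup>2 + 2 * norm x" by (simp add: power2_sum)
    ultimately show ?thesis unfolding reg_sq_def using norm_ge_zero[of x] by linarith
  qed
  define H where "H i x = 4 * (norm x)\<^sup>2 * (- 1 / (2 * (reg_sq i x)\<^sup>2)) + 2 * ?d * (1 / (2 * reg_sq i x))" for i and x :: 'a
  have [measurable]: "H i \<in> borel_measurable borel" for i unfolding H_def by measurable
  have E: "(\<integral>x. ln (reg_sq i x) / 2 * laplacian \<psi> x \<partial>lborel) = (\<integral>x. H i x * \<psi> x \<partial>lborel)" for i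
    unfolding reg_sq_def H_def
    by (rule integral_radial_mult_laplacian[OF _ _ _ _ \<psi>])
      (auto intro!: derivative_eq_intros continuous_intros simp: power2_eq_square divide_simps)
  have "(\<lambda>i. \<integral>x. ln (reg_sq i x) / 2 * laplacian \<psi> x \<partial>lborel) \<longlonglongrightarrow> (\<integral>x. ln (norm x) * laplacian \<psi> x \<partial>lborel)"
  proof (rule tendsto_integral_mult_test_function(2)[where m=1 and C=1 and D=1 and E=0])
    fix x :: 'a assume x: "x \<noteq> 0"
    have "(\<lambda>i. ln (reg_sq i x) / 2) \<longlonglongrightarrow> ln ((norm x)\<^sup>2) / 2"
      using x by (intro tendsto_intros reg_sq_lim) auto
    then show "(\<lambda>i. ln (reg_sq i x) / 2) \<longlonglongrightarrow> ln (norm x)" using x by (simp add: ln_realpow)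
    fix i
    have "ln (reg_sq i x) \<le> ln ((1 + norm x)\<^sup>2)" using reg_sq_pos[of i x] s_le[of i x] by (subst ln_le_cancel_iff) auto
    also have "\<dots> = 2 * ln (1 + norm x)" by (simp add: ln_realpow add_pos_nonneg)
    also have "\<dots> \<le> 2 * norm x" using ln_add_one_self_le_self[of "norm x"] by simp
    finally have 1: "ln (reg_sq i x) / 2 \<le> norm x" by simp
    have "ln ((norm x)\<^sup>2) \<le> ln (reg_sq i x)" using reg_sq_ge[of x i] reg_sq_pos[of i x] x by (subst ln_le_cancel_iff) auto
    then have "2 * ln (norm x) \<le> ln (reg_sq i x)" using x by (simp add: ln_realpow)
    moreover have "ln (inverse (norm x)) \<le> inverse (norm x)" using x by (intro ln_bound) auto
    ultimately have 2: "- inverse (norm x) \<le> ln (reg_sq i x) / 2" using x by (simp add: ln_inverse)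
    show "\<bar>ln (reg_sq i x) / 2\<bar> \<le> 1 * inverse (norm x ^ 1) + 1 * norm x + 0"
      using 1 2 x by (simp add: abs_le_iff add_increasing add_increasing2)
  qed (use d test_function_laplacian[OF \<psi>] in simp_all)
  moreover have "(\<lambda>i. \<integral>x. H i x * \<psi> x \<partial>lborel) \<longlonglongrightarrow> (\<integral>x. (?d - 2) * inverse (norm x ^ 2) * \<psi> x \<partial>lborel)"
  proof (rule tendsto_integral_mult_test_function(2)[OF \<psi>, where m=2 and C="2 + ?d" and D=0 and E=0])
    fix x :: 'a assume x: "x \<noteq> 0"
    have "(\<lambda>i. H i x) \<longlonglongrightarrow> 4 * (norm x)\<^sup>2 * (- 1 / (2 * ((norm x)\<^sup>2)\<^sup>2)) + 2 * ?d * (1 / (2 * (norm x)\<^sup>2))"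
      unfolding H_def using x by (intro tendsto_intros reg_sq_lim) auto
    moreover have "4 * (norm x)\<^sup>2 * (- 1 / (2 * ((norm x)\<^sup>2)\<^sup>2)) + 2 * ?d * (1 / (2 * (norm x)\<^sup>2)) = (?d - 2) * inverse (norm x ^ 2)"
      using x by (simp add: field_simps power2_eq_square)
    ultimately show "(\<lambda>i. H i x) \<longlonglongrightarrow> (?d - 2) * inverse (norm x ^ 2)" by simp
    fix i
    have "\<bar>H i x\<bar> \<le> 2 * ((norm x)\<^sup>2 / (reg_sq i x)\<^sup>2) + ?d * (1 / reg_sq i x)"
      unfolding H_def using reg_sq_pos[of i x] by (intro abs_triangle_ineq[THEN order_trans]) (simp add: abs_mult)
    moreover have "(norm x)\<^sup>2 / (reg_sq i x)\<^sup>2 \<le> 1 / reg_sq i x"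
      using reg_sq_pos[of i x] reg_sq_ge[of x i] by (simp add: power2_eq_square[of "reg_sq i x"] divide_simps)
    ultimately have "\<bar>H i x\<bar> \<le> (2 + ?d) * (1 / reg_sq i x)" by (simp only: distrib_right)
    also have "\<dots> \<le> (2 + ?d) * inverse ((norm x)\<^sup>2)"
      using reg_sq_pos[of i x] reg_sq_ge[of x i] x by (intro mult_left_mono) (simp_all add: inverse_eq_divide frac_le)
    finally show "\<bar>H i x\<bar> \<le> (2 + ?d) * inverse (norm x ^ 2) + 0 * norm x + 0"
      by simp
  qed (use d in simp_all)
  ultimately have "(\<integral>x. ln (norm x) * laplacian \<psi> x \<partial>lborel) = (\<integral>x. (?d - 2) * (inverse (norm x ^ 2) * \<psi> x) \<partial>lborel)"
    unfolding E mult.assoc by (rule LIMSEQ_unique)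
  then show ?thesis using d by (simp add: of_nat_diff)
qed

lemma mult_inverse_power: "a * inverse (a ^ (k + 2)) = inverse (a ^ (k + 1))" if "a \<noteq> 0" for a :: real
  using that by (simp add: mult.assoc[symmetric])

lemma has_real_derivative_inverse_power:
  fixes s :: real
  assumes "s > 0"
  shows "((\<lambda>s. inverse (s ^ j)) has_real_derivative - real j * inverse (s ^ (j + 1))) (at s)"
proof (cases j)
  case (Suc i)
  have "((\<lambda>s. inverse s ^ Suc i) has_real_derivative (1 + real i) * (- (inverse s ^ Suc (Suc 0)) * inverse s ^ i)) (at s)"
    using assms by (intro DERIV_power_Suc DERIV_inverse) simp
  moreover have "(1 + real i) * (- (inverse s ^ Suc (Suc 0)) * inverse s ^ i) = - real j * inverse (s ^ (j + 1))"
    by (simp add: Suc power_inverse algebra_simps)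
  ultimately show ?thesis
    unfolding Suc power_inverse by simp
qed simp

lemma has_real_derivative_inverse_power2:
  fixes s :: real
  assumes "s > 0"
  shows "((\<lambda>s. - real j * inverse (s ^ (j + 1))) has_real_derivative real j * (real j + 1) * inverse (s ^ (j + 2))) (at s)"
  using DERIV_cmult[OF has_real_derivative_inverse_power[OF assms, of "j + 1"], of "- real j"]
  by (simp add: algebra_simps)

text \<open>Away from the origin this is the classical Laplacian of \<open>|x|^(-2j)\<close>. The
  strict inequality keeps \<open>|x|^(-2j-2)\<close> locally integrable, so the origin contributes
  nothing in the limit; at equality the factor would vanish and a point mass would remain.\<close>

lemma integral_inverse_norm_power_mult_laplacian:
  fixes \<psi> :: "'a::euclidean_space \<Rightarrow> real"
  assumes d: "2 * j + 2 < DIM('a)" and \<psi>: "test_function \<psi>"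
  shows "(\<integral>x. inverse (norm x ^ (2 * j)) * laplacian \<psi> x \<partial>lborel)
    = - (2 * j * (real DIM('a) - 2 * j - 2)) * (\<integral>x. inverse (norm x ^ (2 * (j + 1))) * \<psi> x \<partial>lborel)"
proof -
  let ?d = "real DIM('a)" and ?c = "- (2 * j * (real DIM('a) - 2 * j - 2))"
  define H where "H i x = 4 * (norm x)\<^sup>2 * (real j * (real j + 1) * inverse (reg_sq i x ^ (j + 2)))
      + 2 * ?d * (- real j * inverse (reg_sq i x ^ (j + 1)))" for i and x :: 'a
  have [measurable]: "H i \<in> borel_measurable borel" for i unfolding H_def by measurable
  have E: "(\<integral>x. inverse (reg_sq i x ^ j) * laplacian \<psi> x \<partial>lborel) = (\<integral>x. H i x * \<psi> x \<partial>lborel)" for i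
    unfolding reg_sq_def H_def
    by (rule integral_radial_mult_laplacian[OF _ has_real_derivative_inverse_power has_real_derivative_inverse_power2 _ \<psi>])
      (auto intro!: continuous_intros)
  have "(\<lambda>i. \<integral>x. inverse (reg_sq i x ^ j) * laplacian \<psi> x \<partial>lborel) \<longlonglongrightarrow> (\<integral>x. inverse (norm x ^ (2 * j)) * laplacian \<psi> x \<partial>lborel)"
  proof (rule tendsto_integral_mult_test_function(2)[where m="2 * j" and C=1 and D=0 and E=0])
    fix x :: 'a assume x: "x \<noteq> 0"
    show "(\<lambda>i. inverse (reg_sq i x ^ j)) \<longlonglongrightarrow> inverse (norm x ^ (2 * j))"
      unfolding power_mult using x by (intro tendsto_intros reg_sq_lim) auto
    show "\<bar>inverse (reg_sq i x ^ j)\<bar> \<le> 1 * inverse (norm x ^ (2 * j)) + 0 * norm x + 0" for i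
      using reg_sq_inv[OF x, of i j] reg_sq_pos[of i x] by simp
  qed (use d test_function_laplacian[OF \<psi>] in simp_all)
  moreover have "(\<lambda>i. \<integral>x. H i x * \<psi> x \<partial>lborel) \<longlonglongrightarrow> (\<integral>x. ?c * inverse (norm x ^ (2 * (j + 1))) * \<psi> x \<partial>lborel)"
  proof (rule tendsto_integral_mult_test_function(2)[OF \<psi>, where m="2 * (j + 1)" and D=0 and E=0
        and C="4 * (real j * (real j + 1)) + 2 * ?d * j"])
    fix x :: 'a assume x: "x \<noteq> 0"
    have "(\<lambda>i. H i x) \<longlonglongrightarrow> 4 * (norm x)\<^sup>2 * (real j * (real j + 1) * inverse (((norm x)\<^sup>2) ^ (j + 2)))
      + 2 * ?d * (- real j * inverse (((norm x)\<^sup>2) ^ (j + 1)))"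
      unfolding H_def using x by (intro tendsto_intros reg_sq_lim) auto
    moreover have "4 * (norm x)\<^sup>2 * (real j * (real j + 1) * inverse (((norm x)\<^sup>2) ^ (j + 2)))
      + 2 * ?d * (- real j * inverse (((norm x)\<^sup>2) ^ (j + 1))) = ?c * inverse (norm x ^ (2 * (j + 1)))"
    proof -
      have "(norm x)\<^sup>2 * inverse (((norm x)\<^sup>2) ^ (j + 2)) = inverse (((norm x)\<^sup>2) ^ (j + 1))"
        using x by (intro mult_inverse_power) simp
      moreover have "4 * (norm x)\<^sup>2 * (real j * (real j + 1) * inverse (((norm x)\<^sup>2) ^ (j + 2)))
          = 4 * (real j * (real j + 1)) * ((norm x)\<^sup>2 * inverse (((norm x)\<^sup>2) ^ (j + 2)))"
        by (simp only: mult_ac)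
      ultimately have "4 * (norm x)\<^sup>2 * (real j * (real j + 1) * inverse (((norm x)\<^sup>2) ^ (j + 2)))
          = 4 * (real j * (real j + 1)) * inverse (((norm x)\<^sup>2) ^ (j + 1))" by (simp only:)
      moreover have "4 * (q * (q + 1)) * B + 2 * D * (- q * B) = - (2 * q * (D - 2 * q - 2)) * B" for q D B :: real
        by (simp add: algebra_simps)
      ultimately show ?thesis unfolding power_mult by (simp only: of_nat_mult of_nat_numeral)
    qed
    ultimately show "(\<lambda>i. H i x) \<longlonglongrightarrow> ?c * inverse (norm x ^ (2 * (j + 1)))" by simp
    fix i
    have "(norm x)\<^sup>2 * inverse (reg_sq i x ^ (j + 2)) \<le> reg_sq i x * inverse (reg_sq i x ^ (j + 2))"
      using reg_sq_pos[of i x] by (intro mult_right_mono reg_sq_ge) simp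
    also have "\<dots> = inverse (reg_sq i x ^ (j + 1))" using reg_sq_pos[of i x] by (intro mult_inverse_power) simp
    finally have le: "(norm x)\<^sup>2 * inverse (reg_sq i x ^ (j + 2)) \<le> inverse (reg_sq i x ^ (j + 1))" .
    let ?A = "(norm x)\<^sup>2 * inverse (reg_sq i x ^ (j + 2))" and ?B = "inverse (reg_sq i x ^ (j + 1))"
    have B0: "0 \<le> ?B" "0 \<le> ?A" using reg_sq_pos[of i x] by simp_all
    have "H i x = 4 * (real j * (real j + 1)) * ?A - 2 * ?d * j * ?B"
      unfolding H_def by (simp only: mult_ac mult_minus_left mult_minus_right diff_conv_add_uminus)
    moreover have "0 \<le> 4 * (real j * (real j + 1)) * ?A"
      by (rule mult_nonneg_nonneg[OF _ B0(2)]) simp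
    moreover have "0 \<le> 2 * ?d * j * ?B"
      by (rule mult_nonneg_nonneg[OF _ B0(1)]) simp
    moreover have "4 * (real j * (real j + 1)) * ?A \<le> 4 * (real j * (real j + 1)) * ?B"
      by (rule mult_left_mono[OF le]) simp
    ultimately have "\<bar>H i x\<bar> \<le> 4 * (real j * (real j + 1)) * ?B + 2 * ?d * j * ?B"
      unfolding abs_le_iff by linarith
    also have "\<dots> = (4 * (real j * (real j + 1)) + 2 * ?d * j) * ?B" by (rule distrib_right[symmetric])
    also have "\<dots> \<le> (4 * (real j * (real j + 1)) + 2 * ?d * j) * inverse (norm x ^ (2 * (j + 1)))"
      by (rule mult_left_mono[OF reg_sq_inv[OF x]]) simp
    finally show "\<bar>H i x\<bar> \<le> (4 * (real j * (real j + 1)) + 2 * ?d * j) * inverse (norm x ^ (2 * (j + 1))) + 0 * norm x + 0"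
      by simp
  qed (use d in simp_all)
  ultimately have "(\<integral>x. inverse (norm x ^ (2 * j)) * laplacian \<psi> x \<partial>lborel)
      = (\<integral>x. ?c * (inverse (norm x ^ (2 * (j + 1))) * \<psi> x) \<partial>lborel)"
    unfolding E mult.assoc by (rule LIMSEQ_unique)
  also have "\<dots> = ?c * (\<integral>x. inverse (norm x ^ (2 * (j + 1))) * \<psi> x \<partial>lborel)"
    by (rule integral_mult_right_zero)
  finally show ?thesis by (simp only: of_nat_mult of_nat_numeral)
qed

section \<open>The point mass of the Newton kernel\<close>

lemma integral_lborel_scaleR:
  fixes f :: "'a::euclidean_space \<Rightarrow> real"
  assumes [measurable]: "f \<in> borel_measurable borel" and c: "c > 0"
  shows "(\<integral>x. f x \<partial>lborel) = c ^ DIM('a) * (\<integral>x. f (c *\<^sub>R x) \<partial>lborel)"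
proof -
  have "(\<integral>x. f x \<partial>lborel) = (\<integral>x. f x \<partial>density (distr lborel borel (\<lambda>x::'a. 0 + c *\<^sub>R x)) (\<lambda>_. \<bar>c\<bar> ^ DIM('a)))"
    using lborel_affine[of c "0::'a"] c by simp
  also have "\<dots> = (\<integral>x. c ^ DIM('a) * f x \<partial>distr lborel borel (\<lambda>x::'a. 0 + c *\<^sub>R x))"
    using c by (subst integral_real_density) auto
  also have "\<dots> = (\<integral>x. c ^ DIM('a) * f (c *\<^sub>R x) \<partial>lborel)"
    by (subst integral_distr) auto
  finally show ?thesis by simp
qed

text \<open>This is the critical power, with \<open>j = n - 1\<close> and \<open>2 * j + 2\<close>
  equal to the dimension. The Laplacian of the regularised kernel is a negative multiple of
  \<open>\<epsilon> / s^(n+1)\<close> with \<open>s = |x|^2 + \<epsilon>\<close>, and scaling by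
  \<open>sqrt \<epsilon>\<close> turns it into a fixed multiple of the bubble. It is thus an
  approximate identity, and \<open>\<kappa>\<close> is read off from the bubble without any surface
  measure.\<close>

lemma integral_newton_kernel_mult_laplacian:
  fixes n :: nat
  assumes d: "DIM('a::euclidean_space) = 2 * n" and n: "n \<ge> 2"
  obtains \<kappa> where "\<kappa> > 0"
    "\<And>\<psi>::'a \<Rightarrow> real. test_function \<psi> \<Longrightarrow> (\<integral>x. inverse (norm x ^ (2 * (n - 1))) * laplacian \<psi> x \<partial>lborel) = - \<kappa> * \<psi> 0"
proof
  let ?b = "\<lambda>x::'a. inverse (((norm x)\<^sup>2 + 1) ^ (n + 1))"
  let ?\<kappa> = "4 * real (n - 1) * n * (\<integral>x. ?b x \<partial>lborel)"
  have b_int: "integrable lborel ?b" by (rule integrable_bubble[OF d])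
  have b_pos: "?b x > 0" for x by (simp add: add_nonneg_pos)
  have "(\<integral>x. ?b x \<partial>lborel) \<noteq> 0"
  proof
    assume "(\<integral>x. ?b x \<partial>lborel) = 0"
    then have "AE x in lborel. ?b x = 0"
      using integral_nonneg_eq_0_iff_AE[OF b_int] b_pos by (simp add: less_imp_le)
    then have "AE x::'a in lborel. False"
      by eventually_elim (metis b_pos less_irrefl)
    then have "ae_filter (lborel :: 'a measure) = bot" by (simp add: trivial_limit_def)
    then show False by (simp add: ae_filter_eq_bot_iff)
  qed
  moreover have "(\<integral>x. ?b x \<partial>lborel) \<ge> 0"
    by (intro Bochner_Integration.integral_nonneg less_imp_le[OF b_pos])
  ultimately show "?\<kappa> > 0" using n by (simp add: less_le)
  fix \<psi> :: "'a \<Rightarrow> real" assume \<psi>: "test_function \<psi>"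
  note [measurable] = test_function_measurable[OF \<psi>]
  define j where "j = n - 1"
  have E: "(\<integral>x. inverse (reg_sq i x ^ j) * laplacian \<psi> x \<partial>lborel)
      = (\<integral>x. - (4 * real j * n) * (?b x * \<psi> (sqrt (1 / Suc i) *\<^sub>R x)) \<partial>lborel)" for i
  proof -
    define \<epsilon> where "\<epsilon> = 1 / real (Suc i)"
    have \<epsilon>: "\<epsilon> > 0" by (simp add: \<epsilon>_def)
    have s: "reg_sq i x = (norm x)\<^sup>2 + \<epsilon>" for x by (simp add: reg_sq_def \<epsilon>_def)
    have nj: "j + 1 = n" using n by (simp add: j_def)
    have "(\<integral>x. inverse (reg_sq i x ^ j) * laplacian \<psi> x \<partial>lborel)
        = (\<integral>x. (4 * (norm x)\<^sup>2 * (real j * (real j + 1) * inverse (reg_sq i x ^ (j + 2)))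
      + 2 * real DIM('a) * (- real j * inverse (reg_sq i x ^ (j + 1)))) * \<psi> x \<partial>lborel)"
      unfolding s
      by (rule integral_radial_mult_laplacian[OF \<epsilon> has_real_derivative_inverse_power has_real_derivative_inverse_power2 _ \<psi>])
        (auto intro!: continuous_intros)
    also have "(\<lambda>x. 4 * (norm x)\<^sup>2 * (real j * (real j + 1) * inverse (reg_sq i x ^ (j + 2)))
      + 2 * real DIM('a) * (- real j * inverse (reg_sq i x ^ (j + 1)))) = (\<lambda>x. - (4 * real j * n) * (\<epsilon> * inverse (reg_sq i x ^ (n + 1))))"
    proof
      fix x
      have inv: "inverse (reg_sq i x ^ (j + 1)) = ((norm x)\<^sup>2 + \<epsilon>) * inverse (reg_sq i x ^ (n + 1))"
        using reg_sq_pos[of i x] mult_inverse_power[of "reg_sq i x" j] unfolding s[symmetric] by (simp add: nj[symmetric])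
      \<comment> \<open>As \<open>j + 1 = n\<close> and the dimension is \<open>2 * n\<close>, the
        terms with \<open>N\<close>, the squared norm, cancel and only the one with
        \<open>\<epsilon>\<close> survives.\<close>
      have alg: "4 * N * (J * m * I) + 2 * (2 * m) * (- J * ((N + \<epsilon>) * I)) = - (4 * J * m) * (\<epsilon> * I)" for N J m I
        by (simp add: algebra_simps)
      have nj2: "j + 2 = n + 1" "real j + 1 = real n" using nj by linarith+
      show "4 * (norm x)\<^sup>2 * (real j * (real j + 1) * inverse (reg_sq i x ^ (j + 2)))
        + 2 * real DIM('a) * (- real j * inverse (reg_sq i x ^ (j + 1))) = - (4 * real j * n) * (\<epsilon> * inverse (reg_sq i x ^ (n + 1)))"
        unfolding inv nj2 d by (simp only: alg of_nat_mult of_nat_numeral)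
    qed
    also have "(\<integral>x. - (4 * real j * n) * (\<epsilon> * inverse (reg_sq i x ^ (n + 1))) * \<psi> x \<partial>lborel)
      = sqrt \<epsilon> ^ DIM('a) * (\<integral>x. - (4 * real j * n) * (\<epsilon> * inverse (reg_sq i (sqrt \<epsilon> *\<^sub>R x) ^ (n + 1))) * \<psi> (sqrt \<epsilon> *\<^sub>R x) \<partial>lborel)"
      using \<epsilon> by (intro integral_lborel_scaleR) simp_all
    also have "\<dots> = (\<integral>x. \<epsilon> ^ n * (- (4 * real j * n) * (\<epsilon> * inverse (reg_sq i (sqrt \<epsilon> *\<^sub>R x) ^ (n + 1))) * \<psi> (sqrt \<epsilon> *\<^sub>R x)) \<partial>lborel)"
      using \<epsilon> by (simp add: d power_mult)
    \<comment> \<open>The Jacobian \<open>\<epsilon> ^ n\<close> and the spare factor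
      \<open>\<epsilon>\<close> cancel the power \<open>n + 1\<close> of \<open>\<epsilon>\<close>
      in the denominator.\<close>
    also have "\<dots> = (\<integral>x. - (4 * real j * n) * (?b x * \<psi> (sqrt \<epsilon> *\<^sub>R x)) \<partial>lborel)"
    proof (rule Bochner_Integration.integral_cong[OF refl])
      fix x :: 'a
      have "reg_sq i (sqrt \<epsilon> *\<^sub>R x) = \<epsilon> * ((norm x)\<^sup>2 + 1)"
        using \<epsilon> by (simp add: s power_mult_distrib distrib_left)
      then have "\<epsilon> ^ n * (\<epsilon> * inverse (reg_sq i (sqrt \<epsilon> *\<^sub>R x) ^ (n + 1))) = ?b x"
        using \<epsilon> by (simp only: power_mult_distrib inverse_mult_distrib) (simp add: mult.assoc[symmetric] power_inverse)
      then show "\<epsilon> ^ n * (- (4 * real j * n) * (\<epsilon> * inverse (reg_sq i (sqrt \<epsilon> *\<^sub>R x) ^ (n + 1))) * \<psi> (sqrt \<epsilon> *\<^sub>R x))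
         = - (4 * real j * n) * (?b x * \<psi> (sqrt \<epsilon> *\<^sub>R x))"
        unfolding \<open>\<epsilon> ^ n * (\<epsilon> * inverse (reg_sq i (sqrt \<epsilon> *\<^sub>R x) ^ (n + 1))) = ?b x\<close>[symmetric]
        by (simp only: mult_ac mult_minus_left mult_minus_right)
    qed
    finally show ?thesis by (simp only: \<epsilon>_def)
  qed
  have "(\<lambda>i. \<integral>x. inverse (reg_sq i x ^ j) * laplacian \<psi> x \<partial>lborel) \<longlonglongrightarrow> (\<integral>x. inverse (norm x ^ (2 * j)) * laplacian \<psi> x \<partial>lborel)"
  proof (rule tendsto_integral_mult_test_function(2)[where m="2 * j" and C=1 and D=0 and E=0])
    fix x :: 'a assume x: "x \<noteq> 0"
    show "(\<lambda>i. inverse (reg_sq i x ^ j)) \<longlonglongrightarrow> inverse (norm x ^ (2 * j))"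
      unfolding power_mult using x by (intro tendsto_intros reg_sq_lim) auto
    show "\<bar>inverse (reg_sq i x ^ j)\<bar> \<le> 1 * inverse (norm x ^ (2 * j)) + 0 * norm x + 0" for i
      using reg_sq_inv[OF x, of i j] reg_sq_pos[of i x] by simp
  qed (use d n test_function_laplacian[OF \<psi>] in \<open>simp_all add: j_def\<close>)
  moreover have "(\<lambda>i. \<integral>x. - (4 * real j * n) * (?b x * \<psi> (sqrt (1 / Suc i) *\<^sub>R x)) \<partial>lborel)
      \<longlonglongrightarrow> (\<integral>x. - (4 * real j * n) * (?b x * \<psi> 0) \<partial>lborel)"
  proof -
    obtain M where M: "M \<ge> 0" "\<And>x. \<bar>\<psi> x\<bar> \<le> M" by (rule test_function_bounded[OF \<psi>]) blast
    have lim: "(\<lambda>i. \<psi> (sqrt (1 / Suc i) *\<^sub>R x)) \<longlonglongrightarrow> \<psi> 0" for x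
    proof (rule isCont_tendsto_compose[where g=\<psi>])
      show "isCont \<psi> 0" using test_function_continuous[OF \<psi>] by (simp add: continuous_on_eq_continuous_at)
      have "(\<lambda>i. sqrt (1 / Suc i) *\<^sub>R x) \<longlonglongrightarrow> sqrt 0 *\<^sub>R x"
        by (intro tendsto_intros LIMSEQ_Suc[OF lim_1_over_n])
      then show "(\<lambda>i. sqrt (1 / Suc i) *\<^sub>R x) \<longlonglongrightarrow> 0" by simp
    qed
    show ?thesis
    proof (rule integral_dominated_convergence[where w="\<lambda>x. (4 * real j * n * M) * ?b x"])
      show "integrable lborel (\<lambda>x. (4 * real j * n * M) * ?b x)"
        by (intro integrable_mult_right b_int)
      show "AE x in lborel. (\<lambda>i. - (4 * real j * n) * (?b x * \<psi> (sqrt (1 / Suc i) *\<^sub>R x))) \<longlonglongrightarrow> - (4 * real j * n) * (?b x * \<psi> 0)"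
        by (intro AE_I2 tendsto_mult tendsto_const lim)
      fix i
      show "AE x in lborel. norm (- (4 * real j * n) * (?b x * \<psi> (sqrt (1 / Suc i) *\<^sub>R x))) \<le> (4 * real j * n * M) * ?b x"
      proof (rule AE_I2)
        fix x :: 'a
        have "?b x * \<bar>\<psi> (sqrt (1 / Suc i) *\<^sub>R x)\<bar> \<le> ?b x * M"
          by (intro mult_left_mono M(2) less_imp_le[OF b_pos])
        then have "(4 * real j * n) * (?b x * \<bar>\<psi> (sqrt (1 / Suc i) *\<^sub>R x)\<bar>) \<le> (4 * real j * n) * (?b x * M)"
          by (rule mult_left_mono) simp
        moreover have "norm (- (4 * real j * n) * (?b x * \<psi> (sqrt (1 / Suc i) *\<^sub>R x)))
            = (4 * real j * n) * (?b x * \<bar>\<psi> (sqrt (1 / Suc i) *\<^sub>R x)\<bar>)"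
          using b_pos[of x] by (simp only: norm_mult norm_minus_cancel real_norm_def abs_of_pos abs_mult abs_of_nat abs_numeral abs_minus_cancel)
        ultimately show "norm (- (4 * real j * n) * (?b x * \<psi> (sqrt (1 / Suc i) *\<^sub>R x))) \<le> (4 * real j * n * M) * ?b x"
          by (simp only: mult_ac)
      qed
    qed simp_all
  qed
  ultimately have "(\<integral>x. inverse (norm x ^ (2 * j)) * laplacian \<psi> x \<partial>lborel) = (\<integral>x. - (4 * real j * n) * (?b x * \<psi> 0) \<partial>lborel)"
    unfolding E by (rule LIMSEQ_unique)
  then show "(\<integral>x. inverse (norm x ^ (2 * (n - 1))) * laplacian \<psi> x \<partial>lborel) = - ?\<kappa> * \<psi> 0"
    unfolding j_def[symmetric] by simp
qed

text \<open>Each step moves the outermost Laplacian onto the kernel, which makes the power two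
  orders more singular and yields a positive factor; the Newton kernel with its point mass ends the
  chain at \<open>k = 1\<close>. The range stops at \<open>n - 1\<close> because at
  \<open>k = n\<close> the exponent would be 0 and the logarithm has to take over.\<close>

lemma neg_laplacian_pow_newton:
  assumes d: "DIM('a::euclidean_space) = 2 * n" and n: "n \<ge> 2" and k: "1 \<le> k" "k \<le> n - 1"
  shows "\<exists>c>0. \<forall>\<phi>::'a \<Rightarrow> real. test_function \<phi> \<longrightarrow>
    (\<integral>x. inverse (norm x ^ (2 * (n - k))) * neg_laplacian_pow k \<phi> x \<partial>lborel) = c * \<phi> 0"
  using k
proof (induction k rule: dec_induct)
  case base
  obtain \<kappa> where \<kappa>: "\<kappa> > 0"
    "\<And>\<psi>::'a \<Rightarrow> real. test_function \<psi> \<Longrightarrow> (\<integral>x. inverse (norm x ^ (2 * (n - 1))) * laplacian \<psi> x \<partial>lborel) = - \<kappa> * \<psi> 0"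
    by (rule integral_newton_kernel_mult_laplacian[OF d n]) blast
  then show ?case by (intro exI[of _ \<kappa>]) (simp add: neg_laplacian_pow_def)
next
  case (step k)
  define j where "j = n - Suc k"
  have j: "n - k = j + 1" "1 \<le> j" "2 * j + 2 < DIM('a)" using step d by (auto simp: j_def)
  obtain c where c: "c > 0" "\<And>\<phi>::'a \<Rightarrow> real. test_function \<phi> \<Longrightarrow>
    (\<integral>x. inverse (norm x ^ (2 * (j + 1))) * neg_laplacian_pow k \<phi> x \<partial>lborel) = c * \<phi> 0"
    using step j(1) by auto
  let ?q = "2 * j * (real DIM('a) - 2 * j - 2)"
  have "real (2 * j + 2) < real DIM('a)" using j(3) by (simp only: of_nat_less_iff)
  then have q: "?q > 0" using j(2) by simp
  have "(\<integral>x. inverse (norm x ^ (2 * j)) * neg_laplacian_pow (Suc k) \<phi> x \<partial>lborel) = (?q * c) * \<phi> 0"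
    if \<phi>: "test_function \<phi>" for \<phi> :: "'a \<Rightarrow> real"
    using integral_inverse_norm_power_mult_laplacian[OF j(3) test_function_neg_laplacian_pow[OF \<phi>, of k]] c(2)[OF \<phi>]
    by (simp add: neg_laplacian_pow_Suc)
  moreover have "?q * c > 0" using q c(1) by simp
  ultimately show ?case unfolding j_def[symmetric] by blast
qed

text \<open>One Laplacian turns the logarithm into \<open>(d - 2) / |x|^2\<close>, and the remaining
  power \<open>n - 1\<close> acts on \<open>|x|^(-2)\<close> by the chain for powers. The minus sign
  comes from this one step, since the Laplacian of the logarithm is positive. Translation reduces
  \<open>y\<close> to the origin.\<close>

lemma neg_laplacian_pow_fundamental_solution:
  assumes d: "DIM('a::euclidean_space) = 2 * n" and n: "n \<ge> 2"
  obtains \<gamma> where "\<gamma> > 0"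
    "\<And>\<phi> y::'a. test_function \<phi> \<Longrightarrow> (\<integral>x. ln (norm (x - y)) * neg_laplacian_pow n \<phi> x \<partial>lborel) = - \<gamma> * \<phi> y"
proof -
  obtain c where c: "c > 0" "\<And>\<phi>::'a \<Rightarrow> real. test_function \<phi> \<Longrightarrow>
    (\<integral>x. inverse (norm x ^ (2 * (n - (n - 1)))) * neg_laplacian_pow (n - 1) \<phi> x \<partial>lborel) = c * \<phi> 0"
  proof -
    have "1 \<le> n - 1" using n by simp
    then show ?thesis using that neg_laplacian_pow_newton[OF d n _ order_refl] by blast
  qed
  have pow2: "2 * (n - (n - 1)) = 2" and Suc: "Suc (n - 1) = n" using n by auto
  have dge: "DIM('a) > 2" using d n by simp
  show ?thesis
  proof
    show "real (DIM('a) - 2) * c > 0" using c dge by simp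
    fix \<phi> :: "'a \<Rightarrow> real" and y :: 'a assume \<phi>: "test_function \<phi>"
    define \<psi> where "\<psi> = (\<lambda>x. \<phi> (x + y))"
    have \<psi>: "test_function \<psi>" unfolding \<psi>_def by (rule test_function_translate[OF \<phi>])
    note [measurable] = test_function_measurable[OF test_function_neg_laplacian_pow[OF \<phi>]]
    have "(\<integral>x. ln (norm (x - y)) * neg_laplacian_pow n \<phi> x \<partial>lborel)
        = (\<integral>x. ln (norm ((x + y) - y)) * neg_laplacian_pow n \<phi> (x + y) \<partial>lborel)"
      by (rule integral_lborel_translate[symmetric]) measurable
    also have "\<dots> = (\<integral>x. ln (norm x) * neg_laplacian_pow (Suc (n - 1)) \<psi> x \<partial>lborel)"
      by (simp only: \<psi>_def neg_laplacian_pow_translate Suc add_diff_cancel_right')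
    also have "\<dots> = - (\<integral>x. ln (norm x) * laplacian (neg_laplacian_pow (n - 1) \<psi>) x \<partial>lborel)"
      by (simp add: neg_laplacian_pow_Suc)
    also have "\<dots> = - (real (DIM('a) - 2) * (c * \<psi> 0))"
      using integral_ln_norm_mult_laplacian[OF dge test_function_neg_laplacian_pow[OF \<psi>, of "n - 1"]] c(2)[OF \<psi>]
      unfolding pow2 by simp
    finally show "(\<integral>x. ln (norm (x - y)) * neg_laplacian_pow n \<phi> x \<partial>lborel) = - (real (DIM('a) - 2) * c) * \<phi> y"
      by (simp add: \<psi>_def)
  qed
qed

text \<open>Green's identity against the constant 1. It makes additive constants in the potential
  invisible to the equation.\<close>

lemma integral_neg_laplacian_pow_eq_0:
  fixes \<phi> :: "'a::euclidean_space \<Rightarrow> real"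
  assumes \<phi>: "test_function \<phi>" and n: "n \<ge> 1"
  shows "(\<integral>x. neg_laplacian_pow n \<phi> x \<partial>lborel) = 0"
proof -
  obtain k where k: "n = Suc k" using n by (cases n) auto
  have "(\<integral>x. 1 * laplacian (neg_laplacian_pow k \<phi>) x \<partial>lborel) = (\<integral>x. (\<Sum>b\<in>(Basis::'a set). 0) * neg_laplacian_pow k \<phi> x \<partial>lborel)"
    by (rule integral_mult_laplacian[where H="\<lambda>_ _. 0"])
      (simp_all add: test_function_neg_laplacian_pow[OF \<phi>])
  then show ?thesis by (simp add: k neg_laplacian_pow_Suc)
qed

section \<open>The mean field equation on a finite set\<close>

text \<open>Only the endpoint 0 needs an estimate: \<open>ln z \<le> z\<close> at
  \<open>z = inverse (sqrt y)\<close> gives \<open>- y * ln y \<le> 2 * sqrt y\<close>.\<close>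

lemma continuous_on_xlnx: "continuous_on {0..} (\<lambda>x::real. x * ln x)"
proof (rule continuous_onI)
  fix x e :: real assume x: "x \<in> {0..}" and e: "e > 0"
  have bd: "\<bar>y * ln y\<bar> \<le> 2 * sqrt y + y\<^sup>2" if "y \<ge> 0" for y :: real
  proof (cases "y = 0")
    case False
    then have y: "y > 0" using that by simp
    have "y * ln y \<le> y * y" using y ln_bound[OF y] by (intro mult_left_mono) auto
    moreover have "- ln y = 2 * ln (inverse (sqrt y))" using y by (simp add: ln_inverse ln_sqrt)
    then have "- ln y \<le> 2 * inverse (sqrt y)" using y ln_bound[of "inverse (sqrt y)"] by simp
    then have "y * (- ln y) \<le> y * (2 * inverse (sqrt y))" using y by (intro mult_left_mono) auto
    moreover have "y * (2 * inverse (sqrt y)) = 2 * sqrt y"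
      using y by (simp add: field_simps)
    ultimately show ?thesis using y by (simp add: abs_le_iff power2_eq_square add_increasing add_increasing2)
  qed simp
  have "((\<lambda>y. y * ln y) \<longlongrightarrow> x * ln x) (at x within {0..})"
  proof (cases "x = 0")
    case True
    have "((\<lambda>y::real. 2 * sqrt y + y\<^sup>2) \<longlongrightarrow> 2 * sqrt 0 + 0\<^sup>2) (at 0 within {0..})"
      by (intro tendsto_intros)
    then have lim0: "((\<lambda>y::real. 2 * sqrt y + y\<^sup>2) \<longlongrightarrow> 0) (at 0 within {0..})" by simp
    have "\<forall>\<^sub>F y::real in at 0 within {0..}. norm (y * ln y) \<le> 2 * sqrt y + y\<^sup>2"
      unfolding eventually_at_filter real_norm_def by (rule always_eventually) (blast intro: bd dest: atLeast_iff[THEN iffD1])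
    from Lim_null_comparison[OF this lim0] show ?thesis using True by simp
  next
    case False
    then show ?thesis by (intro tendsto_intros) auto
  qed
  then have "\<forall>\<^sub>F y in at x within {0..}. dist (y * ln y) (x * ln x) < e" using e by (rule tendstoD)
  then obtain d where "d > 0" "\<forall>y\<in>{0..}. y \<noteq> x \<and> dist y x < d \<longrightarrow> dist (y * ln y) (x * ln x) < e"
    by (auto simp: eventually_at)
  then show "\<exists>d>0. \<forall>x'\<in>{0..}. dist x' x < d \<longrightarrow> dist (x' * ln x') (x * ln x) \<le> e"
    using e by (metis dist_self less_imp_le)
qed

text \<open>Convexity: the tangent of \<open>x ln x\<close> at \<open>b\<close> lies below the
  graph. The point \<open>a\<close> may be 0, whereas at \<open>b = 0\<close> the slope would be
  infinite.\<close>

lemma xlnx_tangent: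
  fixes a b :: real
  assumes "a \<ge> 0" "b > 0"
  shows "b * ln b - a * ln a \<le> (b - a) * (ln b + 1)"
proof (cases "a = 0")
  case False
  then have a: "a > 0" using assms by simp
  have "ln (b / a) \<le> b / a - 1" using a assms by (intro ln_le_minus_one) simp
  then have "a * (ln b - ln a) \<le> a * (b / a - 1)"
    using a assms by (intro mult_left_mono) (auto simp: ln_div)
  then show ?thesis using a by (simp add: algebra_simps)
qed (use assms in \<open>simp add: algebra_simps\<close>)

text \<open>\<open>P\<close> is a closed part of a product of compact intervals: the mass constraint
  caps \<open>r i\<close> by \<open>1 / m i\<close>, and coordinates outside \<open>S\<close> are
  pinned to 0, so Tychonoff's theorem gives compactness. Continuity of \<open>x ln x\<close> up to 0
  makes \<open>E\<close> continuous on all of \<open>P\<close>.\<close>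

lemma finite_mean_field_minimiser:
  fixes m :: "'i \<Rightarrow> real" and A :: "'i \<Rightarrow> 'i \<Rightarrow> real"
  assumes S: "finite S" "S \<noteq> {}" and m: "\<And>i. i \<in> S \<Longrightarrow> m i > 0"
  defines "P \<equiv> {r. (\<forall>i\<in>S. 0 \<le> r i) \<and> (\<forall>i. i \<notin> S \<longrightarrow> r i = 0) \<and> (\<Sum>i\<in>S. m i * r i) = 1}"
    and "E \<equiv> \<lambda>r. (\<Sum>i\<in>S. m i * (r i * ln (r i))) - (\<Sum>i\<in>S. \<Sum>j\<in>S. m i * m j * A i j * r i * r j) / 2"
  shows "\<exists>r\<in>P. \<forall>q\<in>P. E r \<le> E q"
proof -
  define K where "K = PiE UNIV (\<lambda>i. if i \<in> S then {0..1 / m i} else {0})"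
  have K_compact: "compact K"
  proof -
    have "compactin (product_topology (\<lambda>i. euclidean) UNIV) K"
      unfolding K_def compactin_PiE by simp
    then show ?thesis by (simp add: euclidean_product_topology)
  qed
  have co: "continuous_on X (\<lambda>r. r i)" for X :: "('i \<Rightarrow> real) set" and i
    by (rule continuous_on_subset[OF continuous_on_product_coordinates]) simp
  have "P = K \<inter> {r. (\<Sum>i\<in>S. m i * r i) = 1}"
  proof (intro set_eqI iffI)
    fix r assume r: "r \<in> P"
    have "r i \<le> 1 / m i" if "i \<in> S" for i
    proof -
      have "m i * r i \<le> (\<Sum>i\<in>S. m i * r i)"
        using r that m S by (intro member_le_sum) (auto simp: P_def less_imp_le)
      then show ?thesis using r m[OF that] by (simp add: P_def field_simps)
    qed
    then show "r \<in> K \<inter> {r. (\<Sum>i\<in>S. m i * r i) = 1}"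
      using r by (auto simp: P_def K_def)
  next
    fix r assume "r \<in> K \<inter> {r. (\<Sum>i\<in>S. m i * r i) = 1}"
    then show "r \<in> P" by (auto simp: P_def K_def PiE_iff split: if_splits)
  qed
  moreover have "closed {r. (\<Sum>i\<in>S. m i * r i) = 1}"
    by (intro closed_Collect_eq continuous_on_sum continuous_on_mult continuous_on_const co)
  ultimately have "compact P" using K_compact by (simp add: compact_Int_closed)
  moreover have "P \<noteq> {}"
  proof -
    obtain i where i: "i \<in> S" using S by blast
    have "(\<lambda>k. if k = i then 1 / m i else 0) \<in> P"
      using i m[OF i] S by (auto simp: P_def if_distrib[of "\<lambda>x. m _ * x"] sum.delta cong: if_cong)
    then show ?thesis by blast
  qed
  moreover have "continuous_on P E"
  proof -
    have "continuous_on P (\<lambda>r. r i * ln (r i))" if "i \<in> S" for i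
      by (rule continuous_on_compose2[OF continuous_on_xlnx co]) (use that in \<open>auto simp: P_def\<close>)
    then have "continuous_on P (\<lambda>r. \<Sum>i\<in>S. m i * (r i * ln (r i)))"
      by (intro continuous_on_sum continuous_on_mult_left) auto
    moreover have "continuous_on P (\<lambda>r. (\<Sum>i\<in>S. \<Sum>j\<in>S. m i * m j * A i j * r i * r j) / 2)"
      by (intro continuous_on_divide continuous_on_sum continuous_on_mult continuous_on_const co) auto
    ultimately show ?thesis unfolding E_def by (rule continuous_on_diff)
  qed
  ultimately show ?thesis by (intro continuous_attains_inf)
qed

text \<open>
  The minimiser is compared with itself after mass \<open>t\<close> has been moved from \<open>j\<close> to \<open>i\<close>. The tangent
  inequality for \<open>x ln x\<close> at the new point, rather than a derivative at the old one, also covers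
  \<open>r i = 0\<close>, so that no separate argument is needed to keep the minimiser off the boundary.
\<close>

lemma finite_mean_field:
  fixes m :: "'i \<Rightarrow> real" and A :: "'i \<Rightarrow> 'i \<Rightarrow> real"
  assumes S: "finite S" "S \<noteq> {}" and m: "\<And>i. i \<in> S \<Longrightarrow> m i > 0"
    and sym: "\<And>i j. i \<in> S \<Longrightarrow> j \<in> S \<Longrightarrow> A i j = A j i"
  obtains r w where "\<And>i. i \<in> S \<Longrightarrow> r i \<ge> 0" "(\<Sum>i\<in>S. m i * r i) = 1"
    "\<And>i. i \<in> S \<Longrightarrow> w i = (\<Sum>j\<in>S. A i j * (m j * r j))"
    "\<And>i. i \<in> S \<Longrightarrow> r i = exp (w i) / (\<Sum>l\<in>S. m l * exp (w l))"
proof -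
  define Q where "Q r = (\<Sum>i\<in>S. \<Sum>j\<in>S. m i * m j * A i j * r i * r j)" for r
  define E where "E r = (\<Sum>i\<in>S. m i * (r i * ln (r i))) - Q r / 2" for r
  define P where "P = {r. (\<forall>i\<in>S. 0 \<le> r i) \<and> (\<forall>i. i \<notin> S \<longrightarrow> r i = 0) \<and> (\<Sum>i\<in>S. m i * r i) = 1}"
  have "\<exists>r\<in>P. \<forall>q\<in>P. E r \<le> E q"
    unfolding P_def E_def Q_def by (rule finite_mean_field_minimiser[OF S m])
  then obtain r where r: "r \<in> P" and min: "\<And>q. q \<in> P \<Longrightarrow> E r \<le> E q" by blast
  define w where "w i = (\<Sum>j\<in>S. A i j * (m j * r j))" for i
  have r0: "r i \<ge> 0" if "i \<in> S" for i using r that by (simp add: P_def)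
  \<comment> \<open>Used for both orders of \<open>i\<close> and \<open>j\<close>, this says that
    \<open>r * exp (- w)\<close> is constant on \<open>S\<close>, which is the equation up to
    normalisation.\<close>
  have key: "r j * exp (w i - w j) \<le> r i" if i: "i \<in> S" and j: "j \<in> S" for i j
  proof (cases "i = j \<or> r j = 0")
    case True
    then show ?thesis using r0[OF i] by auto
  next
    case False
    then have ij: "i \<noteq> j" and rj: "r j > 0" using r0[OF j] by auto
    \<comment> \<open>Unit mass moved from \<open>j\<close> to \<open>i\<close>; the weights
      preserve the constraint.\<close>
    define \<delta> where "\<delta> k = (if k = i then 1 / m i else if k = j then - 1 / m j else 0)" for k
    have \<delta>_sum: "(\<Sum>k\<in>S. m k * (\<delta> k * g k)) = g i - g j" for g
    proof -
      have "(\<Sum>k\<in>S. m k * (\<delta> k * g k)) = (\<Sum>k\<in>S. (if k = i then g i else 0) - (if k = j then g j else 0))"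
        using m ij i j by (intro sum.cong) (auto simp: \<delta>_def less_imp_neq[symmetric])
      also have "\<dots> = g i - g j" using S i j by (simp add: sum_subtractf sum.delta)
      finally show ?thesis .
    qed
    \<comment> \<open>The upper limit on \<open>t\<close> keeps \<open>q j\<close> positive. The
      second-order part of the energy survives as \<open>t * (Q \<delta> / 2)\<close>, which
      disappears as \<open>t\<close> tends to 0.\<close>
    have main: "(r j - t / m j) * exp (w i - w j + t * (Q \<delta> / 2)) \<le> r i + t / m i"
      if t: "0 < t" "t < m j * r j" for t
    proof -
      define q where "q k = r k + t * \<delta> k" for k
      have qi: "q i = r i + t / m i" and qj: "q j = r j - t / m j"
        using ij by (simp_all add: q_def \<delta>_def)
      have qi_pos: "q i > 0" unfolding qi using r0[OF i] t m[OF i] by (simp add: add_nonneg_pos)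
      have qj_pos: "q j > 0" unfolding qj using t m[OF j] by (simp add: field_simps)
      have "q k \<ge> 0" if "k \<in> S" for k
        using that qi_pos qj_pos r0[OF that] by (cases "k = i"; cases "k = j") (auto simp: q_def \<delta>_def)
      moreover have "(\<Sum>k\<in>S. m k * q k) = 1"
      proof -
        have "(\<Sum>k\<in>S. m k * q k) = (\<Sum>k\<in>S. m k * r k) + t * (\<Sum>k\<in>S. m k * (\<delta> k * 1))"
          by (simp add: q_def sum.distrib sum_distrib_left algebra_simps)
        then show ?thesis using r \<delta>_sum[of "\<lambda>_. 1"] by (simp add: P_def)
      qed
      moreover have "q k = 0" if "k \<notin> S" for k
        using that i j r by (auto simp: q_def \<delta>_def P_def)
      ultimately have "q \<in> P" by (simp add: P_def)
      then have "0 \<le> E q - E r" using min by simp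
      also have "E q - E r = (\<Sum>k\<in>S. m k * (q k * ln (q k) - r k * ln (r k))) - (Q q - Q r) / 2"
        by (simp add: E_def sum_subtractf right_diff_distrib diff_divide_distrib)
      also have "(\<Sum>k\<in>S. m k * (q k * ln (q k) - r k * ln (r k))) \<le> (\<Sum>k\<in>S. t * (m k * (\<delta> k * (ln (q k) + 1))))"
      proof (rule sum_mono)
        fix k assume k: "k \<in> S"
        have "q k * ln (q k) - r k * ln (r k) \<le> (q k - r k) * (ln (q k) + 1)"
        proof (cases "k = i \<or> k = j")
          case True
          then show ?thesis using qi_pos qj_pos r0[OF k] by (intro xlnx_tangent) auto
        next
          case False
          then show ?thesis by (simp add: q_def \<delta>_def)
        qed
        then have "m k * (q k * ln (q k) - r k * ln (r k)) \<le> m k * ((q k - r k) * (ln (q k) + 1))"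
          using m[OF k] by (intro mult_left_mono) auto
        also have "\<dots> = t * (m k * (\<delta> k * (ln (q k) + 1)))" by (simp add: q_def)
        finally show "m k * (q k * ln (q k) - r k * ln (r k)) \<le> t * (m k * (\<delta> k * (ln (q k) + 1)))" .
      qed
      also have "(\<Sum>k\<in>S. t * (m k * (\<delta> k * (ln (q k) + 1)))) = t * (ln (q i) - ln (q j))"
        by (simp only: sum_distrib_left[symmetric] \<delta>_sum) simp
      \<comment> \<open>Symmetry of \<open>A\<close> makes the two mixed sums equal; the resulting
        factor 2 is what the \<open>/ 2\<close> in \<open>E\<close> compensates.\<close>
      also have "Q q - Q r = 2 * t * (w i - w j) + t\<^sup>2 * Q \<delta>"
      proof -
        have cross: "(\<Sum>k\<in>S. \<Sum>l\<in>S. m k * m l * A k l * \<delta> k * r l) = w i - w j"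
        proof -
          have "(\<Sum>k\<in>S. \<Sum>l\<in>S. m k * m l * A k l * \<delta> k * r l) = (\<Sum>k\<in>S. m k * (\<delta> k * w k))"
            unfolding w_def by (simp only: sum_distrib_left mult_ac)
          then show ?thesis using \<delta>_sum[of w] by simp
        qed
        have cross': "(\<Sum>k\<in>S. \<Sum>l\<in>S. m k * m l * A k l * r k * \<delta> l) = w i - w j"
        proof -
          have "(\<Sum>k\<in>S. \<Sum>l\<in>S. m k * m l * A k l * r k * \<delta> l) = (\<Sum>l\<in>S. \<Sum>k\<in>S. m k * m l * A k l * r k * \<delta> l)"
            by (rule sum.swap)
          also have "\<dots> = (\<Sum>k\<in>S. \<Sum>l\<in>S. m k * m l * A k l * \<delta> k * r l)"
            using sym by (intro sum.cong refl) (simp add: mult_ac)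
          finally show ?thesis using cross by simp
        qed
        have "m k * m l * A k l * q k * q l = m k * m l * A k l * r k * r l + t * (m k * m l * A k l * \<delta> k * r l)
           + t * (m k * m l * A k l * r k * \<delta> l) + t\<^sup>2 * (m k * m l * A k l * \<delta> k * \<delta> l)" for k l
          by (simp add: q_def power2_eq_square algebra_simps)
        then have "Q q = Q r + t * (\<Sum>k\<in>S. \<Sum>l\<in>S. m k * m l * A k l * \<delta> k * r l)
           + t * (\<Sum>k\<in>S. \<Sum>l\<in>S. m k * m l * A k l * r k * \<delta> l) + t\<^sup>2 * Q \<delta>"
          unfolding Q_def by (simp only: sum.distrib sum_distrib_left)
        then show ?thesis unfolding cross cross' by (simp add: algebra_simps)
      qed
      finally have "0 \<le> t * (ln (q i) - ln (q j)) - (2 * t * (w i - w j) + t\<^sup>2 * Q \<delta>) / 2" by simp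
      also have "\<dots> = t * (ln (q i) - ln (q j) - (w i - w j + t * (Q \<delta> / 2)))"
        by (simp add: power2_eq_square field_simps)
      finally have "ln (q j) + (w i - w j + t * (Q \<delta> / 2)) \<le> ln (q i)"
        using t by (simp add: zero_le_mult_iff)
      then have "exp (ln (q j) + (w i - w j + t * (Q \<delta> / 2))) \<le> exp (ln (q i))" by (simp only: exp_le_cancel_iff)
      then show ?thesis using qi_pos qj_pos unfolding exp_add[of "ln (q j)"] by (simp only: exp_ln qi[symmetric] qj[symmetric])
    qed
    have lim1: "((\<lambda>t. (r j - t / m j) * exp (w i - w j + t * (Q \<delta> / 2))) \<longlongrightarrow> (r j - 0 / m j) * exp (w i - w j + 0 * (Q \<delta> / 2))) (at_right 0)"
      by (intro tendsto_intros) (use m[OF j] in auto)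
    have lim2: "((\<lambda>t. r i + t / m i) \<longlongrightarrow> r i + 0 / m i) (at_right 0)"
      by (intro tendsto_intros) (use m[OF i] in auto)
    have "\<forall>\<^sub>F t in at_right 0. t \<in> {0<..<m j * r j}"
      using rj m[OF j] by (intro eventually_at_right_real) simp
    then have "\<forall>\<^sub>F t in at_right 0. (r j - t / m j) * exp (w i - w j + t * (Q \<delta> / 2)) \<le> r i + t / m i"
      by eventually_elim (use main in auto)
    from tendsto_le[OF _ lim2 lim1 this] show ?thesis by simp
  qed
  obtain i0 where i0: "i0 \<in> S" using S by blast
  \<comment> \<open>By \<open>key\<close> every index gives the same constant; the mass constraint
    identifies it as the reciprocal of the partition sum.\<close>
  define c where "c = r i0 * exp (- w i0)"
  have rc: "r i = c * exp (w i)" if i: "i \<in> S" for i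
  proof -
    have "r i0 * exp (w i - w i0) \<le> r i" "r i * exp (w i0 - w i) \<le> r i0" by (rule key[OF i i0] key[OF i0 i])+
    then show ?thesis by (simp add: c_def exp_diff exp_minus field_simps)
  qed
  have one: "(\<Sum>i\<in>S. m i * r i) = 1" using r by (simp add: P_def)
  have "(\<Sum>i\<in>S. m i * r i) = c * (\<Sum>i\<in>S. m i * exp (w i))"
    unfolding sum_distrib_left by (rule sum.cong[OF refl]) (simp add: rc)
  then have cz: "c * (\<Sum>i\<in>S. m i * exp (w i)) = 1" using one by simp
  then have "c = 1 / (\<Sum>i\<in>S. m i * exp (w i))" by (metis mult_zero_right nonzero_eq_divide_eq one_neq_zero zero_neq_one)
  then have "r i = exp (w i) / (\<Sum>l\<in>S. m l * exp (w l))" if "i \<in> S" for i using rc[OF that] by simp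
  then show ?thesis using that[of r w] r0 one w_def by blast
qed

section \<open>The mean field equation for a nonpositive symmetric kernel\<close>

lemma integral_nonpos_AE:
  fixes f :: "'a \<Rightarrow> real"
  assumes "AE x in M. f x \<le> 0"
  shows "(\<integral>x. f x \<partial>M) \<le> 0"
  using integral_nonneg_AE[where f="\<lambda>x. - f x"] assms by simp

text \<open>In the application \<open>M\<close> is \<open>h dx\<close>, of arbitrary positive mass,
  and \<open>k\<close> is the logarithmic kernel. By nonpositivity \<open>B\<close> bounds the L1
  norm of \<open>k x\<close> uniformly in \<open>x\<close>; together with the total mass and the
  coupling it determines the density bound.\<close>

locale mean_field_kernel = finite_measure M for M :: "'a measure" +
  fixes k :: "'a \<Rightarrow> 'a \<Rightarrow> real" and B :: real
  assumes kernel_measurable: "case_prod k \<in> borel_measurable (M \<Otimes>\<^sub>M M)"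
    and kernel_sym: "k x y = k y x"
    and kernel_nonpos: "k x y \<le> 0"
    and kernel_integrable: "x \<in> space M \<Longrightarrow> integrable M (k x)"
    and kernel_bound: "x \<in> space M \<Longrightarrow> - B \<le> (\<integral>y. k x y \<partial>M)"
    and mass_pos: "measure M (space M) > 0"
begin

lemma kernel_measurable' [measurable (raw)]:
  assumes [measurable]: "f \<in> N \<rightarrow>\<^sub>M M" "g \<in> N \<rightarrow>\<^sub>M M"
  shows "(\<lambda>x. k (f x) (g x)) \<in> borel_measurable N"
proof -
  have "case_prod k \<circ> (\<lambda>x. (f x, g x)) \<in> borel_measurable N"
    by (rule measurable_comp[OF _ kernel_measurable]) measurable
  then show ?thesis by (simp add: comp_def)
qed

lemma kernel_mult_integrable:
  assumes x: "x \<in> space M" and [measurable]: "\<rho> \<in> borel_measurable M"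
    and \<rho>: "\<And>y. \<bar>\<rho> y\<bar> \<le> C"
  shows "integrable M (\<lambda>y. k x y * \<rho> y)"
proof (rule Bochner_Integration.integrable_bound[of M "\<lambda>y. k x y * C"])
  show "integrable M (\<lambda>y. k x y * C)" using kernel_integrable[OF x] by simp
  show "(\<lambda>y. k x y * \<rho> y) \<in> borel_measurable M" using x by measurable
  have "\<bar>\<rho> y\<bar> \<le> \<bar>C\<bar>" for y using \<rho>[of y] by linarith
  then show "AE y in M. norm (k x y * \<rho> y) \<le> norm (k x y * C)"
    by (intro AE_I2) (simp add: abs_mult mult_left_mono)
qed

lemma potential_measurable [measurable]:
  assumes [measurable]: "\<rho> \<in> borel_measurable M"
  shows "(\<lambda>x. \<integral>y. k x y * \<rho> y \<partial>M) \<in> borel_measurable M"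
  by measurable

lemma potential_bounds:
  assumes x: "x \<in> space M" and [measurable]: "\<rho> \<in> borel_measurable M"
    and \<rho>: "\<And>y. 0 \<le> \<rho> y" "\<And>y. \<rho> y \<le> C"
  shows "(\<integral>y. k x y * \<rho> y \<partial>M) \<le> 0" "- (C * B) \<le> (\<integral>y. k x y * \<rho> y \<partial>M)"
proof -
  have C: "C \<ge> 0" using \<rho>[of x] by linarith
  have i: "integrable M (\<lambda>y. k x y * \<rho> y)"
    by (rule kernel_mult_integrable[OF x, where C=C]) (use \<rho> in auto)
  show "(\<integral>y. k x y * \<rho> y \<partial>M) \<le> 0"
    by (rule integral_nonpos_AE) (simp add: mult_nonpos_nonneg kernel_nonpos \<rho>)
  have "C * (- B) \<le> C * (\<integral>y. k x y \<partial>M)" using kernel_bound[OF x] C by (rule mult_left_mono)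
  also have "\<dots> = (\<integral>y. k x y * C \<partial>M)" by simp
  also have "\<dots> \<le> (\<integral>y. k x y * \<rho> y \<partial>M)"
    by (rule integral_mono[OF _ i])
      (use kernel_integrable[OF x] \<rho> kernel_nonpos in \<open>auto intro: mult_left_mono_neg\<close>)
  finally show "- (C * B) \<le> (\<integral>y. k x y * \<rho> y \<partial>M)" by simp
qed

lemma kernel_bound_nonneg: "B \<ge> 0"
proof -
  have "space M \<noteq> {}" using mass_pos by auto
  then obtain x where x: "x \<in> space M" by blast
  have "(\<integral>y. k x y \<partial>M) \<le> 0" by (rule integral_nonpos_AE) (simp add: kernel_nonpos)
  then show ?thesis using kernel_bound[OF x] by linarith
qed

text \<open>A uniform L1 bound over a finite measure. It justifies the interchange of integrals that
  makes the cell averages symmetric.\<close>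

lemma kernel_integrable_product: "integrable (M \<Otimes>\<^sub>M M) (case_prod k)"
proof -
  interpret P: pair_sigma_finite M M ..
  show ?thesis
  proof (rule P.Fubini_integrable)
    show "case_prod k \<in> borel_measurable (M \<Otimes>\<^sub>M M)" by (rule kernel_measurable)
    show "integrable M (\<lambda>x. \<integral>y. norm (case_prod k (x, y)) \<partial>M)"
    proof (rule integrable_const_bound[where B=B])
      show "AE x in M. norm (\<integral>y. norm (case_prod k (x, y)) \<partial>M) \<le> B"
      proof (rule AE_I2)
        fix x assume x: "x \<in> space M"
        have "(\<integral>y. norm (case_prod k (x, y)) \<partial>M) = - (\<integral>y. k x y \<partial>M)"
          using kernel_nonpos by simp
        moreover have "(\<integral>y. norm (case_prod k (x, y)) \<partial>M) \<ge> 0"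
          by (rule Bochner_Integration.integral_nonneg) simp
        ultimately show "norm (\<integral>y. norm (case_prod k (x, y)) \<partial>M) \<le> B"
          using kernel_bound[OF x] by simp
      qed
    qed measurable
    show "AE x in M. integrable M (\<lambda>y. case_prod k (x, y))"
      using kernel_integrable by (intro AE_I2) simp
  qed
qed

text \<open>\<open>\<rho>\<close> and \<open>\<omega>\<close> are taken constant on cells, and the
  matrix of the finite problem is \<open>\<beta>\<close> times the mean of \<open>k\<close> over
  pairs of cells. The bound on \<open>\<rho>\<close> must survive refinement, so it mentions only
  \<open>\<beta>\<close>, \<open>B\<close> and \<open>\<mu>\<close>. Null cells are dropped, whence
  the equations hold almost everywhere; the last one says that \<open>\<omega>\<close> is the cell
  mean of the potential, multiplied by the measure of the cell.\<close>

lemma partition_mean_field: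
  fixes L :: "'a \<Rightarrow> 'c"
  assumes L: "L \<in> M \<rightarrow>\<^sub>M count_space UNIV" and fin: "finite (L ` space M)" and \<beta>: "\<beta> \<ge> 0"
  defines "\<mu> \<equiv> measure M (space M)"
    and "cell \<equiv> \<lambda>x. {y \<in> space M. L y = L x}"
  shows "\<exists>\<rho> \<omega>. \<rho> \<in> borel_measurable M \<and> \<omega> \<in> borel_measurable M \<and>
    (\<forall>x. 0 \<le> \<rho> x) \<and> (\<forall>x. \<rho> x \<le> exp (\<beta> * B / \<mu>) / \<mu>) \<and> (\<forall>x. \<omega> x \<le> 0) \<and>
    (AE x in M. measure M (cell x) > 0) \<and>
    (AE x in M. \<rho> x = exp (\<omega> x) / (\<integral>y. exp (\<omega> y) \<partial>M)) \<and>
    (AE x in M. \<omega> x * measure M (cell x) = \<beta> * (\<integral>y. indicator (cell x) y * (\<integral>z. k y z * \<rho> z \<partial>M) \<partial>M))"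
proof -
  interpret P: pair_sigma_finite M M ..
  define C where "C a = {y \<in> space M. L y = a}" for a
  have [measurable]: "C a \<in> sets M" for a
  proof -
    have "C a = L -` {a} \<inter> space M" by (auto simp: C_def)
    then show ?thesis using measurable_sets[OF L, of "{a}"] by simp
  qed
  define m where "m a = measure M (C a)" for a
  define S where "S = {a \<in> L ` space M. m a > 0}"
  have S_fin: "finite S" using fin by (simp add: S_def)
  have m_pos: "m a > 0" if "a \<in> S" for a using that by (simp add: S_def)
  have ae_S: "AE x in M. L x \<in> S"
  proof -
    have "AE x in M. x \<notin> C a" if "a \<in> L ` space M - S" for a
    proof -
      have "m a = 0" using that measure_nonneg[of M "C a"] by (auto simp: S_def m_def not_less antisym)
      then have "C a \<in> null_sets M" by (intro null_setsI) (auto simp: emeasure_eq_measure m_def)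
      then show ?thesis by (rule AE_not_in)
    qed
    then have "AE x in M. \<forall>a\<in>L ` space M - S. x \<notin> C a"
      using fin by (intro AE_finite_allI) auto
    then show ?thesis
      by (rule AE_mp) (auto simp: C_def)
  qed
  have ae_all: "AE x in M. L x \<in> S \<and> x \<in> space M" using ae_S by (rule AE_mp) auto
  have step_eq: "(\<Sum>a\<in>S. g a * indicator (C a) x) = g (L x)" if "L x \<in> S" "x \<in> space M" for g :: "'c \<Rightarrow> real" and x
  proof -
    have "(\<Sum>a\<in>S. g a * indicator (C a) x) = (\<Sum>a\<in>S. if a = L x then g a else 0)"
      using that(2) by (intro sum.cong) (auto simp: C_def indicator_def)
    then show ?thesis using that(1) S_fin by (simp add: sum.delta')
  qed
  have step_int: "integrable M (\<lambda>x. \<Sum>a\<in>S. g a * indicator (C a) x)"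
    and step_integral: "(\<integral>x. (\<Sum>a\<in>S. g a * indicator (C a) x) \<partial>M) = (\<Sum>a\<in>S. g a * m a)" for g :: "'c \<Rightarrow> real"
    by (auto simp: m_def integrable_real_indicator emeasure_eq_measure)
  have mass: "(\<Sum>a\<in>S. m a) = \<mu>"
  proof -
    have "(\<integral>x. (\<Sum>a\<in>S. 1 * indicator (C a) x) \<partial>M) = (\<integral>x. (1::real) \<partial>M)"
    proof (rule integral_cong_AE)
      show "AE x in M. (\<Sum>a\<in>S. 1 * indicator (C a) x) = (1::real)"
        using ae_all by eventually_elim (simp only: step_eq)
    qed measurable
    then show ?thesis by (subst (asm) step_integral) (simp add: \<mu>_def)
  qed
  have S_ne: "S \<noteq> {}" using mass mass_pos by (auto simp: \<mu>_def)
  define V where "V b x = (\<integral>y. k x y * indicator (C b) y \<partial>M)" for b x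
  have [measurable]: "V b \<in> borel_measurable M" for b unfolding V_def by measurable
  have kb_int: "integrable M (\<lambda>y. k x y * indicator (C b) y)" if "x \<in> space M" for x b
    by (rule kernel_mult_integrable[OF that, where C=1]) auto
  have V_bounds: "V b x \<le> 0" "- B \<le> V b x" if "x \<in> space M" for b x
    using potential_bounds[OF that, of "indicator (C b)" 1] unfolding V_def by (auto simp: indicator_def)
  have V_int: "integrable M (\<lambda>x. indicator (C a) x * V b x)" for a b
  proof (rule integrable_const_bound[where B=B])
    show "AE x in M. norm (indicator (C a) x * V b x) \<le> B"
    proof (rule AE_I2)
      fix x assume "x \<in> space M"
      from V_bounds[OF this, of b] have "\<bar>V b x\<bar> \<le> B" by linarith
      then show "norm (indicator (C a) x * V b x) \<le> B"
        using kernel_bound_nonneg by (simp add: indicator_def)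
    qed
  qed measurable
  define I where "I a b = (\<integral>x. indicator (C a) x * V b x \<partial>M)" for a b
  have I_sym: "I a b = I b a" for a b
  proof -
    have int: "integrable (M \<Otimes>\<^sub>M M) (case_prod (\<lambda>x y. indicator (C a) x * (k x y * indicator (C b) y)))"
      by (rule Bochner_Integration.integrable_bound[OF kernel_integrable_product])
        (auto simp: indicator_def intro!: AE_I2)
    have "I a b = (\<integral>x. (\<integral>y. indicator (C a) x * (k x y * indicator (C b) y) \<partial>M) \<partial>M)"
      by (simp add: I_def V_def)
    also have "\<dots> = (\<integral>y. (\<integral>x. indicator (C a) x * (k x y * indicator (C b) y) \<partial>M) \<partial>M)"
      by (rule P.Fubini_integral[OF int, symmetric])
    also have "\<dots> = (\<integral>y. (\<integral>x. indicator (C b) y * (k y x * indicator (C a) x) \<partial>M) \<partial>M)"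
    proof (intro Bochner_Integration.integral_cong refl)
      fix x y
      show "indicator (C a) x * (k x y * indicator (C b) y) = indicator (C b) y * (k y x * indicator (C a) x)"
        unfolding kernel_sym[of x y] by (simp only: mult_ac)
    qed
    also have "\<dots> = I b a" by (simp add: I_def V_def)
    finally show ?thesis .
  qed
  obtain r w where r: "\<And>a. a \<in> S \<Longrightarrow> r a \<ge> 0" "(\<Sum>a\<in>S. m a * r a) = 1"
    and w: "\<And>a. a \<in> S \<Longrightarrow> w a = (\<Sum>b\<in>S. \<beta> * I a b / (m a * m b) * (m b * r b))"
    and rw: "\<And>a. a \<in> S \<Longrightarrow> r a = exp (w a) / (\<Sum>l\<in>S. m l * exp (w l))"
  proof (rule finite_mean_field[OF S_fin S_ne m_pos, where A="\<lambda>a b. \<beta> * I a b / (m a * m b)"])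
    show "\<beta> * I a b / (m a * m b) = \<beta> * I b a / (m b * m a)" for a b
      unfolding I_sym[of a b] mult.commute[of "m a"] by (rule refl)
  qed (assumption, rule that)
  have w': "w a * m a = \<beta> * (\<Sum>b\<in>S. r b * I a b)" if a: "a \<in> S" for a
  proof -
    have "w a * m a = (\<Sum>b\<in>S. \<beta> * I a b / (m a * m b) * (m b * r b) * m a)"
      by (simp add: w[OF a] sum_distrib_right)
    also have "\<dots> = (\<Sum>b\<in>S. \<beta> * (r b * I a b))"
      using m_pos[OF a] by (intro sum.cong refl) (simp add: m_pos less_imp_neq[symmetric])
    finally show ?thesis by (simp add: sum_distrib_left)
  qed
  have I_nonpos: "I a b \<le> 0" for a b
    unfolding I_def by (rule integral_nonpos_AE) (auto intro!: AE_I2 mult_nonneg_nonpos V_bounds)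
  have w_nonpos: "w a \<le> 0" if a: "a \<in> S" for a
  proof -
    have "w a * m a \<le> 0" unfolding w'[OF a]
      using \<beta> r(1) I_nonpos by (intro mult_nonneg_nonpos sum_nonpos) auto
    then show ?thesis using m_pos[OF a] by (simp add: mult_le_0_iff)
  qed
  define Z where "Z = (\<Sum>l\<in>S. m l * exp (w l))"
  \<comment> \<open>Jensen's inequality in the form
    \<open>exp (w a - s) \<ge> 1 + (w a - s)\<close>, summed with the weights \<open>m\<close> at
    the mean \<open>s\<close> of \<open>w\<close>.\<close>
  have Z_lower: "\<mu> * exp (- \<beta> * B / \<mu>) \<le> Z"
  proof -
    define s where "s = (\<Sum>a\<in>S. m a * w a) / \<mu>"
    \<comment> \<open>The indicators of the cells add up to at most 1, so their joint potential is
      nowhere below \<open>- B\<close>.\<close>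
    have I_sum: "- B * m b \<le> (\<Sum>a\<in>S. I b a)" for b
    proof -
      have "- B * m b = (\<integral>x. - B * indicator (C b) x \<partial>M)" by (simp add: m_def)
      also have "\<dots> \<le> (\<integral>x. (\<Sum>a\<in>S. indicator (C b) x * V a x) \<partial>M)"
      proof (rule integral_mono)
        fix x assume x: "x \<in> space M"
        have "(\<Sum>a\<in>S. V a x) = (\<integral>y. k x y * (\<Sum>a\<in>S. indicator (C a) y) \<partial>M)"
          unfolding V_def using kb_int[OF x] by (simp add: sum_distrib_left)
        moreover have "\<dots> \<ge> - (1 * B)"
        proof (rule potential_bounds(2)[OF x])
          have "(\<Sum>a\<in>S. indicator (C a) y :: real) \<le> 1" for y
          proof -
            have "(\<Sum>a\<in>S. indicator (C a) y :: real) \<le> (\<Sum>a\<in>S. if a = L y then 1 else 0)"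
              by (rule sum_mono) (auto simp: C_def indicator_def)
            also have "\<dots> \<le> 1" using S_fin by (simp add: sum.delta)
            finally show ?thesis .
          qed
          then show "(\<Sum>a\<in>S. indicator (C a) y :: real) \<le> 1" for y .
        qed (auto intro: sum_nonneg)
        ultimately have "- B \<le> (\<Sum>a\<in>S. V a x)" by simp
        then show "- B * indicator (C b) x \<le> (\<Sum>a\<in>S. indicator (C b) x * V a x)"
          by (simp add: indicator_def)
      qed (use V_int in \<open>auto simp: emeasure_eq_measure\<close>)
      also have "\<dots> = (\<Sum>a\<in>S. I b a)" using V_int by (simp add: I_def)
      finally show ?thesis .
    qed
    have I_sum': "- B * m b \<le> (\<Sum>a\<in>S. I a b)" for b
    proof -
      have "(\<Sum>a\<in>S. I b a) = (\<Sum>a\<in>S. I a b)" by (rule sum.cong[OF refl I_sym])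
      then show ?thesis using I_sum[of b] by simp
    qed
    have "(\<Sum>a\<in>S. m a * w a) = (\<Sum>a\<in>S. \<beta> * (\<Sum>b\<in>S. r b * I a b))"
      by (intro sum.cong refl) (metis w' mult.commute)
    also have "\<dots> = \<beta> * (\<Sum>a\<in>S. \<Sum>b\<in>S. r b * I a b)"
      by (simp only: sum_distrib_left)
    \<comment> \<open>Exchanging the sums lets the potential be taken of the reference measure,
      where it is at least \<open>- B\<close> per unit mass; of \<open>r\<close> only its total mass
      1 remains.\<close>
    also have "\<dots> = \<beta> * (\<Sum>b\<in>S. \<Sum>a\<in>S. r b * I a b)"
      by (rule arg_cong[OF sum.swap])
    also have "\<dots> = \<beta> * (\<Sum>b\<in>S. r b * (\<Sum>a\<in>S. I a b))"
      by (simp only: sum_distrib_left)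
    also have "\<dots> \<ge> \<beta> * (\<Sum>b\<in>S. r b * (- B * m b))"
      using \<beta> r(1) I_sum' by (intro mult_left_mono sum_mono) auto
    also have "\<beta> * (\<Sum>b\<in>S. r b * (- B * m b)) = - \<beta> * B * (\<Sum>b\<in>S. m b * r b)"
      by (simp add: sum_distrib_left sum_negf[symmetric] mult_ac)
    finally have "- \<beta> * B \<le> (\<Sum>a\<in>S. m a * w a)" using r(2) by simp
    then have s: "- \<beta> * B / \<mu> \<le> s" unfolding s_def using mass_pos by (intro divide_right_mono) (auto simp: \<mu>_def)
    have "exp s * \<mu> = exp s * (\<Sum>a\<in>S. m a * (1 + (w a - s)))"
    proof -
      have "(\<Sum>a\<in>S. m a * (1 + (w a - s))) = (\<Sum>a\<in>S. m a) + ((\<Sum>a\<in>S. m a * w a) - (\<Sum>a\<in>S. m a) * s)"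
        by (simp add: distrib_left right_diff_distrib sum.distrib sum_subtractf sum_distrib_right)
      also have "\<dots> = \<mu>" unfolding mass using mass_pos by (simp add: s_def \<mu>_def)
      finally show ?thesis by simp
    qed
    also have "\<dots> \<le> exp s * (\<Sum>a\<in>S. m a * exp (w a - s))"
      using m_pos exp_ge_add_one_self by (intro mult_left_mono sum_mono) (auto simp: less_imp_le)
    also have "\<dots> = Z" by (simp add: Z_def sum_distrib_left mult.left_commute exp_diff)
    finally have "exp s * \<mu> \<le> Z" .
    moreover have "exp (- \<beta> * B / \<mu>) * \<mu> \<le> exp s * \<mu>" using s mass_pos by (simp add: \<mu>_def)
    ultimately show ?thesis by (simp add: mult.commute)
  qed
  have \<mu>: "\<mu> > 0" using mass_pos by (simp add: \<mu>_def)
  have Z_pos: "Z > 0" using Z_lower \<mu> by (smt (verit) exp_gt_zero mult_pos_pos)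
  \<comment> \<open>Nonpositivity of \<open>w\<close> bounds the numerator by 1, so the lower bound
    on \<open>Z\<close> is all that is left to use.\<close>
  have r_le: "r a \<le> exp (\<beta> * B / \<mu>) / \<mu>" if a: "a \<in> S" for a
  proof -
    have "r a \<le> 1 / Z" unfolding rw[OF a] Z_def[symmetric] using w_nonpos[OF a] Z_pos by (intro divide_right_mono) auto
    also have "\<dots> \<le> 1 / (\<mu> * exp (- \<beta> * B / \<mu>))" using Z_lower \<mu> Z_pos by (intro divide_left_mono) auto
    also have "\<dots> = exp (\<beta> * B / \<mu>) / \<mu>" by (simp add: exp_minus field_simps)
    finally show ?thesis .
  qed
  define \<rho> where "\<rho> x = (\<Sum>a\<in>S. r a * indicator (C a) x)" for x
  define \<omega> where "\<omega> x = (\<Sum>a\<in>S. w a * indicator (C a) x)" for x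
  have outside: "(\<Sum>a\<in>S. g a * indicator (C a) x) = 0" if "\<not> (L x \<in> S \<and> x \<in> space M)" for g :: "'c \<Rightarrow> real" and x
    using that by (intro sum.neutral) (auto simp: C_def indicator_def)
  have Z_eq: "(\<integral>y. exp (\<omega> y) \<partial>M) = Z"
  proof -
    have "(\<integral>y. exp (\<omega> y) \<partial>M) = (\<integral>y. (\<Sum>a\<in>S. exp (w a) * indicator (C a) y) \<partial>M)"
    proof (rule integral_cong_AE)
      show "AE y in M. exp (\<omega> y) = (\<Sum>a\<in>S. exp (w a) * indicator (C a) y)"
        using ae_all by eventually_elim (simp only: \<omega>_def step_eq)
    qed (auto simp: \<omega>_def)
    then show ?thesis unfolding step_integral Z_def by (simp add: mult.commute)
  qed
  have cell_eq: "cell x = C (L x)" for x by (simp add: cell_def C_def)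
  show ?thesis
  proof (intro exI conjI allI)
    show "\<rho> \<in> borel_measurable M" "\<omega> \<in> borel_measurable M"
      unfolding \<rho>_def \<omega>_def by measurable
    show "0 \<le> \<rho> x" for x unfolding \<rho>_def using r(1) by (intro sum_nonneg) auto
    show "\<rho> x \<le> exp (\<beta> * B / \<mu>) / \<mu>" for x
    proof (cases "L x \<in> S \<and> x \<in> space M")
      case True
      then show ?thesis unfolding \<rho>_def using r_le by (simp add: step_eq)
    next
      case False
      then show ?thesis unfolding \<rho>_def outside[OF False] using \<mu> by simp
    qed
    show "\<omega> x \<le> 0" for x unfolding \<omega>_def using w_nonpos by (intro sum_nonpos) (auto simp: indicator_def)
    show "AE x in M. measure M (cell x) > 0"
      using ae_all by eventually_elim (use m_pos in \<open>auto simp: cell_eq m_def\<close>)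
    show "AE x in M. \<rho> x = exp (\<omega> x) / (\<integral>y. exp (\<omega> y) \<partial>M)"
      using ae_all
    proof eventually_elim
      case (elim x)
      then have "\<rho> x = r (L x)" "\<omega> x = w (L x)" by (simp_all only: \<rho>_def \<omega>_def step_eq)
      then show ?case using rw[of "L x"] elim by (simp only: Z_eq Z_def)
    qed
    show "AE x in M. \<omega> x * measure M (cell x) = \<beta> * (\<integral>y. indicator (cell x) y * (\<integral>z. k y z * \<rho> z \<partial>M) \<partial>M)"
      using ae_all
    proof eventually_elim
      case (elim x)
      have pot: "(\<integral>z. k y z * \<rho> z \<partial>M) = (\<Sum>b\<in>S. r b * V b y)" if y: "y \<in> space M" for y
      proof -
        have "(\<integral>z. k y z * \<rho> z \<partial>M) = (\<integral>z. (\<Sum>b\<in>S. r b * (k y z * indicator (C b) z)) \<partial>M)"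
          by (simp only: \<rho>_def sum_distrib_left mult_ac)
        also have "\<dots> = (\<Sum>b\<in>S. r b * V b y)"
          unfolding V_def using kb_int[OF y] by simp
        finally show ?thesis .
      qed
      have "(\<integral>y. indicator (cell x) y * (\<integral>z. k y z * \<rho> z \<partial>M) \<partial>M)
          = (\<integral>y. (\<Sum>b\<in>S. r b * (indicator (C (L x)) y * V b y)) \<partial>M)"
      proof (rule Bochner_Integration.integral_cong[OF refl])
        fix y assume "y \<in> space M"
        from pot[OF this] show "indicator (cell x) y * (\<integral>z. k y z * \<rho> z \<partial>M) = (\<Sum>b\<in>S. r b * (indicator (C (L x)) y * V b y))"
          by (simp only: cell_eq sum_distrib_left mult.left_commute)
      qed
      also have "\<dots> = (\<Sum>b\<in>S. r b * I (L x) b)"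
        using V_int by (simp add: I_def)
      finally show ?case using elim w'[of "L x"]
        by (simp add: \<omega>_def step_eq cell_eq m_def[symmetric])
    qed
  qed
qed

end

section \<open>From partitions to the continuous equation\<close>

locale equicontinuous_mean_field_kernel = mean_field_kernel M k B
  for M :: "'a::second_countable_topology measure" and k B +
  assumes sets_borel: "sets M = sets borel"
    and kernel_continuous: "((\<lambda>x'. \<integral>y. \<bar>k x' y - k x y\<bar> \<partial>M) \<longlongrightarrow> 0) (at x)"
begin

lemma space_UNIV: "space M = UNIV"
  using sets_eq_imp_space_eq[OF sets_borel] by simp

text \<open>The neighbourhood does not depend on the density: two potentials differ by at most the
  bound on \<open>\<rho>\<close> times the L1 distance of \<open>k x'\<close> and
  \<open>k x\<close>, which is small by \<open>kernel_continuous\<close>.\<close>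

lemma potential_equicontinuous:
  assumes e: "e > 0"
  obtains X where "open X" "x \<in> X"
    "\<And>x' \<rho>. x' \<in> X \<Longrightarrow> \<rho> \<in> borel_measurable M \<Longrightarrow> (\<And>y. 0 \<le> \<rho> y) \<Longrightarrow> (\<And>y. \<rho> y \<le> C) \<Longrightarrow>
      \<bar>(\<integral>y. k x' y * \<rho> y \<partial>M) - (\<integral>y. k x y * \<rho> y \<partial>M)\<bar> \<le> e"
proof -
  have "e / (\<bar>C\<bar> + 1) > 0" using e by (simp add: add_nonneg_pos)
  then have "\<forall>\<^sub>F x' in at x. (\<integral>y. \<bar>k x' y - k x y\<bar> \<partial>M) < e / (\<bar>C\<bar> + 1)"
    by (rule order_tendstoD(2)[OF kernel_continuous])
  then obtain X where X: "open X" "x \<in> X"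
    and small: "\<And>x'. x' \<in> X \<Longrightarrow> x' \<noteq> x \<Longrightarrow> (\<integral>y. \<bar>k x' y - k x y\<bar> \<partial>M) < e / (\<bar>C\<bar> + 1)"
    unfolding eventually_at_topological by blast
  show ?thesis
  proof
    fix x' \<rho> assume x': "x' \<in> X" and [measurable]: "\<rho> \<in> borel_measurable M" and \<rho>: "\<And>y. 0 \<le> \<rho> y" "\<And>y. \<rho> y \<le> C"
    have \<rho>': "\<bar>\<rho> y\<bar> \<le> \<bar>C\<bar> + 1" for y using \<rho>(1)[of y] \<rho>(2)[of y] by linarith
    have int: "integrable M (\<lambda>y. k z y * \<rho> y)" for z
      by (rule kernel_mult_integrable[OF _ _ \<rho>']) (auto simp: space_UNIV)
    have int_k: "integrable M (k z)" for z using kernel_integrable by (simp add: space_UNIV)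
    show "\<bar>(\<integral>y. k x' y * \<rho> y \<partial>M) - (\<integral>y. k x y * \<rho> y \<partial>M)\<bar> \<le> e"
    proof (cases "x' = x")
      case True
      then show ?thesis using e by simp
    next
      case False
      have "\<bar>(\<integral>y. k x' y * \<rho> y \<partial>M) - (\<integral>y. k x y * \<rho> y \<partial>M)\<bar> = \<bar>\<integral>y. (k x' y - k x y) * \<rho> y \<partial>M\<bar>"
        using int by (simp add: left_diff_distrib)
      also have "\<dots> \<le> (\<integral>y. \<bar>(k x' y - k x y) * \<rho> y\<bar> \<partial>M)" by (rule integral_abs_bound)
      also have "\<dots> \<le> (\<integral>y. \<bar>k x' y - k x y\<bar> * (\<bar>C\<bar> + 1) \<partial>M)"
      proof (rule integral_mono)
        show "integrable M (\<lambda>y. \<bar>(k x' y - k x y) * \<rho> y\<bar>)"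
          unfolding left_diff_distrib using int by simp
        show "integrable M (\<lambda>y. \<bar>k x' y - k x y\<bar> * (\<bar>C\<bar> + 1))" using int_k by simp
        show "\<bar>(k x' y - k x y) * \<rho> y\<bar> \<le> \<bar>k x' y - k x y\<bar> * (\<bar>C\<bar> + 1)" for y
          using \<rho>'[of y] by (simp add: abs_mult mult_left_mono)
      qed
      also have "\<dots> = (\<integral>y. \<bar>k x' y - k x y\<bar> \<partial>M) * (\<bar>C\<bar> + 1)" by simp
      also have "\<dots> \<le> e / (\<bar>C\<bar> + 1) * (\<bar>C\<bar> + 1)"
        using small[OF x' False] by (intro mult_right_mono) auto
      also have "\<dots> = e" by (simp add: add_nonneg_pos less_imp_neq[symmetric])
      finally show ?thesis .
    qed
  qed (use X in auto)
qed

text \<open>An Arzela-Ascoli argument, applied to the potentials \<open>W N\<close> because the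
  \<open>\<omega> N\<close> are only step functions. Pointwise convergence along a subsequence is
  enough: the uniform density bound lets the integrals pass to the limit by domination.\<close>

theorem mean_field_equation:
  assumes \<beta>: "\<beta> \<ge> 0"
  obtains w where "continuous_on UNIV w" "\<And>x. w x \<le> 0" "(\<integral>y. exp (w y) \<partial>M) > 0"
    "\<And>x. w x = \<beta> * (\<integral>y. k x y * exp (w y) \<partial>M) / (\<integral>y. exp (w y) \<partial>M)"
proof -
  define \<mu> where "\<mu> = measure M (space M)"
  define C where "C = exp (\<beta> * B / \<mu>) / \<mu>"
  have \<mu>: "\<mu> > 0" using mass_pos by (simp add: \<mu>_def)
  then have C: "C > 0" by (simp add: C_def)
  obtain \<B> :: "'a set set" where \<B>: "countable \<B>" "topological_basis \<B>"
    using ex_countable_basis by blast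
  \<comment> \<open>The cells of the \<open>N\<close>-th partition record membership in the first \<open>N\<close> sets of a countable
    basis, so the cell of a fixed point eventually lies in any given neighbourhood of it.\<close>
  define U where "U = from_nat_into \<B>"
  have "\<B> \<noteq> {}" using \<B>(2) by (metis UNIV_I empty_iff open_UNIV topological_basisE)
  then have U_range: "range U = \<B>" unfolding U_def using \<B>(1) by (rule range_from_nat_into)
  have U_open: "open (U i)" for i using U_range \<B>(2) topological_basis_open by blast
  have U_basis: "\<exists>i. x \<in> U i \<and> U i \<subseteq> X" if "open X" "x \<in> X" for x X
    using topological_basisE[OF \<B>(2) that] U_range by (metis rangeE)
  have [measurable]: "U i \<in> sets M" for i using U_open sets_borel by simp
  define L where "L N x = {i. i \<le> N \<and> x \<in> U i}" for N x
  have L_fin: "finite (L N ` space M)" for N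
    by (rule finite_subset[of _ "Pow {..N}"]) (auto simp: L_def)
  have L_meas: "L N \<in> M \<rightarrow>\<^sub>M count_space UNIV" for N
  proof (rule measurable_compose_countable'[where I="Pow {..N}" and g="L N" and f="\<lambda>i x. i"])
    show "L N \<in> M \<rightarrow>\<^sub>M count_space (Pow {..N})"
    proof (rule measurable_count_space_eq2[THEN iffD2])
      show "L N \<in> space M \<rightarrow> Pow {..N} \<and> (\<forall>a\<in>Pow {..N}. L N -` {a} \<inter> space M \<in> sets M)"
      proof (intro conjI ballI)
        fix a assume a: "a \<in> Pow {..N}"
        have "L N x = a \<longleftrightarrow> (\<forall>i\<in>{..N}. i \<in> a \<longleftrightarrow> x \<in> U i)" for x
          using a unfolding L_def set_eq_iff mem_Collect_eq by blast
        then have "L N -` {a} \<inter> space M = {x \<in> space M. \<forall>i\<in>{..N}. i \<in> a \<longleftrightarrow> x \<in> U i}" by blast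
        also have "\<dots> \<in> sets M" by measurable
        finally show "L N -` {a} \<inter> space M \<in> sets M" .
      qed (auto simp: L_def)
    qed simp
  qed (auto simp: countable_finite)
  define cell where "cell N x = {y \<in> space M. L N y = L N x}" for N x
  define G where "G N \<rho> \<omega> \<longleftrightarrow> \<rho> \<in> borel_measurable M \<and> \<omega> \<in> borel_measurable M \<and>
    (\<forall>x. 0 \<le> \<rho> x) \<and> (\<forall>x. \<rho> x \<le> C) \<and> (\<forall>x. \<omega> x \<le> 0) \<and>
    (AE x in M. measure M (cell N x) > 0) \<and>
    (AE x in M. \<rho> x = exp (\<omega> x) / (\<integral>y. exp (\<omega> y) \<partial>M)) \<and>
    (AE x in M. \<omega> x * measure M (cell N x) = \<beta> * (\<integral>y. indicator (cell N x) y * (\<integral>z. k y z * \<rho> z \<partial>M) \<partial>M))"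
    for N \<rho> \<omega>
  have "\<exists>\<rho> \<omega>. G N \<rho> \<omega>" for N
    unfolding G_def C_def \<mu>_def cell_def by (rule partition_mean_field[OF L_meas L_fin \<beta>])
  then obtain \<rho> \<omega> where G: "\<And>N. G N (\<rho> N) (\<omega> N)" by metis
  have meas [measurable]: "\<rho> N \<in> borel_measurable M" "\<omega> N \<in> borel_measurable M"
    and \<rho>: "0 \<le> \<rho> N x" "\<rho> N x \<le> C" and \<omega>_nonpos: "\<omega> N x \<le> 0"
    and ae: "AE x in M. measure M (cell N x) > 0" "AE x in M. \<rho> N x = exp (\<omega> N x) / (\<integral>y. exp (\<omega> N y) \<partial>M)"
      "AE x in M. \<omega> N x * measure M (cell N x) = \<beta> * (\<integral>y. indicator (cell N x) y * (\<integral>z. k y z * \<rho> N z \<partial>M) \<partial>M)"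
    for N x
    using G[of N] unfolding G_def by blast+
  define W where "W N x = \<beta> * (\<integral>y. k x y * \<rho> N y \<partial>M)" for N x
  have [measurable]: "W N \<in> borel_measurable M" for N unfolding W_def by measurable
  have W_bounds: "W N x \<le> 0" "- (\<beta> * (C * B)) \<le> W N x" for N x
  proof -
    have x: "x \<in> space M" by (simp add: space_UNIV)
    note pb = potential_bounds[OF x meas(1)[of N] \<rho>]
    show "W N x \<le> 0" unfolding W_def using pb(1) \<beta> by (intro mult_nonneg_nonpos)
    show "- (\<beta> * (C * B)) \<le> W N x" unfolding W_def using mult_left_mono[OF pb(2) \<beta>] by simp
  qed
  have equi: "\<exists>X. open X \<and> x \<in> X \<and> (\<forall>x'\<in>X. \<forall>N. \<bar>W N x' - W N x\<bar> \<le> e)" if e: "e > 0" for x e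
  proof -
    \<comment> \<open>\<open>\<beta>\<close> may be 0; dividing by \<open>\<beta> + 1\<close> covers
      this case too.\<close>
    have e': "e / (\<beta> + 1) > 0" using e \<beta> by simp
    obtain X where X: "open X" "x \<in> X"
      and small: "\<And>x' \<rho>. x' \<in> X \<Longrightarrow> \<rho> \<in> borel_measurable M \<Longrightarrow> (\<And>y. 0 \<le> \<rho> y) \<Longrightarrow> (\<And>y. \<rho> y \<le> C) \<Longrightarrow>
      \<bar>(\<integral>y. k x' y * \<rho> y \<partial>M) - (\<integral>y. k x y * \<rho> y \<partial>M)\<bar> \<le> e / (\<beta> + 1)"
      by (rule potential_equicontinuous[OF e', where C=C]) blast
    have "\<bar>W N x' - W N x\<bar> \<le> e" if x': "x' \<in> X" for x' N
    proof -
      have "\<bar>W N x' - W N x\<bar> = \<beta> * \<bar>(\<integral>y. k x' y * \<rho> N y \<partial>M) - (\<integral>y. k x y * \<rho> N y \<partial>M)\<bar>"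
        using \<beta> by (simp add: W_def right_diff_distrib[symmetric] abs_mult)
      also have "\<dots> \<le> \<beta> * (e / (\<beta> + 1))"
        by (rule mult_left_mono[OF small[OF x' meas(1) \<rho>] \<beta>])
      also have "\<dots> \<le> e" using \<beta> e by (simp add: field_simps)
      finally show ?thesis .
    qed
    then show ?thesis using X by blast
  qed
  \<comment> \<open>A diagonal subsequence settles convergence on a countable dense set, and
    equicontinuity extends it to every point.\<close>
  obtain D :: "'a set" where D: "countable D" "\<And>X. open X \<Longrightarrow> X \<noteq> {} \<Longrightarrow> \<exists>d\<in>D. d \<in> X"
    by (rule countable_dense_setE) blast
  have W_norm: "norm (W N x) \<le> \<beta> * (C * B)" for N x using W_bounds[of N x] by (simp add: abs_le_iff)
  obtain \<kappa> :: "nat \<Rightarrow> nat" where \<kappa>: "strict_mono \<kappa>" and conv_D: "\<And>x. x \<in> D \<Longrightarrow> \<exists>l. (\<lambda>n. W (\<kappa> n) x) \<longlonglongrightarrow> l"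
    by (rule function_convergent_subsequence[where f=W and M="\<beta> * (C * B)", OF D(1) W_norm], rule that) auto
  have "\<exists>l. (\<lambda>n. W (\<kappa> n) x) \<longlonglongrightarrow> l" for x
  proof -
    have "Cauchy (\<lambda>n. W (\<kappa> n) x)"
    proof (rule metric_CauchyI)
      fix e :: real assume e: "e > 0"
      then have "e / 4 > 0" by simp
      from equi[OF this, of x] obtain X where X: "open X" "x \<in> X" "\<And>x' N. x' \<in> X \<Longrightarrow> \<bar>W N x' - W N x\<bar> \<le> e / 4"
        by blast
      then obtain d where d: "d \<in> D" "d \<in> X" using D(2)[of X] by blast
      have "Cauchy (\<lambda>n. W (\<kappa> n) d)" using conv_D[OF d(1)] LIMSEQ_imp_Cauchy by blast
      then obtain n0 where n0: "\<And>m n. m \<ge> n0 \<Longrightarrow> n \<ge> n0 \<Longrightarrow> dist (W (\<kappa> m) d) (W (\<kappa> n) d) < e / 4"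
        using e by (meson \<open>e / 4 > 0\<close> metric_CauchyD)
      have "dist (W (\<kappa> m) x) (W (\<kappa> n) x) < e" if "m \<ge> n0" "n \<ge> n0" for m n
        using n0[OF that] X(3)[OF d(2), of "\<kappa> m"] X(3)[OF d(2), of "\<kappa> n"] e unfolding dist_real_def by linarith
      then show "\<exists>M. \<forall>m\<ge>M. \<forall>n\<ge>M. dist (W (\<kappa> m) x) (W (\<kappa> n) x) < e" by blast
    qed
    then show ?thesis using convergent_eq_Cauchy by blast
  qed
  then obtain w where w: "\<And>x. (\<lambda>n. W (\<kappa> n) x) \<longlonglongrightarrow> w x" by metis
  have w_nonpos: "w x \<le> 0" for x using LIMSEQ_le_const2[OF w] W_bounds(1) by blast
  have w_lower: "- (\<beta> * (C * B)) \<le> w x" for x using LIMSEQ_le_const[OF w] W_bounds(2) by blast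
  have w_cont: "continuous_on UNIV w"
    unfolding continuous_on_def
  proof (intro ballI tendstoI)
    fix x and e :: real assume e: "e > 0"
    then have "e / 2 > 0" by simp
    from equi[OF this, of x] obtain X where X: "open X" "x \<in> X" "\<And>x' N. x' \<in> X \<Longrightarrow> \<bar>W N x' - W N x\<bar> \<le> e / 2"
      by blast
    have "dist (w x') (w x) < e" if x': "x' \<in> X" for x'
    proof -
      have "\<bar>w x' - w x\<bar> \<le> e / 2"
      proof (rule LIMSEQ_le_const2)
        show "(\<lambda>n. \<bar>W (\<kappa> n) x' - W (\<kappa> n) x\<bar>) \<longlonglongrightarrow> \<bar>w x' - w x\<bar>" by (intro tendsto_intros w)
        show "\<exists>N. \<forall>n\<ge>N. \<bar>W (\<kappa> n) x' - W (\<kappa> n) x\<bar> \<le> e / 2" using X(3)[OF x'] by blast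
      qed
      then show ?thesis using e by (simp add: dist_real_def)
    qed
    then show "\<forall>\<^sub>F x' in at x. dist (w x') (w x) < e"
      unfolding eventually_at_topological using X by blast
  qed
  have w_meas [measurable]: "w \<in> borel_measurable M"
    using borel_measurable_continuous_onI[OF w_cont] by (simp add: measurable_cong_sets[OF sets_borel refl])
  define Z where "Z = (\<integral>y. exp (w y) \<partial>M)"
  have exp_int: "integrable M (\<lambda>y. exp (g y))" if "g \<in> borel_measurable M" "\<And>y. g y \<le> 0" for g :: "'a \<Rightarrow> real"
    using that by (intro integrable_const_bound[where B=1]) auto
  have Z_pos: "Z > 0"
  proof -
    have "0 < exp (- (\<beta> * (C * B))) * \<mu>" using \<mu> by simp
    also have "\<dots> = (\<integral>y. exp (- (\<beta> * (C * B))) \<partial>M)" by (simp add: \<mu>_def mult.commute)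
    also have "\<dots> \<le> Z" unfolding Z_def
      by (rule integral_mono) (use w_lower exp_int[OF w_meas w_nonpos] in auto)
    finally show ?thesis .
  qed
  have ae_all: "AE x in M. \<forall>N. measure M (cell N x) > 0 \<and> \<rho> N x = exp (\<omega> N x) / (\<integral>y. exp (\<omega> N y) \<partial>M)
    \<and> \<omega> N x * measure M (cell N x) = \<beta> * (\<integral>y. indicator (cell N x) y * (\<integral>z. k y z * \<rho> N z \<partial>M) \<partial>M)"
    unfolding AE_all_countable using ae by (auto intro: AE_conjI)
  \<comment> \<open>\<open>\<omega> N x\<close> is the mean of \<open>W N\<close> over the cell of
    \<open>x\<close>, and this cell ends up in any neighbourhood of \<open>x\<close>, so
    equicontinuity closes the gap to \<open>W N x\<close>.\<close>
  have \<omega>_lim: "(\<lambda>n. \<omega> (\<kappa> n) x) \<longlonglongrightarrow> w x"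
    if x: "\<forall>N. measure M (cell N x) > 0 \<and> \<rho> N x = exp (\<omega> N x) / (\<integral>y. exp (\<omega> N y) \<partial>M)
    \<and> \<omega> N x * measure M (cell N x) = \<beta> * (\<integral>y. indicator (cell N x) y * (\<integral>z. k y z * \<rho> N z \<partial>M) \<partial>M)" for x
  proof -
    have "(\<lambda>n. \<omega> (\<kappa> n) x - W (\<kappa> n) x) \<longlonglongrightarrow> 0"
    proof (rule LIMSEQ_I)
      fix e :: real assume e: "e > 0"
      then have "e / 2 > 0" by simp
      from equi[OF this, of x] obtain X where X: "open X" "x \<in> X" "\<And>x' N. x' \<in> X \<Longrightarrow> \<bar>W N x' - W N x\<bar> \<le> e / 2"
        by blast
      obtain i where i: "x \<in> U i" "U i \<subseteq> X" using U_basis[OF X(1,2)] by blast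
      have "norm (\<omega> N x - W N x - 0) < e" if N: "N \<ge> i" for N
      proof -
        have cell_X: "y \<in> X" if "y \<in> cell N x" for y
        proof -
          \<comment> \<open>For \<open>N \<ge> i\<close> membership in \<open>U i\<close> is part of
            the label, so the whole cell lies in \<open>U i\<close>.\<close>
          have "i \<in> L N x" using i N by (simp add: L_def)
          then have "i \<in> L N y" using that by (simp add: cell_def)
          then show ?thesis using i by (auto simp: L_def)
        qed
        have [measurable]: "cell N x \<in> sets M"
        proof -
          have "cell N x = L N -` {L N x} \<inter> space M" by (auto simp: cell_def)
          then show ?thesis using measurable_sets[OF L_meas, of "{L N x}" N] by simp
        qed
        let ?m = "measure M (cell N x)"
        have m: "?m > 0" using x by blast
        have "\<omega> N x * ?m = (\<integral>y. indicator (cell N x) y * W N y \<partial>M)"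
          using x by (simp add: W_def mult.left_commute)
        moreover have int_const: "integrable M (\<lambda>y. indicator (cell N x) y * c)" "(\<integral>y. indicator (cell N x) y * c \<partial>M) = c * ?m" for c :: real
          by (auto simp: emeasure_eq_measure)
        moreover have intW: "integrable M (\<lambda>y. indicator (cell N x) y * W N y)"
        proof (rule integrable_const_bound[where B="\<beta> * (C * B)"])
          have "\<bar>W N y\<bar> \<le> \<beta> * (C * B)" for y using W_bounds[of N y] by (simp add: abs_le_iff)
          moreover have "0 \<le> \<beta> * (C * B)" using \<beta> C kernel_bound_nonneg by simp
          ultimately show "AE y in M. norm (indicator (cell N x) y * W N y) \<le> \<beta> * (C * B)"
            by (intro AE_I2) (simp add: indicator_def)
        qed measurable
        moreover have "(\<integral>y. indicator (cell N x) y * W N y \<partial>M) \<le> (\<integral>y. indicator (cell N x) y * (W N x + e / 2) \<partial>M)"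
        proof (rule integral_mono[OF intW int_const(1)])
          show "indicator (cell N x) y * W N y \<le> indicator (cell N x) y * (W N x + e / 2)" for y
          proof (cases "y \<in> cell N x")
            case True
            then show ?thesis using X(3)[OF cell_X[OF True], of N] unfolding abs_le_iff by simp
          qed simp
        qed
        moreover have "(\<integral>y. indicator (cell N x) y * (W N x - e / 2) \<partial>M) \<le> (\<integral>y. indicator (cell N x) y * W N y \<partial>M)"
        proof (rule integral_mono[OF int_const(1) intW])
          show "indicator (cell N x) y * (W N x - e / 2) \<le> indicator (cell N x) y * W N y" for y
          proof (cases "y \<in> cell N x")
            case True
            then show ?thesis using X(3)[OF cell_X[OF True], of N] unfolding abs_le_iff by simp
          qed simp
        qed
        ultimately have "\<omega> N x * ?m \<le> (W N x + e / 2) * ?m" "(W N x - e / 2) * ?m \<le> \<omega> N x * ?m" by (simp_all only:)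
        then have "\<omega> N x \<le> W N x + e / 2" "W N x - e / 2 \<le> \<omega> N x" using m by (simp_all only: mult_le_cancel_right_pos)
        then show ?thesis using e by (simp add: abs_less_iff)
      qed
      then show "\<exists>n0. \<forall>n\<ge>n0. norm (\<omega> (\<kappa> n) x - W (\<kappa> n) x - 0) < e"
        using seq_suble[OF \<kappa>] le_trans by blast
    qed
    from tendsto_add[OF this w[of x]] show ?thesis by simp
  qed
  \<comment> \<open>Nonpositivity of \<open>\<omega>\<close> makes the constant 1 a majorant,
    integrable because \<open>M\<close> is finite.\<close>
  have Z_lim: "(\<lambda>n. \<integral>y. exp (\<omega> (\<kappa> n) y) \<partial>M) \<longlonglongrightarrow> Z"
    unfolding Z_def
  proof (rule integral_dominated_convergence[where w="\<lambda>_. 1"])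
    show "AE x in M. (\<lambda>n. exp (\<omega> (\<kappa> n) x)) \<longlonglongrightarrow> exp (w x)"
      using ae_all by eventually_elim (intro tendsto_exp \<omega>_lim)
    show "AE x in M. norm (exp (\<omega> (\<kappa> n) x)) \<le> 1" for n using \<omega>_nonpos by simp
  qed simp_all
  have "w x = \<beta> * (\<integral>y. k x y * exp (w y) \<partial>M) / Z" for x
  proof -
    have x: "x \<in> space M" by (simp add: space_UNIV)
    have "(\<lambda>n. \<integral>y. k x y * \<rho> (\<kappa> n) y \<partial>M) \<longlonglongrightarrow> (\<integral>y. k x y * (exp (w y) / Z) \<partial>M)"
    proof (rule integral_dominated_convergence[where w="\<lambda>y. \<bar>k x y\<bar> * C"])
      show "integrable M (\<lambda>y. \<bar>k x y\<bar> * C)" using kernel_integrable[OF x] by simp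
      show "AE y in M. (\<lambda>n. k x y * \<rho> (\<kappa> n) y) \<longlonglongrightarrow> k x y * (exp (w y) / Z)"
        using ae_all
      proof eventually_elim
        case (elim y)
        have "(\<lambda>n. exp (\<omega> (\<kappa> n) y) / (\<integral>y. exp (\<omega> (\<kappa> n) y) \<partial>M)) \<longlonglongrightarrow> exp (w y) / Z"
          using Z_pos by (intro tendsto_divide tendsto_exp \<omega>_lim[OF elim] Z_lim) simp
        moreover have "\<rho> (\<kappa> n) y = exp (\<omega> (\<kappa> n) y) / (\<integral>y. exp (\<omega> (\<kappa> n) y) \<partial>M)" for n using elim by blast
        ultimately have "(\<lambda>n. \<rho> (\<kappa> n) y) \<longlonglongrightarrow> exp (w y) / Z" by presburger
        then show ?case by (intro tendsto_mult tendsto_const)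
      qed
      show "AE y in M. norm (k x y * \<rho> (\<kappa> n) y) \<le> \<bar>k x y\<bar> * C" for n
        using \<rho> by (intro AE_I2) (simp add: abs_mult mult_left_mono)
      show "(\<lambda>y. k x y * (exp (w y) / Z)) \<in> borel_measurable M" "(\<lambda>y. k x y * \<rho> (\<kappa> n) y) \<in> borel_measurable M" for n
        using x by measurable
    qed
    then have "(\<lambda>n. W (\<kappa> n) x) \<longlonglongrightarrow> \<beta> * (\<integral>y. k x y * (exp (w y) / Z) \<partial>M)"
      unfolding W_def by (intro tendsto_mult tendsto_const)
    then have "w x = \<beta> * (\<integral>y. k x y * (exp (w y) / Z) \<partial>M)" using w[of x] LIMSEQ_unique by blast
    then show ?thesis by simp
  qed
  then show ?thesis using that[OF w_cont w_nonpos] Z_pos unfolding Z_def by blast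
qed

end

section \<open>The logarithmic kernel\<close>

lemma integrable_lborel_translate:
  fixes f :: "'a::euclidean_space \<Rightarrow> real"
  assumes "integrable lborel f"
  shows "integrable lborel (\<lambda>x. f (x + c))"
proof -
  have "integrable (distr lborel borel ((+) c)) f" using assms by (simp add: lborel_distr_plus)
  moreover have "f \<in> borel_measurable borel" using borel_measurable_integrable[OF assms] by simp
  ultimately have "integrable lborel (\<lambda>x. f (c + x))" by (subst (asm) integrable_distr_eq) auto
  then show ?thesis by (simp add: add.commute)
qed

lemma integrable_ln_norm_mult_test_function:
  fixes \<psi> :: "'a::euclidean_space \<Rightarrow> real"
  assumes \<psi>: "test_function \<psi>" and d: "DIM('a) \<ge> 2"
  shows "integrable lborel (\<lambda>x. ln (norm (x - y)) * \<psi> x)"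
proof -
  \<comment> \<open>A constant sequence turns the convergence lemma into an integrability
    criterion.\<close>
  have "integrable lborel (\<lambda>x. ln (norm x) * \<psi> (x + y))"
  proof (rule tendsto_integral_mult_test_function(1)[where m=1 and C=1 and D=1 and E=0 and H="\<lambda>_ x. ln (norm x)"])
    fix x :: 'a assume x: "x \<noteq> 0"
    have "ln (norm x) \<le> norm x" "ln (inverse (norm x)) \<le> inverse (norm x)" using x by (intro ln_bound; simp)+
    then show "\<bar>ln (norm x)\<bar> \<le> 1 * inverse (norm x ^ 1) + 1 * norm x + 0"
      using x by (simp add: ln_inverse abs_le_iff add_increasing add_increasing2)
  qed (use d test_function_translate[OF \<psi>] in auto)
  from integrable_lborel_translate[OF this, of "- y"] show ?thesis by simp
qed

text \<open>Duality between \<open>exp\<close> and \<open>c ln c - c\<close> for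
  \<open>c = b / \<tau>\<close>. Weakening \<open>ln c\<close> to \<open>ln (1 + c)\<close> makes
  the last term nonnegative. A small \<open>\<tau>\<close> shrinks the exponential part at the
  expense of the logarithmic one.\<close>

lemma young_exp_log:
  fixes a b \<tau> :: real
  assumes \<tau>: "\<tau> > 0" and b: "b \<ge> 0"
  shows "a * b \<le> \<tau> * exp a + b * ln (1 + b / \<tau>)"
proof (cases "b = 0")
  case False
  define c where "c = b / \<tau>"
  have c: "c > 0" using b False \<tau> by (simp add: c_def)
  have "c * (1 + (a - ln c)) \<le> c * exp (a - ln c)" using c by (intro mult_left_mono exp_ge_add_one_self) auto
  also have "\<dots> = exp a" using c by (simp add: exp_diff)
  finally have "c * a \<le> exp a + c * ln c - c" by (simp add: algebra_simps)
  moreover have "c * ln c \<le> c * ln (1 + c)" using c by (intro mult_left_mono) auto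
  ultimately have "c * a \<le> exp a + c * ln (1 + c)" using c by linarith
  then have "\<tau> * (c * a) \<le> \<tau> * (exp a + c * ln (1 + c))" using \<tau> by (intro mult_left_mono) auto
  moreover have "\<tau> * c = b" using \<tau> by (simp add: c_def)
  ultimately show ?thesis by (simp add: c_def[symmetric] distrib_left mult.assoc[symmetric] mult.commute[of a])
qed (use \<tau> in simp)

text \<open>Both orders of \<open>ln t \<le> t - 1\<close>. The sum of the inverses replaces their
  maximum so that each can be integrated separately.\<close>

lemma abs_ln_diff_le:
  fixes a b :: real
  assumes "a > 0" "b > 0"
  shows "\<bar>ln a - ln b\<bar> \<le> \<bar>a - b\<bar> * (inverse a + inverse b)"
proof -
  have *: "ln x - ln y \<le> \<bar>x - y\<bar> * inverse y" if "x > 0" "y > 0" for x y :: real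
  proof -
    have "ln x - ln y \<le> x / y - 1" using that ln_le_minus_one[of "x / y"] by (simp add: ln_div)
    also have "\<dots> = (x - y) * inverse y" using that by (simp add: field_simps)
    also have "\<dots> \<le> \<bar>x - y\<bar> * inverse y" using that by (intro mult_right_mono) auto
    finally show ?thesis .
  qed
  have "0 \<le> \<bar>a - b\<bar> * inverse a" "0 \<le> \<bar>a - b\<bar> * inverse b" using assms by simp_all
  then show ?thesis
    using *[OF assms] *[OF assms(2,1)] unfolding distrib_left abs_le_iff by (simp add: abs_minus_commute)
qed

text \<open>The default \<open>ln 0 = 0\<close> gives the diagonal the value
  \<open>- 2 * ln (1 + norm x)\<close>, so nonpositivity holds there without exception.\<close>

definition log_kernel :: "'a::euclidean_space \<Rightarrow> 'a \<Rightarrow> real" where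
  "log_kernel x y = ln (norm (x - y)) - ln (1 + norm x) - ln (1 + norm y)"

text \<open>The singular part within distance 1. Off the origin it equals
  \<open>exp (near_log z)\<close> there, which makes the two truncations a pair for Young's
  inequality.\<close>

definition near_inverse :: "'a::euclidean_space \<Rightarrow> real" where
  "near_inverse z = indicator (cball 0 1) z * inverse (norm z)"

text \<open>The positive part of \<open>- ln (norm z)\<close>, with value 0 at the origin by the
  default for \<open>ln 0\<close>.\<close>

definition near_log :: "'a::euclidean_space \<Rightarrow> real" where
  "near_log z = indicator (cball 0 1) z * - ln (norm z)"

lemma log_kernel_measurable [measurable]:
  "(\<lambda>(x, y). log_kernel x y) \<in> borel_measurable (borel \<Otimes>\<^sub>M borel)"
  unfolding log_kernel_def by measurable

lemma near_inverse_measurable [measurable]: "near_inverse \<in> borel_measurable borel"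
  unfolding near_inverse_def
  by (intro borel_measurable_times borel_measurable_indicator borel_measurable_inverse borel_measurable_norm) simp_all

lemma near_log_measurable [measurable]: "near_log \<in> borel_measurable borel"
  unfolding near_log_def
  by (intro borel_measurable_times borel_measurable_indicator borel_measurable_uminus borel_measurable_ln
      borel_measurable_norm) simp_all

lemma near_inverse_nonneg: "0 \<le> near_inverse z"
  by (simp add: near_inverse_def)

lemma near_log_nonneg: "0 \<le> near_log z"
  by (cases "z = 0") (simp_all add: near_log_def indicator_def)

lemma log_kernel_commute: "log_kernel x y = log_kernel y x"
  by (simp add: log_kernel_def norm_minus_commute)

lemma ln_one_plus_norm_nonneg: "0 \<le> ln (1 + norm x)"
  by simp

lemma ln_norm_diff_le: "ln (norm (x - y)) \<le> ln (1 + norm x) + ln (1 + norm y)"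
proof (cases "x = y")
  case False
  have "norm (x - y) \<le> norm x + norm y" by (rule norm_triangle_ineq4)
  also have "\<dots> \<le> (1 + norm x) * (1 + norm y)" by (simp add: algebra_simps)
  finally have "ln (norm (x - y)) \<le> ln ((1 + norm x) * (1 + norm y))" using False by (subst ln_le_cancel_iff) (auto intro!: mult_pos_pos add_pos_nonneg)
  also have "\<dots> = ln (1 + norm x) + ln (1 + norm y)" by (rule ln_mult_pos) (simp_all add: add_pos_nonneg)
  finally show ?thesis .
qed (simp add: ln_one_plus_norm_nonneg)

lemma log_kernel_nonpos: "log_kernel x y \<le> 0"
  using ln_norm_diff_le[of x y] by (simp add: log_kernel_def)

text \<open>The right-hand side is free of \<open>ln (1 + norm x)\<close>, which makes the bounds on
  potentials uniform in \<open>x\<close>. With \<open>r = norm (x - y)\<close> one has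
  \<open>1 + norm x \<le> (1 + norm y) * (1 + r)\<close>, which trades \<open>x\<close> for
  \<open>y\<close>; what is left, \<open>ln (1 + r) - ln r\<close>, is at most \<open>ln 2\<close>
  unless \<open>r \<le> 1\<close>, where \<open>near_log\<close> covers the rest.\<close>

lemma log_kernel_lower: "- log_kernel x y \<le> ln 2 + 2 * ln (1 + norm y) + near_log (x - y)"
proof (cases "x = y")
  case True
  then show ?thesis by (simp add: log_kernel_def near_log_def)
next
  case False
  define r where "r = norm (x - y)"
  have r: "r > 0" using False by (simp add: r_def)
  have "1 + norm x \<le> 1 + (r + norm y)" using norm_triangle_ineq[of "x - y" y] by (simp add: r_def)
  also have "\<dots> \<le> (1 + norm y) * (1 + r)" using r by (simp add: algebra_simps)
  finally have "ln (1 + norm x) \<le> ln ((1 + norm y) * (1 + r))" by (subst ln_le_cancel_iff) (use r in \<open>auto intro!: mult_pos_pos add_pos_nonneg\<close>)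
  also have "\<dots> = ln (1 + norm y) + ln (1 + r)" using r by (intro ln_mult_pos) (simp_all add: add_pos_nonneg)
  finally have 1: "ln (1 + norm x) \<le> ln (1 + norm y) + ln (1 + r)" .
  have 2: "ln (1 + r) - ln r \<le> ln 2 + near_log (x - y)"
  proof (cases "r \<le> 1")
    case True
    have "ln (1 + r) \<le> ln 2" using r True by simp
    then show ?thesis using True by (simp add: near_log_def r_def[symmetric])
  next
    case r1: False
    have "ln (1 + r) \<le> ln (2 * r)" using r r1 by (subst ln_le_cancel_iff) auto
    also have "\<dots> = ln 2 + ln r" using r by (intro ln_mult_pos) auto
    finally show ?thesis using near_log_nonneg[of "x - y"] by simp
  qed
  show ?thesis using 1 2 by (simp add: log_kernel_def r_def[symmetric])
qed

text \<open>Two norms differing by at most \<open>norm y\<close> have ratio at most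
  \<open>1 + norm y\<close> once the smaller is at least 1. This provides a majorant that does not
  involve \<open>X\<close> except in the unit ball around it.\<close>

lemma ln_norm_ratio_le:
  fixes X y :: "'a::euclidean_space"
  assumes X: "norm X \<ge> 1"
  shows "\<bar>ln (norm (X - y)) - ln (norm X)\<bar> \<le> ln (1 + norm y) + near_log (X - y)"
proof (cases "X = y")
  case True
  have "ln (norm X) \<le> ln (1 + norm X)" "0 \<le> ln (norm X)" using X by (auto intro!: ln_mono)
  then show ?thesis using True by (simp add: near_log_def)
next
  case False
  define r where "r = norm (X - y)"
  have r: "r > 0" using False by (simp add: r_def)
  have y: "1 + norm y > 0" by (simp add: add_pos_nonneg)
  have "r \<le> norm X + norm y" unfolding r_def by (rule norm_triangle_ineq4)
  also have "\<dots> \<le> norm X + norm X * norm y" using X by (simp add: mult_right_mono[of 1 "norm X" "norm y", simplified])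
  also have "\<dots> = norm X * (1 + norm y)" by (simp add: distrib_left)
  finally have "ln r \<le> ln (norm X * (1 + norm y))" using r by (rule ln_mono)
  also have "\<dots> = ln (norm X) + ln (1 + norm y)" using X y by (intro ln_mult_pos) auto
  finally have 1: "ln r - ln (norm X) \<le> ln (1 + norm y) + near_log (X - y)" using near_log_nonneg[of "X - y"] by simp
  have Xr: "norm X \<le> r + norm y" unfolding r_def using norm_triangle_ineq[of "X - y" y] by simp
  have 2: "ln (norm X) - ln r \<le> ln (1 + norm y) + near_log (X - y)"
  proof (cases "r \<le> 1")
    case True
    then have "X - y \<in> cball 0 1" by (simp add: r_def)
    then have "near_log (X - y) = - ln r" by (simp add: near_log_def r_def indicator_def del: mem_cball)
    moreover have "ln (norm X) \<le> ln (1 + norm y)" using Xr True X by (intro ln_mono) auto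
    ultimately show ?thesis by simp
  next
    case False
    then have "norm y \<le> r * norm y" using mult_right_mono[of 1 r "norm y"] by simp
    then have "norm X \<le> r * (1 + norm y)" using Xr by (simp add: distrib_left)
    then have "ln (norm X) \<le> ln (r * (1 + norm y))" using X by (intro ln_mono) auto
    also have "\<dots> = ln r + ln (1 + norm y)" using r y by (intro ln_mult_pos)
    finally show ?thesis using near_log_nonneg[of "X - y"] by simp
  qed
  show ?thesis using 1 2 unfolding r_def[symmetric] abs_le_iff by simp
qed

lemma ln_norm_ratio_tendsto:
  assumes X: "filterlim (\<lambda>i. norm (X i :: 'a::euclidean_space)) at_top sequentially"
  shows "(\<lambda>i. ln (norm (X i - y)) - ln (norm (X i))) \<longlonglongrightarrow> 0"
proof -
  have "(\<lambda>i. norm y / norm (X i)) \<longlonglongrightarrow> 0"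
    by (rule tendsto_divide_0[OF tendsto_const filterlim_at_top_imp_at_infinity[OF X]])
  moreover have "\<forall>\<^sub>F i in sequentially. norm (norm (X i - y) / norm (X i) - 1) \<le> norm y / norm (X i)"
    using filterlim_at_top_dense[THEN iffD1, OF X, rule_format, of 0]
  proof eventually_elim
    case (elim i)
    have "norm (X i - y) / norm (X i) - 1 = (norm (X i - y) - norm (X i)) / norm (X i)"
      using elim by (simp add: diff_divide_distrib)
    moreover have "\<bar>norm (X i - y) - norm (X i)\<bar> \<le> norm y"
      using norm_triangle_ineq3[of "X i - y" "X i"] by simp
    ultimately show ?case by (simp add: divide_right_mono)
  qed
  ultimately have "(\<lambda>i. norm (X i - y) / norm (X i) - 1) \<longlonglongrightarrow> 0" by (rule Lim_null_comparison[rotated])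
  then have "(\<lambda>i. norm (X i - y) / norm (X i)) \<longlonglongrightarrow> 1" by (simp add: LIM_zero_iff)
  then have "(\<lambda>i. ln (norm (X i - y) / norm (X i))) \<longlonglongrightarrow> ln 1" by (intro tendsto_ln) simp_all
  then have l: "(\<lambda>i. ln (norm (X i - y) / norm (X i))) \<longlonglongrightarrow> 0" by simp
  have "\<forall>\<^sub>F i in sequentially. ln (norm (X i - y) / norm (X i)) = ln (norm (X i - y)) - ln (norm (X i))"
    using filterlim_at_top_dense[THEN iffD1, OF X, rule_format, of "norm y"]
  proof eventually_elim
    case (elim i)
    then have "X i \<noteq> y" "norm (X i) > 0" using norm_ge_zero[of y] by (auto simp del: norm_ge_zero)
    then show ?case by (simp add: ln_div)
  qed
  from Lim_transform_eventually[OF l this] show ?thesis .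
qed

section \<open>Weighted estimates for the logarithmic kernel\<close>

lemma near_inverse_translate:
  fixes x :: "'a::euclidean_space"
  assumes d: "DIM('a) \<ge> 2"
  shows "integrable lborel (\<lambda>y. near_inverse (x - y))"
    and "(\<integral>y. near_inverse (x - y) \<partial>lborel) = (\<integral>y. near_inverse (y::'a) \<partial>lborel)"
proof -
  have int: "integrable lborel (near_inverse :: 'a \<Rightarrow> real)"
    using integrable_inverse_norm_power[of 1 1, where 'a='a] d by (simp add: near_inverse_def[abs_def])
  have eq: "near_inverse (x - y) = near_inverse (y + - x)" for y
    by (simp add: near_inverse_def norm_minus_commute indicator_def)
  show "integrable lborel (\<lambda>y. near_inverse (x - y))"
    unfolding eq by (rule integrable_lborel_translate[OF int])
  show "(\<integral>y. near_inverse (x - y) \<partial>lborel) = (\<integral>y. near_inverse (y::'a) \<partial>lborel)"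
    unfolding eq by (rule integral_lborel_translate) measurable
qed

text \<open>It serves twice: for the weight \<open>h\<close> in the mean field equation and for the
  normalised density of the solution, which inherits the assumptions with another \<open>A\<close>.
  The growth bound tames the local singularity, the logarithmic moment the behaviour at
  infinity.\<close>

locale log_density =
  fixes h :: "'a::euclidean_space \<Rightarrow> real" and A p :: real
  assumes h_measurable [measurable]: "h \<in> borel_measurable borel"
    and h_nonneg: "0 \<le> h x"
    and A_pos: "A > 0" and p_nonneg: "p \<ge> 0"
    and h_growth: "h x \<le> A * (1 + norm x) powr p"
    and h_integrable: "integrable lborel h"
    and h_log_integrable: "integrable lborel (\<lambda>x. h x * ln (1 + norm x))"
    and dim: "DIM('a) \<ge> 2"
begin

definition near_mass :: real where
  "near_mass = (\<integral>y. near_inverse (y::'a) \<partial>lborel)"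

text \<open>A majorant of \<open>h y * ln (1 + h y / \<tau>)\<close>: the growth bound gives
  \<open>1 + h y / \<tau> \<le> (1 + A / \<tau>) * (1 + norm y) powr p\<close>. Being linear in
  \<open>h\<close>, it is integrable by the logarithmic moment.\<close>

definition log_growth :: "real \<Rightarrow> 'a \<Rightarrow> real" where
  "log_growth \<tau> y = h y * (ln (1 + A / \<tau>) + p * ln (1 + norm y))"

lemma log_growth_integrable: "integrable lborel (log_growth \<tau>)"
proof -
  have "integrable lborel (\<lambda>y. ln (1 + A / \<tau>) * h y + p * (h y * ln (1 + norm y)))"
    using h_integrable h_log_integrable by simp
  then show ?thesis unfolding log_growth_def[abs_def] by (simp only: distrib_left mult_ac)
qed

lemma log_growth_measurable [measurable]: "log_growth \<tau> \<in> borel_measurable borel"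
  unfolding log_growth_def by measurable

lemma log_growth_nonneg: "\<tau> > 0 \<Longrightarrow> 0 \<le> log_growth \<tau> y"
  unfolding log_growth_def using A_pos p_nonneg
  by (intro mult_nonneg_nonneg h_nonneg add_nonneg_nonneg) simp_all

text \<open>Young's inequality with \<open>a = - ln (norm (x - y))\<close> and
  \<open>b = h y\<close>. The indicator is kept because, as \<open>x\<close> runs to infinity, the
  second term tends to 0 pointwise, whereas the first keeps its mass
  \<open>\<tau> * near_mass\<close>.\<close>

lemma near_log_mult_le:
  assumes \<tau>: "\<tau> > 0"
  shows "near_log (x - y) * h y \<le> \<tau> * near_inverse (x - y) + indicator (cball x 1) y * log_growth \<tau> y"
proof (cases "x = y \<or> norm (x - y) > 1")
  case True
  then have "near_log (x - y) = 0" by (auto simp: near_log_def)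
  moreover have "0 \<le> \<tau> * near_inverse (x - y) + indicator (cball x 1) y * log_growth \<tau> y"
    using \<tau> by (intro add_nonneg_nonneg mult_nonneg_nonneg near_inverse_nonneg log_growth_nonneg) simp_all
  ultimately show ?thesis by simp
next
  case False
  then have z: "norm (x - y) > 0" "norm (x - y) \<le> 1" by auto
  have pw: "1 \<le> (1 + norm y) powr p" using p_nonneg by (simp add: ge_one_powr_ge_zero)
  have "1 + h y / \<tau> \<le> 1 + A / \<tau> * (1 + norm y) powr p"
    using h_growth[of y] \<tau> by (simp add: divide_right_mono)
  also have "\<dots> \<le> (1 + A / \<tau>) * (1 + norm y) powr p"
    using pw by (simp add: distrib_right)
  finally have "ln (1 + h y / \<tau>) \<le> ln ((1 + A / \<tau>) * (1 + norm y) powr p)"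
    using h_nonneg[of y] \<tau> by (intro ln_mono add_pos_nonneg) auto
  also have "\<dots> = ln (1 + A / \<tau>) + p * ln (1 + norm y)"
    using A_pos \<tau> by (subst ln_mult) (auto simp: add_pos_nonneg ln_powr add_nonneg_eq_0_iff)
  finally have "h y * ln (1 + h y / \<tau>) \<le> log_growth \<tau> y"
    unfolding log_growth_def by (rule mult_left_mono[OF _ h_nonneg])
  moreover have "- ln (norm (x - y)) * h y \<le> \<tau> * exp (- ln (norm (x - y))) + h y * ln (1 + h y / \<tau>)"
    by (rule young_exp_log[OF \<tau> h_nonneg])
  moreover have "x - y \<in> cball 0 1" "y \<in> cball x 1" using z by (simp_all add: dist_norm norm_minus_commute)
  then have "near_log (x - y) = - ln (norm (x - y))" "near_inverse (x - y) = inverse (norm (x - y))"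
    "indicator (cball x 1) y = (1::real)"
    unfolding near_log_def near_inverse_def by (simp_all only: indicator_simps mult_1_left)
  ultimately show ?thesis
    using z by (simp add: exp_minus)
qed

text \<open>Here \<open>\<tau> = 1\<close> is enough. By translation invariance the singular part
  contributes \<open>near_mass\<close> whatever \<open>x\<close> is, so the bound is uniform and can
  serve as the constant \<open>B\<close> of the abstract equation.\<close>

lemma log_kernel_mult_integrable: "integrable lborel (\<lambda>y. h y * log_kernel x y)"
  and log_kernel_mult_bound: "- ((\<integral>y. h y * (ln 2 + 2 * ln (1 + norm y)) \<partial>lborel) + near_mass + (\<integral>y. log_growth 1 y \<partial>lborel))
      \<le> (\<integral>y. h y * log_kernel x y \<partial>lborel)"
proof -
  let ?w = "\<lambda>y. h y * (ln 2 + 2 * ln (1 + norm y)) + near_inverse (x - y) + log_growth 1 y"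
  have i1: "integrable lborel (\<lambda>y. h y * (ln 2 + 2 * ln (1 + norm y)))"
  proof -
    have "integrable lborel (\<lambda>y. ln 2 * h y + 2 * (h y * ln (1 + norm y)))"
      using h_integrable h_log_integrable by simp
    then show ?thesis by (simp only: distrib_left mult_ac)
  qed
  note i = i1 near_inverse_translate(1)[OF dim, of x] log_growth_integrable[of 1]
  have w: "integrable lborel ?w" using i by simp
  have bd: "- (h y * log_kernel x y) \<le> ?w y" for y
  proof -
    have "h y * (- log_kernel x y) \<le> h y * (ln 2 + 2 * ln (1 + norm y) + near_log (x - y))"
      by (rule mult_left_mono[OF log_kernel_lower h_nonneg])
    also have "\<dots> = h y * (ln 2 + 2 * ln (1 + norm y)) + near_log (x - y) * h y" by (simp only: distrib_left mult.commute)
    also have "near_log (x - y) * h y \<le> 1 * near_inverse (x - y) + indicator (cball x 1) y * log_growth 1 y"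
      by (rule near_log_mult_le) simp
    also have "indicator (cball x 1) y * log_growth 1 y \<le> log_growth 1 y"
      using log_growth_nonneg[of 1 y] by (simp add: indicator_def)
    finally show ?thesis by simp
  qed
  have np: "h y * log_kernel x y \<le> 0" for y by (intro mult_nonneg_nonpos h_nonneg log_kernel_nonpos)
  show int: "integrable lborel (\<lambda>y. h y * log_kernel x y)"
  proof (rule Bochner_Integration.integrable_bound[OF w])
    show "(\<lambda>y. h y * log_kernel x y) \<in> borel_measurable lborel"
      unfolding log_kernel_def by measurable
    show "AE y in lborel. norm (h y * log_kernel x y) \<le> norm (?w y)"
    proof (rule AE_I2)
      fix y
      show "norm (h y * log_kernel x y) \<le> norm (?w y)" using bd[of y] np[of y] unfolding real_norm_def by linarith
    qed
  qed
  have "(\<integral>y. - (h y * log_kernel x y) \<partial>lborel) \<le> (\<integral>y. ?w y \<partial>lborel)"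
    by (rule integral_mono[OF _ w bd]) (use int in simp)
  also have "\<dots> = (\<integral>y. h y * (ln 2 + 2 * ln (1 + norm y)) \<partial>lborel) + near_mass + (\<integral>y. log_growth 1 y \<partial>lborel)"
    using i near_inverse_translate(2)[OF dim, of x] by (simp add: near_mass_def)
  finally show "- ((\<integral>y. h y * (ln 2 + 2 * ln (1 + norm y)) \<partial>lborel) + near_mass + (\<integral>y. log_growth 1 y \<partial>lborel))
      \<le> (\<integral>y. h y * log_kernel x y \<partial>lborel)" by simp
qed

text \<open>Beyond distance 1 the inverse is at most 1; within it \<open>norm y \<le> R + 1\<close>,
  and the growth bound on \<open>h\<close> accounts for the base \<open>2 + R\<close>. The bound is
  only locally uniform in \<open>x\<close>, which is what continuity asks for.\<close>

lemma inverse_mult_bound: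
  assumes x: "norm x \<le> R"
  shows "integrable lborel (\<lambda>y. h y * inverse (norm (x - y)))"
    and "(\<integral>y. h y * inverse (norm (x - y)) \<partial>lborel) \<le> (\<integral>y. h y \<partial>lborel) + A * (2 + R) powr p * near_mass"
proof -
  let ?w = "\<lambda>y. h y + A * (2 + R) powr p * near_inverse (x - y)"
  note i = h_integrable near_inverse_translate(1)[OF dim, of x]
  have w: "integrable lborel ?w" using i by simp
  have bd: "h y * inverse (norm (x - y)) \<le> ?w y" for y
  proof (cases "norm (x - y) \<le> 1")
    case True
    have "norm y \<le> norm x + norm (x - y)" by (metis norm_minus_commute norm_triangle_sub)
    then have "1 + norm y \<le> 2 + R" using True x by linarith
    then have "(1 + norm y) powr p \<le> (2 + R) powr p" using p_nonneg by (intro powr_mono2) auto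
    then have "h y \<le> A * (2 + R) powr p"
      using h_growth[of y] A_pos by (meson less_imp_le mult_left_mono order_trans)
    then have "h y * inverse (norm (x - y)) \<le> A * (2 + R) powr p * inverse (norm (x - y))"
      by (rule mult_right_mono) simp
    then show ?thesis using True h_nonneg[of y] by (simp add: near_inverse_def)
  next
    case False
    then have "h y * inverse (norm (x - y)) \<le> h y * 1"
      by (intro mult_left_mono h_nonneg) (simp add: inverse_le_1_iff)
    then show ?thesis using False by (simp add: near_inverse_def)
  qed
  show int: "integrable lborel (\<lambda>y. h y * inverse (norm (x - y)))"
  proof (rule Bochner_Integration.integrable_bound[OF w])
    show "(\<lambda>y. h y * inverse (norm (x - y))) \<in> borel_measurable lborel" by measurable
    show "AE y in lborel. norm (h y * inverse (norm (x - y))) \<le> norm (?w y)"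
    proof (rule AE_I2)
      fix y
      have "0 \<le> h y * inverse (norm (x - y))" using h_nonneg by simp
      then show "norm (h y * inverse (norm (x - y))) \<le> norm (?w y)" using bd[of y] unfolding real_norm_def by linarith
    qed
  qed
  have "(\<integral>y. h y * inverse (norm (x - y)) \<partial>lborel) \<le> (\<integral>y. ?w y \<partial>lborel)"
    by (rule integral_mono[OF int w bd])
  also have "\<dots> = (\<integral>y. h y \<partial>lborel) + A * (2 + R) powr p * near_mass"
    using i near_inverse_translate(2)[OF dim, of x] by (simp add: near_mass_def)
  finally show "(\<integral>y. h y * inverse (norm (x - y)) \<partial>lborel) \<le> (\<integral>y. h y \<partial>lborel) + A * (2 + R) powr p * near_mass" .
qed

text \<open>The increment of the logarithm brings in the singularity \<open>1 / |x - y|\<close>,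
  still integrable against \<open>h\<close> in dimension at least 2. The map from \<open>x\<close>
  to the kernel is therefore locally Lipschitz in the L1 norm with weight \<open>h\<close>.\<close>

lemma log_kernel_continuous:
  "((\<lambda>x'. \<integral>y. h y * \<bar>log_kernel x' y - log_kernel x y\<bar> \<partial>lborel) \<longlongrightarrow> 0) (at x)"
proof -
  let ?R = "norm x + 1"
  let ?m = "\<integral>y. h y \<partial>lborel"
  let ?B = "?m + A * (2 + ?R) powr p * near_mass"
  have est: "(\<integral>y. h y * \<bar>log_kernel x' y - log_kernel x y\<bar> \<partial>lborel) \<le> norm (x' - x) * (?B + ?B + ?m)"
    if x': "dist x' x \<le> 1" for x'
  proof -
    have nx: "norm x \<le> ?R" by simp
    have nx': "norm x' \<le> ?R"
      using x' norm_triangle_ineq[of "x' - x" x] by (simp add: dist_norm)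
    note iv = inverse_mult_bound[OF nx] inverse_mult_bound[OF nx']
    let ?w = "\<lambda>y. norm (x' - x) * (h y * inverse (norm (x' - y)) + h y * inverse (norm (x - y)) + h y)"
    have w: "integrable lborel ?w" using iv h_integrable by simp
    have ae: "AE y in lborel. h y * \<bar>log_kernel x' y - log_kernel x y\<bar> \<le> ?w y"
    proof -
      have "AE y in lborel. y \<noteq> x" "AE y in lborel. y \<noteq> x'" by (rule AE_lborel_singleton)+
      then show ?thesis
      proof eventually_elim
        case (elim y)
        then have ab: "norm (x' - y) > 0" "norm (x - y) > 0" by auto
        have "\<bar>ln (norm (x' - y)) - ln (norm (x - y))\<bar> \<le> \<bar>norm (x' - y) - norm (x - y)\<bar> * (inverse (norm (x' - y)) + inverse (norm (x - y)))"
          by (rule abs_ln_diff_le[OF ab])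
        also have "\<dots> \<le> norm (x' - x) * (inverse (norm (x' - y)) + inverse (norm (x - y)))"
          using norm_triangle_ineq3[of "x' - y" "x - y"] by (intro mult_right_mono) auto
        finally have 1: "\<bar>ln (norm (x' - y)) - ln (norm (x - y))\<bar> \<le> norm (x' - x) * (inverse (norm (x' - y)) + inverse (norm (x - y)))" .
        have one: "1 + norm z > 0" "inverse (1 + norm z) \<le> 1" for z :: 'a by (simp_all add: add_pos_nonneg inverse_le_1_iff)
        have 2: "\<bar>ln (1 + norm x') - ln (1 + norm x)\<bar> \<le> norm (x' - x)"
        proof -
          have *: "ln (1 + norm a) - ln (1 + norm b) \<le> norm (a - b)" for a b :: 'a
          proof -
            have "norm a \<le> norm b + norm (a - b)" by (rule norm_triangle_sub)
            moreover have "0 \<le> norm b * norm (a - b)" by simp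
            ultimately have "1 + norm a \<le> 1 + norm b + norm (a - b) + norm b * norm (a - b)" by linarith
            then have "1 + norm a \<le> (1 + norm b) * (1 + norm (a - b))" by (simp add: distrib_left distrib_right)
            then have "ln (1 + norm a) \<le> ln ((1 + norm b) * (1 + norm (a - b)))" using one(1) by (intro ln_mono) auto
            also have "\<dots> = ln (1 + norm b) + ln (1 + norm (a - b))" using one(1) by (intro ln_mult_pos) auto
            also have "ln (1 + norm (a - b)) \<le> norm (a - b)" by (rule ln_add_one_self_le_self) simp
            finally show ?thesis by simp
          qed
          show ?thesis using *[of x' x] *[of x x'] by (simp add: abs_le_iff norm_minus_commute)
        qed
        have "\<bar>log_kernel x' y - log_kernel x y\<bar> \<le> norm (x' - x) * (inverse (norm (x' - y)) + inverse (norm (x - y))) + norm (x' - x)"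
          using 1 2 unfolding log_kernel_def by linarith
        then have "h y * \<bar>log_kernel x' y - log_kernel x y\<bar> \<le> h y * (norm (x' - x) * (inverse (norm (x' - y)) + inverse (norm (x - y))) + norm (x' - x))"
          by (rule mult_left_mono[OF _ h_nonneg])
        also have "\<dots> = ?w y" by (simp add: algebra_simps)
        finally show ?case .
      qed
    qed
    have "(\<integral>y. h y * \<bar>log_kernel x' y - log_kernel x y\<bar> \<partial>lborel) \<le> (\<integral>y. ?w y \<partial>lborel)"
    proof (rule integral_mono_AE[OF _ w ae])
      have "integrable lborel (\<lambda>y. \<bar>h y * log_kernel x' y - h y * log_kernel x y\<bar>)"
        using log_kernel_mult_integrable by simp
      moreover have "\<bar>h y * log_kernel x' y - h y * log_kernel x y\<bar> = h y * \<bar>log_kernel x' y - log_kernel x y\<bar>" for y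
        using h_nonneg[of y] by (simp add: right_diff_distrib[symmetric] abs_mult)
      ultimately show "integrable lborel (\<lambda>y. h y * \<bar>log_kernel x' y - log_kernel x y\<bar>)" by simp
    qed
    also have "\<dots> = norm (x' - x) * ((\<integral>y. h y * inverse (norm (x' - y)) \<partial>lborel) + (\<integral>y. h y * inverse (norm (x - y)) \<partial>lborel) + ?m)"
      using iv h_integrable by simp
    also have "\<dots> \<le> norm (x' - x) * (?B + ?B + ?m)"
      using iv by (intro mult_left_mono add_mono) auto
    finally show ?thesis .
  qed
  have "((\<lambda>x'. norm (x' - x) * (?B + ?B + ?m)) \<longlongrightarrow> norm (x - x) * (?B + ?B + ?m)) (at x)"
    by (intro tendsto_intros)
  then have lim: "((\<lambda>x'. norm (x' - x) * (?B + ?B + ?m)) \<longlongrightarrow> 0) (at x)" by simp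
  have "\<forall>\<^sub>F x' in at x. dist x' x \<le> 1"
    using eventually_at_ball[of 1 x UNIV] by (auto simp: eventually_at dist_commute intro!: exI[of _ 1])
  then have "\<forall>\<^sub>F x' in at x. norm (\<integral>y. h y * \<bar>log_kernel x' y - log_kernel x y\<bar> \<partial>lborel) \<le> norm (x' - x) * (?B + ?B + ?m)"
  proof eventually_elim
    case (elim x')
    have "0 \<le> (\<integral>y. h y * \<bar>log_kernel x' y - log_kernel x y\<bar> \<partial>lborel)"
      by (intro Bochner_Integration.integral_nonneg mult_nonneg_nonneg h_nonneg) simp
    then show ?case using est[OF elim] by simp
  qed
  from Lim_null_comparison[OF this lim] show ?thesis .
qed

text \<open>The singularity travels with \<open>X i\<close> and has no fixed integrable majorant.
  Young's inequality splits off a travelling part of mass \<open>\<tau> * near_mass\<close>, made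
  small by \<open>\<tau>\<close>; the rest is bounded by \<open>T i\<close>, which has a fixed
  majorant and the pointwise limit 0.\<close>

lemma integral_ln_norm_ratio_tendsto:
  assumes X: "filterlim (\<lambda>i. norm (X i :: 'a)) at_top sequentially"
  shows "(\<lambda>i. \<integral>y. h y * (ln (norm (X i - y)) - ln (norm (X i))) \<partial>lborel) \<longlonglongrightarrow> 0"
proof (rule LIMSEQ_I)
  fix e :: real assume e: "e > 0"
  have N0: "near_mass \<ge> 0" unfolding near_mass_def
    by (intro Bochner_Integration.integral_nonneg near_inverse_nonneg)
  \<comment> \<open>The travelling part is then at most \<open>e / 2\<close>; the summand 1 avoids a
    zero denominator.\<close>
  define \<tau> where "\<tau> = e / (2 * (near_mass + 1))"
  have \<tau>: "\<tau> > 0" using e N0 by (simp add: \<tau>_def)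
  have \<tau>N: "\<tau> * near_mass \<le> e / 2" using e N0 by (simp add: \<tau>_def field_simps)
  define g where "g i y = ln (norm (X i - y)) - ln (norm (X i))" for i y
  have g_meas [measurable]: "g i \<in> borel_measurable borel" for i unfolding g_def by measurable
  \<comment> \<open>Inside the unit ball around \<open>X i\<close> the integrand is replaced by what
    Young's inequality leaves besides the travelling part. Every fixed \<open>y\<close> is outside
    these balls from some index on.\<close>
  define T where "T i y = indicator (- cball (X i) 1) y * (h y * \<bar>g i y\<bar>)
    + indicator (cball (X i) 1) y * (h y * ln (1 + norm y) + log_growth \<tau> y)" for i y
  have T_meas [measurable]: "T i \<in> borel_measurable borel" for i
    unfolding T_def
    by (intro borel_measurable_add borel_measurable_times borel_measurable_indicator) simp_all
  obtain i0 where i0: "\<And>i. i \<ge> i0 \<Longrightarrow> norm (X i) > 1"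
    using filterlim_at_top_dense[THEN iffD1, OF X, rule_format, of 1] unfolding eventually_sequentially by blast
  have g_le: "\<bar>g i y\<bar> \<le> ln (1 + norm y) + near_log (X i - y)" if "i \<ge> i0" for i y
    unfolding g_def using i0[OF that] by (intro ln_norm_ratio_le) simp
  have far: "near_log (X i - y) = 0" if "y \<notin> cball (X i) 1" for i y
    using that by (simp add: near_log_def indicator_def dist_norm norm_minus_commute)
  let ?D = "\<lambda>y. h y * ln (1 + norm y) + log_growth \<tau> y"
  have D_int: "integrable lborel ?D" using h_log_integrable log_growth_integrable by simp
  have hJ: "0 \<le> h y * ln (1 + norm y)" for y using h_nonneg[of y] by simp
  have T_le: "\<bar>T i y\<bar> \<le> ?D y" if i: "i \<ge> i0" for i y
  proof (cases "y \<in> cball (X i) 1")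
    case True
    then show ?thesis unfolding T_def using hJ[of y] log_growth_nonneg[OF \<tau>, of y] by (simp add: indicator_def del: mem_cball)
  next
    case False
    have "h y * \<bar>g i y\<bar> \<le> h y * ln (1 + norm y)"
      using g_le[OF i, of y] far[OF False] by (intro mult_left_mono h_nonneg) simp
    then show ?thesis unfolding T_def using False log_growth_nonneg[OF \<tau>, of y] h_nonneg[of y]
      by (simp add: indicator_def abs_mult del: mem_cball)
  qed
  have T_lim: "(\<lambda>i. T i y) \<longlonglongrightarrow> 0" for y
  proof -
    have "(\<lambda>i. h y * \<bar>g i y\<bar>) \<longlonglongrightarrow> h y * \<bar>0\<bar>"
      unfolding g_def by (intro tendsto_intros ln_norm_ratio_tendsto[OF X])
    then have l: "(\<lambda>i. h y * \<bar>g i y\<bar>) \<longlonglongrightarrow> 0" by simp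
    have "\<forall>\<^sub>F i in sequentially. h y * \<bar>g i y\<bar> = T i y"
      using filterlim_at_top_dense[THEN iffD1, OF X, rule_format, of "norm y + 1"]
    proof eventually_elim
      case (elim i)
      have "norm (X i) \<le> norm (X i - y) + norm y" using norm_triangle_ineq[of "X i - y" y] by simp
      then have "y \<notin> cball (X i) 1" using elim by (simp add: dist_norm)
      then show ?case by (simp add: T_def indicator_def del: mem_cball)
    qed
    from Lim_transform_eventually[OF l this] show ?thesis .
  qed
  have "(\<lambda>i. \<integral>y. T (i + i0) y \<partial>lborel) \<longlonglongrightarrow> (\<integral>y. 0 \<partial>(lborel :: 'a measure))"
  proof (rule integral_dominated_convergence[OF _ _ D_int])
    show "AE y in lborel. (\<lambda>i. T (i + i0) y) \<longlonglongrightarrow> 0"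
      by (intro AE_I2 LIMSEQ_ignore_initial_segment T_lim)
    show "AE y in lborel. norm (T (i + i0) y) \<le> ?D y" for i
      unfolding real_norm_def by (intro AE_I2 T_le) simp
  qed simp_all
  then have "(\<lambda>i. \<integral>y. T (i + i0) y \<partial>lborel) \<longlonglongrightarrow> 0" by simp
  then have "(\<lambda>i. \<integral>y. T i y \<partial>lborel) \<longlonglongrightarrow> 0" by (rule LIMSEQ_offset)
  moreover have "e / 2 > 0" using e by simp
  ultimately obtain i1 where i1: "\<And>i. i \<ge> i1 \<Longrightarrow> norm ((\<integral>y. T i y \<partial>lborel) - 0) < e / 2"
    by (blast dest: LIMSEQ_D)
  have "norm ((\<integral>y. h y * g i y \<partial>lborel) - 0) < e" if i: "i \<ge> max i0 i1" for i
  proof -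
    have i': "i \<ge> i0" "i \<ge> i1" using i by auto
    let ?w = "\<lambda>y. T i y + \<tau> * near_inverse (X i - y)"
    have T_int: "integrable lborel (T i)"
      by (rule Bochner_Integration.integrable_bound[OF D_int]) (use T_le[OF i'(1)] in \<open>auto intro!: AE_I2 order_trans[OF _ abs_ge_self]\<close>)
    note i_near = near_inverse_translate[OF dim, of "X i"]
    have w: "integrable lborel ?w" using T_int i_near by simp
    have bd: "\<bar>h y * g i y\<bar> \<le> ?w y" for y
    proof (cases "y \<in> cball (X i) 1")
      case True
      have "h y * \<bar>g i y\<bar> \<le> h y * (ln (1 + norm y) + near_log (X i - y))"
        by (rule mult_left_mono[OF g_le[OF i'(1)] h_nonneg])
      also have "\<dots> = h y * ln (1 + norm y) + near_log (X i - y) * h y" by (simp only: distrib_left mult.commute)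
      also have "near_log (X i - y) * h y \<le> \<tau> * near_inverse (X i - y) + indicator (cball (X i) 1) y * log_growth \<tau> y"
        by (rule near_log_mult_le[OF \<tau>])
      finally show ?thesis using True h_nonneg[of y] by (simp add: T_def indicator_def abs_mult del: mem_cball)
    next
      case False
      then show ?thesis using h_nonneg[of y] near_inverse_nonneg[of "X i - y"] \<tau> by (simp add: T_def indicator_def abs_mult del: mem_cball)
    qed
    have hg: "integrable lborel (\<lambda>y. h y * g i y)"
    proof (rule Bochner_Integration.integrable_bound[OF w])
      show "AE y in lborel. norm (h y * g i y) \<le> norm (?w y)"
        using bd by (intro AE_I2) (metis abs_ge_self order_trans real_norm_def)
    qed simp
    have "\<bar>\<integral>y. h y * g i y \<partial>lborel\<bar> \<le> (\<integral>y. \<bar>h y * g i y\<bar> \<partial>lborel)" by (rule integral_abs_bound)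
    also have "\<dots> \<le> (\<integral>y. ?w y \<partial>lborel)" by (rule integral_mono[OF _ w bd]) (use hg in simp)
    also have "\<dots> = (\<integral>y. T i y \<partial>lborel) + \<tau> * near_mass" using T_int i_near by (simp add: near_mass_def)
    also have "\<dots> < e" using i1[OF i'(2)] \<tau>N unfolding real_norm_def by linarith
    finally show ?thesis by simp
  qed
  then show "\<exists>n0. \<forall>i\<ge>n0. norm ((\<integral>y. h y * (ln (norm (X i - y)) - ln (norm (X i))) \<partial>lborel) - 0) < e"
    unfolding g_def by blast
qed

text \<open>The subtracted term shifts the potential by a finite constant only. With it, the
  difference from the integral of \<open>log_kernel\<close> is exactly
  \<open>ln (1 + norm x)\<close> times the mass.\<close>

definition log_potential :: "'a \<Rightarrow> real" where
  "log_potential x = (\<integral>y. h y * (ln (norm (x - y)) - ln (1 + norm y)) \<partial>lborel)"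

lemma log_potential_integrable: "integrable lborel (\<lambda>y. h y * (ln (norm (x - y)) - ln (1 + norm y)))"
  and log_potential_eq: "log_potential x = (\<integral>y. h y * log_kernel x y \<partial>lborel) + ln (1 + norm x) * (\<integral>y. h y \<partial>lborel)"
proof -
  have eq: "h y * (ln (norm (x - y)) - ln (1 + norm y)) = h y * log_kernel x y + ln (1 + norm x) * h y" for y
    by (simp add: log_kernel_def algebra_simps)
  show "integrable lborel (\<lambda>y. h y * (ln (norm (x - y)) - ln (1 + norm y)))"
    unfolding eq using log_kernel_mult_integrable h_integrable by simp
  show "log_potential x = (\<integral>y. h y * log_kernel x y \<partial>lborel) + ln (1 + norm x) * (\<integral>y. h y \<partial>lborel)"
    unfolding log_potential_def eq using log_kernel_mult_integrable h_integrable by simp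
qed

text \<open>Dominated convergence works along sequences, so the limit is tested there: a failure
  would give points \<open>X i\<close> of norm at least \<open>i\<close> at which the distance to
  the limit stays at least \<open>e\<close>.\<close>

lemma log_potential_at_infinity:
  "((\<lambda>x. log_potential x - (\<integral>y. h y \<partial>lborel) * ln (norm x)) \<longlongrightarrow> - (\<integral>y. h y * ln (1 + norm y) \<partial>lborel)) at_infinity"
proof (rule ccontr)
  let ?L = "- (\<integral>y. h y * ln (1 + norm y) \<partial>lborel)"
  let ?f = "\<lambda>x. log_potential x - (\<integral>y. h y \<partial>lborel) * ln (norm x)"
  assume "\<not> (?f \<longlongrightarrow> ?L) at_infinity"
  then obtain e where e: "e > 0" and freq: "\<not> (\<forall>\<^sub>F x in at_infinity. dist (?f x) ?L < e)"
    unfolding tendsto_iff by blast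
  have "\<exists>x. real i \<le> norm x \<and> \<not> dist (?f x) ?L < e" for i
    using freq unfolding eventually_at_infinity by blast
  then obtain X where X: "\<And>i. real i \<le> norm (X i)" and far: "\<And>i. \<not> dist (?f (X i)) ?L < e"
    by metis
  have "filterlim (\<lambda>i. norm (X i)) at_top sequentially"
    by (rule filterlim_at_top_mono[OF filterlim_real_sequentially]) (simp add: X)
  from integral_ln_norm_ratio_tendsto[OF this]
  have "(\<lambda>i. \<integral>y. h y * (ln (norm (X i - y)) - ln (norm (X i))) \<partial>lborel) \<longlonglongrightarrow> 0" .
  moreover have "(\<integral>y. h y * (ln (norm (x - y)) - ln (norm x)) \<partial>lborel) = ?f x - ?L" for x
  proof -
    have "h y * (ln (norm (x - y)) - ln (norm x))
        = h y * (ln (norm (x - y)) - ln (1 + norm y)) - h y * ln (norm x) + h y * ln (1 + norm y)" for y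
      by (simp add: algebra_simps)
    then show ?thesis using log_potential_integrable[of x] h_integrable h_log_integrable
      by (simp add: log_potential_def)
  qed
  ultimately have "(\<lambda>i. ?f (X i) - ?L) \<longlonglongrightarrow> 0" by simp
  then have "(\<lambda>i. ?f (X i)) \<longlonglongrightarrow> ?L" by (simp only: LIM_zero_iff)
  then have "\<forall>\<^sub>F i in sequentially. dist (?f (X i)) ?L < e" using e by (rule tendstoD)
  then show False using far by (auto simp: eventually_sequentially)
qed

text \<open>Fubini's theorem. As \<open>log_kernel\<close> is nonpositive,
  \<open>- log_kernel x y + ln (1 + norm x)\<close> bounds the absolute value of
  \<open>ln (norm (x - y)) - ln (1 + norm y)\<close>, and its integral against \<open>h\<close> is
  at most a continuous function of \<open>x\<close>, which the compact support of \<open>q\<close>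
  makes integrable.\<close>

lemma integral_log_potential_mult_test_function:
  assumes q: "test_function q"
  shows "(\<integral>x. log_potential x * q x \<partial>lborel)
    = (\<integral>y. h y * ((\<integral>x. ln (norm (x - y)) * q x \<partial>lborel) - ln (1 + norm y) * (\<integral>x. q x \<partial>lborel)) \<partial>lborel)"
proof -
  note [measurable] = test_function_measurable[OF q]
  obtain R where R: "\<And>x. norm x > R \<Longrightarrow> q x = 0" by (rule test_function_support[OF q]) blast
  define F where "F x y = h y * (ln (norm (x - y)) - ln (1 + norm y)) * q x" for x y
  define B where "B = (\<integral>y. h y * (ln 2 + 2 * ln (1 + norm y)) \<partial>lborel) + near_mass + (\<integral>y. log_growth 1 y \<partial>lborel)"
  have [measurable]: "(\<lambda>p. F (fst p) (snd p)) \<in> borel_measurable (borel \<Otimes>\<^sub>M borel)" unfolding F_def by measurable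
  have F_meas: "case_prod F \<in> borel_measurable (lborel \<Otimes>\<^sub>M lborel)"
    by (simp add: case_prod_beta' measurable_cong_sets[OF sets_pair_measure_cong[OF sets_lborel sets_lborel] refl])
  have section_int: "integrable lborel (F x)" for x
    unfolding F_def[abs_def] using log_potential_integrable[of x] by simp
  have F_int: "integrable (lborel \<Otimes>\<^sub>M lborel) (case_prod F)"
  proof (rule lborel_pair.Fubini_integrable[OF F_meas])
    show "AE x in lborel. integrable lborel (\<lambda>y. case_prod F (x, y))" using section_int by simp
    let ?w = "\<lambda>x. \<bar>q x\<bar> * (B + ln (1 + norm x) * (\<integral>y. h y \<partial>lborel))"
    have w: "integrable lborel ?w"
    proof (rule integrable_compact_support)
      show "continuous_on UNIV ?w"
        by (intro continuous_on_mult continuous_on_rabs test_function_continuous[OF q] continuous_on_add continuous_on_const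
            continuous_on_ln continuous_on_norm continuous_on_id) (metis add_pos_nonneg less_irrefl norm_ge_zero zero_less_one)
      show "?w x = 0" if "norm x > R" for x using R[OF that] by simp
    qed
    show "integrable lborel (\<lambda>x. \<integral>y. norm (case_prod F (x, y)) \<partial>lborel)"
    proof (rule Bochner_Integration.integrable_bound[OF w])
      show "(\<lambda>x. \<integral>y. norm (case_prod F (x, y)) \<partial>lborel) \<in> borel_measurable lborel"
        using F_meas by (intro lborel.borel_measurable_lebesgue_integral) (simp add: case_prod_beta')
      show "AE x in lborel. norm (\<integral>y. norm (case_prod F (x, y)) \<partial>lborel) \<le> norm (?w x)"
      proof (rule AE_I2)
        fix x :: 'a
        have le: "norm (F x y) \<le> \<bar>q x\<bar> * (- (h y * log_kernel x y) + ln (1 + norm x) * h y)" for y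
        proof -
          have "\<bar>ln (norm (x - y)) - ln (1 + norm y)\<bar> \<le> - log_kernel x y + ln (1 + norm x)"
            using log_kernel_nonpos[of x y] ln_one_plus_norm_nonneg[of x] unfolding log_kernel_def by linarith
          then have "h y * \<bar>ln (norm (x - y)) - ln (1 + norm y)\<bar> \<le> h y * (- log_kernel x y + ln (1 + norm x))"
            by (rule mult_left_mono[OF _ h_nonneg])
          then have "\<bar>q x\<bar> * (h y * \<bar>ln (norm (x - y)) - ln (1 + norm y)\<bar>) \<le> \<bar>q x\<bar> * (h y * (- log_kernel x y + ln (1 + norm x)))"
            by (rule mult_left_mono) simp
          moreover have "norm (F x y) = \<bar>q x\<bar> * (h y * \<bar>ln (norm (x - y)) - ln (1 + norm y)\<bar>)"
            unfolding F_def real_norm_def abs_mult abs_of_nonneg[OF h_nonneg] by (rule mult.commute)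
          moreover have "h y * (- log_kernel x y + ln (1 + norm x)) = - (h y * log_kernel x y) + ln (1 + norm x) * h y"
            by (simp add: algebra_simps)
          ultimately show ?thesis by (simp only:)
        qed
        have "(\<integral>y. norm (F x y) \<partial>lborel) \<le> (\<integral>y. \<bar>q x\<bar> * (- (h y * log_kernel x y) + ln (1 + norm x) * h y) \<partial>lborel)"
          by (rule integral_mono[OF _ _ le]) (use section_int[of x] log_kernel_mult_integrable h_integrable in auto)
        also have "\<dots> = \<bar>q x\<bar> * (- (\<integral>y. h y * log_kernel x y \<partial>lborel) + ln (1 + norm x) * (\<integral>y. h y \<partial>lborel))"
          using log_kernel_mult_integrable h_integrable by simp
        also have "\<dots> \<le> ?w x"
          using log_kernel_mult_bound[of x] unfolding B_def by (intro mult_left_mono add_right_mono) auto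
        finally show "norm (\<integral>y. norm (case_prod F (x, y)) \<partial>lborel) \<le> norm (?w x)"
          by (simp add: abs_of_nonneg Bochner_Integration.integral_nonneg order_trans[OF _ abs_ge_self])
      qed
    qed
  qed
  have "(\<integral>x. log_potential x * q x \<partial>lborel) = (\<integral>x. (\<integral>y. F x y \<partial>lborel) \<partial>lborel)"
    unfolding F_def log_potential_def by simp
  also have "\<dots> = (\<integral>y. (\<integral>x. F x y \<partial>lborel) \<partial>lborel)"
    by (rule lborel_pair.Fubini_integral[OF F_int, symmetric])
  also have "\<dots> = (\<integral>y. h y * ((\<integral>x. ln (norm (x - y)) * q x \<partial>lborel) - ln (1 + norm y) * (\<integral>x. q x \<partial>lborel)) \<partial>lborel)"
  proof (rule Bochner_Integration.integral_cong[OF refl])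
    fix y :: 'a
    have iq: "integrable lborel q"
      by (rule integrable_compact_support[OF test_function_continuous[OF q] R])
    have "F x y = h y * (ln (norm (x - y)) * q x - ln (1 + norm y) * q x)" for x
      by (simp add: F_def algebra_simps)
    then show "(\<integral>x. F x y \<partial>lborel) = h y * ((\<integral>x. ln (norm (x - y)) * q x \<partial>lborel) - ln (1 + norm y) * (\<integral>x. q x \<partial>lborel))"
      using integrable_ln_norm_mult_test_function[OF q dim, of y] iq by simp
  qed
  finally show ?thesis .
qed

text \<open>The abstract equation for the measure \<open>h dx\<close>, rewritten with Lebesgue
  integrals. Dividing by \<open>Z\<close> turns \<open>h y * exp (w y)\<close> into a density of
  mass 1.\<close>

lemma mean_field_density:
  assumes mass: "(\<integral>y. h y \<partial>lborel) > 0" and \<beta>: "\<beta> \<ge> 0"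
  obtains w Z where "continuous_on UNIV w" "\<And>x. w x \<le> 0" "Z > 0"
    "(\<integral>y. h y * exp (w y) \<partial>lborel) = Z"
    "\<And>x. w x = \<beta> * (\<integral>y. h y * exp (w y) / Z * log_kernel x y \<partial>lborel)"
proof -
  define M where "M = density lborel (\<lambda>x. ennreal (h x))"
  have sets_M: "sets M = sets borel" and space_M: "space M = UNIV" by (simp_all add: M_def)
  have int_M: "(\<integral>y. f y \<partial>M) = (\<integral>y. h y * f y \<partial>lborel)" if "f \<in> borel_measurable borel" for f :: "'a \<Rightarrow> real"
    unfolding M_def using that by (intro integral_real_density) (auto simp: h_nonneg)
  have integrable_M: "integrable M f \<longleftrightarrow> integrable lborel (\<lambda>y. h y * f y)" if "f \<in> borel_measurable borel" for f :: "'a \<Rightarrow> real"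
    unfolding M_def using that by (intro integrable_real_density) (auto simp: h_nonneg)
  have emeasure_M: "emeasure M (space M) = ennreal (\<integral>y. h y \<partial>lborel)"
    unfolding M_def by (simp add: emeasure_density nn_integral_eq_integral[OF h_integrable] h_nonneg)
  have lk: "(\<lambda>y. log_kernel x y) \<in> borel_measurable borel" "(\<lambda>y. \<bar>log_kernel x' y - log_kernel x y\<bar>) \<in> borel_measurable borel" for x x' :: 'a
    unfolding log_kernel_def by measurable
  define B where "B = (\<integral>y. h y * (ln 2 + 2 * ln (1 + norm y)) \<partial>lborel) + near_mass + (\<integral>y. log_growth 1 y \<partial>lborel)"
  interpret finite_measure M
    by (rule finite_measureI) (simp add: emeasure_M)
  interpret equicontinuous_mean_field_kernel M log_kernel B
  proof unfold_locales
    show "case_prod log_kernel \<in> borel_measurable (M \<Otimes>\<^sub>M M)"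
      unfolding measurable_cong_sets[OF sets_pair_measure_cong[OF sets_M sets_M] refl] by (rule log_kernel_measurable)
    show "log_kernel x y = log_kernel y x" for x y :: 'a by (rule log_kernel_commute)
    show "log_kernel x y \<le> 0" for x y :: 'a by (rule log_kernel_nonpos)
    show "integrable M (log_kernel x)" for x
      using log_kernel_mult_integrable by (simp add: integrable_M lk)
    show "- B \<le> (\<integral>y. log_kernel x y \<partial>M)" for x
      using log_kernel_mult_bound[of x] by (simp add: int_M lk B_def)
    show "measure M (space M) > 0"
      using mass unfolding measure_def emeasure_M by simp
    show "sets M = sets borel" by (rule sets_M)
    show "((\<lambda>x'. \<integral>y. \<bar>log_kernel x' y - log_kernel x y\<bar> \<partial>M) \<longlongrightarrow> 0) (at x)" for x
      using log_kernel_continuous[of x] by (simp add: int_M lk)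
  qed
  obtain w where w: "continuous_on UNIV w" "\<And>x. w x \<le> 0" "(\<integral>y. exp (w y) \<partial>M) > 0"
    "\<And>x. w x = \<beta> * (\<integral>y. log_kernel x y * exp (w y) \<partial>M) / (\<integral>y. exp (w y) \<partial>M)"
    by (rule mean_field_equation[OF \<beta>]) blast
  have [measurable]: "w \<in> borel_measurable borel" by (rule borel_measurable_continuous_onI[OF w(1)])
  define Z where "Z = (\<integral>y. exp (w y) \<partial>M)"
  have Z: "(\<integral>y. h y * exp (w y) \<partial>lborel) = Z" unfolding Z_def by (subst int_M) simp_all
  have "w x = \<beta> * (\<integral>y. h y * exp (w y) / Z * log_kernel x y \<partial>lborel)" for x
  proof -
    have "(\<lambda>y. log_kernel x y * exp (w y)) \<in> borel_measurable borel" by (intro borel_measurable_times lk) measurable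
    then have "w x = \<beta> * (\<integral>y. h y * (log_kernel x y * exp (w y)) \<partial>lborel) / Z"
      using w(4)[of x] by (simp add: Z_def[symmetric] int_M)
    also have "\<dots> = \<beta> * (\<integral>y. h y * (log_kernel x y * exp (w y)) / Z \<partial>lborel)" by simp
    also have "(\<lambda>y. h y * (log_kernel x y * exp (w y)) / Z) = (\<lambda>y. h y * exp (w y) / Z * log_kernel x y)"
      by (rule ext) simp
    finally show ?thesis .
  qed
  then show ?thesis using that[OF w(1,2) _ Z] w(3) unfolding Z_def by blast
qed

end

section \<open>Assembling the solution\<close>

lemma continuous_nonneg_integral_pos:
  fixes h :: "'a::euclidean_space \<Rightarrow> real"
  assumes c: "continuous_on UNIV h" and int: "integrable lborel h" and nn: "\<And>x. 0 \<le> h x" and x0: "h x0 \<noteq> 0"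
  shows "(\<integral>x. h x \<partial>lborel) > 0"
proof -
  have "(\<integral>x. h x \<partial>lborel) \<noteq> 0"
  proof
    assume "(\<integral>x. h x \<partial>lborel) = 0"
    then have "AE x in lborel. h x = 0" using integral_nonneg_eq_0_iff_AE[OF int] nn by simp
    moreover have op: "open {x. h x \<noteq> 0}" by (rule open_Collect_neq[OF c continuous_on_const])
    moreover from op have "{x. h x \<noteq> 0} \<in> sets lborel" by simp
    ultimately have "{x. h x \<noteq> 0} \<in> null_sets lborel" by (subst AE_iff_null_sets) simp_all
    then have "negligible {x. h x \<noteq> 0}"
      by (simp add: negligible_iff_null_sets null_sets_completionI)
    then show False using open_not_negligible[OF op] x0 by blast
  qed
  moreover have "(\<integral>x. h x \<partial>lborel) \<ge> 0" by (intro Bochner_Integration.integral_nonneg nn)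
  ultimately show ?thesis by simp
qed

text \<open>Lying strictly below the supremum leaves room for an admissible exponent beyond
  \<open>\<alpha>\<close>, and the gap yields the logarithmic moment of \<open>h\<close>. Borel
  measurability lets integrability pass from the completed measure to \<open>lborel\<close>.\<close>

lemma alpha1_less_imp_integrable:
  assumes "ereal \<alpha> < alpha1 n K" and K: "K \<in> borel_measurable borel"
  obtains \<beta> where "\<alpha> < \<beta>" "integrable lborel (\<lambda>x. K x * (1 + norm x) powr (2 * real n * \<beta>))"
proof -
  obtain \<beta> where \<beta>: "\<alpha> < \<beta>" "integrable lebesgue (\<lambda>x. K x * (1 + norm x) powr (2 * real n * \<beta>))"
    using assms(1) unfolding alpha1_def less_Sup_iff by auto
  have "(\<lambda>x. K x * (1 + norm x) powr (2 * real n * \<beta>)) \<in> borel_measurable lborel" using K by measurable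
  then show ?thesis using that \<beta> integrable_completion by blast
qed

theorem theorem1p5:
  fixes n :: nat and K :: "real ^ 'm \<Rightarrow> real" and \<alpha> :: real
  assumes "n \<ge> 2"
    and "CARD('m) = 2 * n"
    and "continuous_on UNIV K"
    and "\<exists>x. K x \<noteq> 0"
    and "\<forall>x. K x \<le> 0"
    and "\<exists>C>0. \<exists>lam\<ge>0. \<forall>x. \<bar>K x\<bar> \<le> C * (norm x powr lam + 1)"
    and "alpha1 n K > 0"
    and "0 < \<alpha>" and "ereal \<alpha> < alpha1 n K"
  shows "\<exists>u. is_solution n K u \<and>
           (\<exists>l::real. ((\<lambda>x. u x - \<alpha> * ln (norm x)) \<longlongrightarrow> l) at_infinity)"
proof -
  have d: "DIM(real ^ 'm) = 2 * n" using assms(2) by simp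
  have n: "n \<ge> 2" by fact
  obtain \<gamma> where \<gamma>: "\<gamma> > 0"
    and fund: "\<And>\<phi> y::real ^ 'm. test_function \<phi> \<Longrightarrow> (\<integral>x. ln (norm (x - y)) * neg_laplacian_pow n \<phi> x \<partial>lborel) = - \<gamma> * \<phi> y"
    by (rule neg_laplacian_pow_fundamental_solution[OF d n]) blast
  have K_meas [measurable]: "K \<in> borel_measurable borel" by (rule borel_measurable_continuous_onI) fact
  obtain \<beta> where \<beta>: "\<alpha> < \<beta>" and int_\<beta>: "integrable lborel (\<lambda>x. K x * (1 + norm x) powr (2 * real n * \<beta>))"
    by (rule alpha1_less_imp_integrable[OF assms(9) K_meas])
  obtain C lam where C: "C > 0" and lam: "lam \<ge> 0" and growth: "\<And>x. \<bar>K x\<bar> \<le> C * (norm x powr lam + 1)"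
    using assms(6) by blast
  have one: "1 \<le> 1 + norm x" "0 < 1 + norm x" for x :: "real ^ 'm" by (simp_all add: add_pos_nonneg)
  \<comment> \<open>Both the exponent of the weight in \<open>h\<close> and the coupling of the mean
    field equation: the logarithm absorbed into \<open>h\<close> carries the same factor as the
    kernel.\<close>
  define b where "b = 2 * real n * \<alpha>"
  have b: "b > 0" using n assms(8) by (simp add: b_def)
  define h where "h x = - K x * (1 + norm x) powr b" for x
  have h_nonneg: "0 \<le> h x" for x unfolding h_def using assms(5) by (simp add: mult_nonpos_nonneg)
  have h_cont: "continuous_on UNIV h"
    unfolding h_def using one(2) assms(3)
    by (intro continuous_on_mult continuous_on_minus continuous_on_powr continuous_on_add continuous_on_norm
        continuous_on_id continuous_on_const) (auto simp: less_imp_neq[symmetric])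
  \<comment> \<open>The factor 2 absorbs the summand 1 into \<open>(1 + norm x) powr lam\<close>,
    which is at least 1.\<close>
  have h_growth: "h x \<le> (2 * C) * (1 + norm x) powr (lam + b)" for x
  proof -
    have "norm x powr lam \<le> (1 + norm x) powr lam" using lam by (intro powr_mono2) auto
    moreover have "1 \<le> (1 + norm x) powr lam" using lam one by (intro ge_one_powr_ge_zero) auto
    ultimately have "norm x powr lam + 1 \<le> 2 * (1 + norm x) powr lam" by linarith
    then have "C * (norm x powr lam + 1) \<le> C * (2 * (1 + norm x) powr lam)" using C by (intro mult_left_mono) auto
    then have "- K x \<le> 2 * C * (1 + norm x) powr lam" using growth[of x] by linarith
    then have "- K x * (1 + norm x) powr b \<le> 2 * C * (1 + norm x) powr lam * (1 + norm x) powr b"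
      by (rule mult_right_mono) simp
    then show ?thesis by (simp add: h_def powr_add mult.assoc)
  qed
  \<comment> \<open>The excess of \<open>2 * real n * \<beta>\<close> over \<open>b\<close>; it
    absorbs the logarithm because \<open>ln t \<le> t powr \<delta> / \<delta>\<close> for
    \<open>t \<ge> 1\<close>.\<close>
  define \<delta> where "\<delta> = 2 * real n * (\<beta> - \<alpha>)"
  have \<delta>: "\<delta> > 0" using \<beta> n by (simp add: \<delta>_def)
  let ?k = "\<lambda>x. \<bar>K x * (1 + norm x) powr (2 * real n * \<beta>)\<bar>"
  have k_int: "integrable lborel ?k" using int_\<beta> by simp
  have k_eq: "?k x = h x * (1 + norm x) powr \<delta>" for x
  proof -
    have "2 * real n * \<beta> = b + \<delta>" by (simp add: b_def \<delta>_def algebra_simps)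
    then show ?thesis using assms(5) by (simp add: h_def powr_add abs_mult abs_of_nonpos)
  qed
  have [measurable]: "h \<in> borel_measurable borel" by (rule borel_measurable_continuous_onI[OF h_cont])
  have h_int: "integrable lborel h"
  proof (rule Bochner_Integration.integrable_bound[OF k_int])
    show "AE x in lborel. norm (h x) \<le> norm (?k x)"
    proof (rule AE_I2)
      fix x :: "real ^ 'm"
      have "h x * 1 \<le> h x * (1 + norm x) powr \<delta>"
        using \<delta> one by (intro mult_left_mono h_nonneg ge_one_powr_ge_zero) auto
      then show "norm (h x) \<le> norm (?k x)" unfolding k_eq using h_nonneg[of x] by simp
    qed
  qed simp
  have h_log_int: "integrable lborel (\<lambda>x. h x * ln (1 + norm x))"
  proof (rule Bochner_Integration.integrable_bound[of _ "\<lambda>x. ?k x / \<delta>"])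
    show "integrable lborel (\<lambda>x. ?k x / \<delta>)" using k_int by simp
    show "AE x in lborel. norm (h x * ln (1 + norm x)) \<le> norm (?k x / \<delta>)"
    proof (rule AE_I2)
      fix x :: "real ^ 'm"
      have "h x * ln (1 + norm x) \<le> h x * ((1 + norm x) powr \<delta> / \<delta>)"
        using \<delta> one by (intro mult_left_mono h_nonneg ln_powr_bound) auto
      moreover have "0 \<le> h x * ln (1 + norm x)" using h_nonneg[of x] by simp
      ultimately show "norm (h x * ln (1 + norm x)) \<le> norm (?k x / \<delta>)" unfolding k_eq using \<delta> h_nonneg[of x] by (simp add: abs_mult)
    qed
  qed simp
  interpret H: log_density h "2 * C" "lam + b"
    by unfold_locales (use h_nonneg h_growth h_int h_log_int C lam b d n in auto)
  obtain x0 where "K x0 \<noteq> 0" using assms(4) by blast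
  then have "h x0 \<noteq> 0" using one(2)[of x0] by (simp add: h_def)
  from continuous_nonneg_integral_pos[OF h_cont h_int h_nonneg this]
  have mass: "(\<integral>y. h y \<partial>lborel) > 0" .
  obtain w Z where w: "continuous_on UNIV w" "\<And>x. w x \<le> 0" and Z: "Z > 0"
    and Z_eq: "(\<integral>y. h y * exp (w y) \<partial>lborel) = Z"
    and w_eq: "\<And>x. w x = b * (\<integral>y. h y * exp (w y) / Z * log_kernel x y \<partial>lborel)"
    by (rule H.mean_field_density[OF mass less_imp_le[OF b]]) blast
  define f where "f y = h y * exp (w y) / Z" for y
  have f_cont: "continuous_on UNIV f"
    unfolding f_def using Z by (intro continuous_on_divide continuous_on_mult h_cont continuous_on_exp w continuous_on_const) simp
  have [measurable]: "f \<in> borel_measurable borel" by (rule borel_measurable_continuous_onI[OF f_cont])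
  have f_nonneg: "0 \<le> f x" for x unfolding f_def using h_nonneg[of x] Z by simp
  have f_le: "f x \<le> h x / Z" for x
  proof -
    have "h x * exp (w x) \<le> h x * 1" using w(2)[of x] by (intro mult_left_mono h_nonneg) simp
    then show ?thesis unfolding f_def using Z by (simp add: divide_right_mono)
  qed
  have f_int: "integrable lborel f"
    by (rule Bochner_Integration.integrable_bound[of _ "\<lambda>x. h x / Z"])
      (use h_int f_le f_nonneg h_nonneg Z in \<open>auto intro!: AE_I2\<close>)
  have f_log_int: "integrable lborel (\<lambda>x. f x * ln (1 + norm x))"
  proof (rule Bochner_Integration.integrable_bound[of _ "\<lambda>x. h x * ln (1 + norm x) / Z"])
    show "AE x in lborel. norm (f x * ln (1 + norm x)) \<le> norm (h x * ln (1 + norm x) / Z)"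
    proof (rule AE_I2)
      fix x :: "real ^ 'm"
      have "f x * ln (1 + norm x) \<le> h x / Z * ln (1 + norm x)" by (intro mult_right_mono f_le) simp
      moreover have "0 \<le> f x * ln (1 + norm x)" using f_nonneg[of x] by simp
      ultimately show "norm (f x * ln (1 + norm x)) \<le> norm (h x * ln (1 + norm x) / Z)"
        using h_nonneg[of x] Z by (simp add: abs_mult)
    qed
  qed (use h_log_int in auto)
  have f_growth: "f x \<le> (2 * C / Z) * (1 + norm x) powr (lam + b)" for x
    using f_le[of x] divide_right_mono[OF h_growth[of x], of Z] Z by simp
  interpret F: log_density f "2 * C / Z" "lam + b"
    by unfold_locales (use f_nonneg f_growth f_int f_log_int C Z lam b d n in auto)
  have f_mass: "(\<integral>y. f y \<partial>lborel) = 1"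
    unfolding f_def using Z_eq Z by simp
  \<comment> \<open>Mass 1 of \<open>f\<close> makes the passage from kernel to potential cost
    exactly \<open>ln (1 + norm x)\<close>.\<close>
  have w_pot: "w x = b * (F.log_potential x - ln (1 + norm x))" for x
    using w_eq[of x] by (simp add: F.log_potential_eq f_mass f_def[symmetric])
  \<comment> \<open>Chosen so that \<open>exp (2 * real n * c) = \<alpha> * \<gamma> / Z\<close>,
    the factor that turns \<open>K x * (1 + norm x) powr b * exp (w x)\<close> into
    \<open>- (\<alpha> * \<gamma>) * f x\<close>.\<close>
  define c where "c = ln (\<alpha> * \<gamma> / Z) / (2 * real n)"
  define u where "u x = \<alpha> * F.log_potential x + c" for x
  have pot: "F.log_potential x = w x / b + ln (1 + norm x)" for x
    using w_pot[of x] b by (simp add: field_simps)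
  \<comment> \<open>Read backwards, the mean field equation transfers the continuity of
    \<open>w\<close> to the potential of \<open>f\<close>.\<close>
  have pot_cont: "continuous_on UNIV F.log_potential"
    unfolding pot[abs_def] using one(2) b
    by (intro continuous_on_add continuous_on_divide w continuous_on_const continuous_on_ln continuous_on_norm continuous_on_id)
      (auto simp: less_imp_neq[symmetric])
  have u_cont: "continuous_on UNIV u"
    unfolding u_def by (intro continuous_on_add continuous_on_mult continuous_on_const pot_cont)
  have K_exp: "K x * exp (2 * real n * u x) = - (\<alpha> * \<gamma>) * f x" for x
  proof -
    have "2 * real n * u x = b * F.log_potential x + ln (\<alpha> * \<gamma> / Z)"
      using n by (simp add: u_def c_def b_def field_simps)
    also have "\<dots> = w x + b * ln (1 + norm x) + ln (\<alpha> * \<gamma> / Z)"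
      using b by (simp add: pot distrib_left)
    finally have "exp (2 * real n * u x) = exp (w x) * (1 + norm x) powr b * (\<alpha> * \<gamma> / Z)"
      using one(2)[of x] \<gamma> Z assms(8) by (simp add: exp_add powr_def)
    then show ?thesis by (simp add: f_def h_def)
  qed
  have sol: "(\<integral>x. u x * neg_laplacian_pow n \<phi> x \<partial>lebesgue) = (\<integral>x. K x * exp (2 * real n * u x) * \<phi> x \<partial>lebesgue)"
    if \<phi>: "test_function \<phi>" for \<phi> :: "real ^ 'm \<Rightarrow> real"
  proof -
    let ?q = "neg_laplacian_pow n \<phi>"
    have q: "test_function ?q" by (rule test_function_neg_laplacian_pow[OF \<phi>])
    note [measurable] = test_function_measurable[OF q] test_function_measurable[OF \<phi>] borel_measurable_continuous_onI[OF u_cont]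
    obtain R where R: "\<And>x. norm x > R \<Longrightarrow> ?q x = 0" by (rule test_function_support[OF q]) blast
    have q_int: "integrable lborel ?q" by (rule integrable_compact_support[OF test_function_continuous[OF q] R])
    have pq_int: "integrable lborel (\<lambda>x. F.log_potential x * ?q x)"
      by (rule integrable_compact_support[where R=R])
        (use R in \<open>auto intro: continuous_on_mult pot_cont test_function_continuous[OF q]\<close>)
    \<comment> \<open>This annihilates both the constant \<open>c\<close> and the term with
      \<open>ln (1 + norm y)\<close>.\<close>
    have q0: "(\<integral>x. ?q x \<partial>lborel) = 0" using n by (intro integral_neg_laplacian_pow_eq_0[OF \<phi>]) simp
    have "(\<integral>x. u x * ?q x \<partial>lebesgue) = (\<integral>x. u x * ?q x \<partial>lborel)" by (rule integral_completion) measurable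
    also have "\<dots> = (\<integral>x. \<alpha> * (F.log_potential x * ?q x) + c * ?q x \<partial>lborel)"
      by (simp add: u_def algebra_simps)
    also have "\<dots> = \<alpha> * (\<integral>x. F.log_potential x * ?q x \<partial>lborel)"
      using pq_int q_int q0 by simp
    also have "\<dots> = \<alpha> * (\<integral>y. f y * (- \<gamma> * \<phi> y) \<partial>lborel)"
      by (simp add: F.integral_log_potential_mult_test_function[OF q] fund[OF \<phi>] q0)
    also have "\<dots> = (\<integral>y. \<alpha> * (f y * (- \<gamma> * \<phi> y)) \<partial>lborel)" by simp
    also have "\<dots> = (\<integral>x. K x * exp (2 * real n * u x) * \<phi> x \<partial>lborel)"
      unfolding K_exp by (rule Bochner_Integration.integral_cong[OF refl]) simp
    also have "\<dots> = (\<integral>x. K x * exp (2 * real n * u x) * \<phi> x \<partial>lebesgue)"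
      by (rule integral_completion[symmetric]) measurable
    finally show ?thesis .
  qed
  have "((\<lambda>x. \<alpha> * (F.log_potential x - (\<integral>y. f y \<partial>lborel) * ln (norm x)) + c)
      \<longlongrightarrow> \<alpha> * - (\<integral>y. f y * ln (1 + norm y) \<partial>lborel) + c) at_infinity"
    by (intro tendsto_add tendsto_mult tendsto_const F.log_potential_at_infinity)
  then have "((\<lambda>x. u x - \<alpha> * ln (norm x)) \<longlongrightarrow> \<alpha> * - (\<integral>y. f y * ln (1 + norm y) \<partial>lborel) + c) at_infinity"
    by (simp add: f_mass u_def algebra_simps)
  moreover have "is_solution n K u" unfolding is_solution_def using u_cont sol by blast
  ultimately show ?thesis by blast
qed

end
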